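(* Let $t(n)=s_2(n) \bmod 2\in\{0,1\}$ denote the Thue--Morse sequence, where $s_2(n)$ is the sum of the binary digits of $n$, and let $\mu$ be the M\"obius function. Then, as $N\to\infty$, \[ \sum_{n< N} \mu(n)\, t(n^2) = o(N). \]
   Context: $\mu(n)=(-1)^{\omega(n)}$ if $n$ is squarefree and $\mu(n)=0$ otherwise, where $\omega(n)$ is the number of distinct prime factors of $n$. *)

theory Defs
  imports Complex_Main "HOL-Library.Landau_Symbols" "HOL-Computational_Algebra.Squarefree"
begin

fun binary_digit_sum :: "nat \<Rightarrow> nat" where
  "binary_digit_sum n = (if n = 0 then 0 else n mod 2 + binary_digit_sum (n div 2))"

declare binary_digit_sum.simps [simp del]

definition thue_morse :: "nat \<Rightarrow> nat" where
  "thue_morse n = binary_digit_sum n mod 2"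

(* 0 is not squarefree, so moebius_mu 0 = 0. *)
definition moebius_mu :: "nat \<Rightarrow> int" where
  "moebius_mu n = (if squarefree n then (-1) ^ card (prime_factors n) else 0)"

end

theory Submission
  imports Defs "HOL-Complex_Analysis.Complex_Analysis" "HOL-Real_Asymp.Real_Asymp"
begin

text \<open>
  Write \<open>f(n) = (-1) ^ s\<^sub>2(n)\<close>, so that \<open>t = (1 - f) / 2\<close>. The constant part contributes the summatory function of
  \<open>\<mu>\<close>, which is \<open>o(N)\<close> by Newman's contour argument and the non-vanishing of \<open>\<zeta>\<close> on the line \<open>Re s = 1\<close>.
  For the oscillating part, the Katai--Bourgain--Sarnak--Ziegler criterion (a Turan--Kubilius estimate and Cauchy--Schwarz)
  reduces the claim to \<open>\<Sum>n<N. f(a n\<^sup>2) f(b n\<^sup>2) = o(N)\<close> for distinct odd \<open>a\<close>, \<open>b\<close>.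

  For this correlation the method of Mauduit and Rivat is used qualitatively. Differencing \<open>n\<^sup>2\<close> against \<open>(n + r)\<^sup>2\<close>
  removes the influence of the digits at positions beyond \<open>log\<^sub>2 N + O(1)\<close>, because long carries are rare. Averaging over
  shifts of \<open>n\<close> by multiples of \<open>2 ^ u\<close>, a small fixed proportion of \<open>N\<close>, removes the digits below \<open>u\<close>. What remains is
  a function of a window of \<open>W\<close> digits, with \<open>W\<close> fixed while \<open>N\<close> tends to infinity; by equidistribution of
  \<open>n\<^sup>2 / 2 ^ (u + W)\<close>, of \<open>n mod 2 ^ W\<close> and of \<open>n / N\<close> it is controlled by the mean square of the autocorrelation of
  \<open>x \<mapsto> f(a x + i) f(b x + j)\<close> modulo \<open>2 ^ W\<close>. That mean square tends to \<open>0\<close> with growing \<open>W\<close> because the Fourier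
  transform of this function tends to \<open>0\<close> uniformly.
\<close>

section \<open>Thue--Morse signs and their Fourier transform\<close>

text \<open>The order of the choices lets qualitative estimates suffice. The number \<open>K\<close>
  of shifts is fixed first, from the target accuracy; then the width \<open>W\<close>, so large that
  the normalised Fourier transform is below 1 / K and that K shifts by 2^u are still short against
  N; only then does N grow. Hence equidistribution is needed for finitely many frequencies at a
  time, and a single van der Corput differencing supplies it. Positivity is the other
  simplification: the shift averages enter through their squares, so upper bounds for the number of
  n in a cell are enough and a Fejer majorant replaces asymptotic counts. The digits of a n^2 and b
  n^2 must be controlled jointly. Both integer parts after division by 2^u are read off from the
  integer part of a b n^2 / 2^u, so one equidistributed quantity governs both; this is where the
  modulus 2^W a b comes from. Beyond positivity, the hypotheses on a and b enter through one fact: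
  some y has a y and b y of opposite signs. This makes one block of digits contract the Fourier
  transform, whatever the incoming carries are.\<close>

definition tm_sign :: "nat \<Rightarrow> real" where
  "tm_sign n = (-1) ^ binary_digit_sum n"

lemma tm_sign_0 [simp]: "tm_sign 0 = 1"
  by (simp add: tm_sign_def binary_digit_sum.simps)

lemma tm_sign_double [simp]: "tm_sign (2 * n) = tm_sign n"
  unfolding tm_sign_def by (subst binary_digit_sum.simps) (auto simp: binary_digit_sum.simps[of 0])

lemma tm_sign_double_Suc [simp]: "tm_sign (Suc (2 * n)) = - tm_sign n"
  unfolding tm_sign_def by (subst binary_digit_sum.simps) simp

lemma tm_sign_square [simp]: "tm_sign n * tm_sign n = 1"
  by (simp add: tm_sign_def flip: power_mult_distrib)

lemma abs_tm_sign [simp]: "\<bar>tm_sign n\<bar> = 1"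
  by (simp add: tm_sign_def power_abs)

lemma tm_sign_cases: "tm_sign n = 1 \<or> tm_sign n = -1"
  using abs_tm_sign[of n] by linarith

lemma tm_sign_append: "x < 2 ^ e \<Longrightarrow> tm_sign (x + 2 ^ e * y) = tm_sign x * tm_sign y"
proof (induction e arbitrary: x)
  case 0
  then show ?case by simp
next
  case (Suc e)
  define u where "u = x div 2"
  have u: "u < 2 ^ e" using Suc.prems by (auto simp: u_def)
  show ?case
  proof (cases "even x")
    case True
    then have x: "x = 2 * u" by (simp add: u_def)
    have "x + 2 ^ Suc e * y = 2 * (u + 2 ^ e * y)" by (simp add: x algebra_simps)
    then show ?thesis using Suc.IH[OF u] by (simp only: x tm_sign_double)
  next
    case False
    then have x: "x = Suc (2 * u)" by (simp add: u_def)
    have "x + 2 ^ Suc e * y = Suc (2 * (u + 2 ^ e * y))" by (simp add: x algebra_simps)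
    then have "tm_sign (x + 2 ^ Suc e * y) = - tm_sign (u + 2 ^ e * y)" by (simp only: tm_sign_double_Suc)
    then show ?thesis using Suc.IH[OF u] by (simp add: x)
  qed
qed

lemma tm_sign_split: "tm_sign n = tm_sign (n mod 2 ^ e) * tm_sign (n div 2 ^ e)"
  using tm_sign_append[of "n mod 2 ^ e" e "n div 2 ^ e"] by simp

lemma tm_sign_mod_split:
  "tm_sign (n mod 2 ^ (L + W)) = tm_sign (n mod 2 ^ L) * tm_sign ((n div 2 ^ L) mod 2 ^ W)"
proof -
  have "n mod 2 ^ (L + W) = n mod 2 ^ L + 2 ^ L * ((n div 2 ^ L) mod 2 ^ W)"
    by (simp add: power_add mod_mult2_eq)
  then show ?thesis by (simp add: tm_sign_append)
qed

section \<open>Separating the signs of two odd dilates\<close>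

text \<open>Suppose the signs always agree. Take a y just above 2^k, so that a y has a digit 1 at
  position k while b y stays below 2^k. Adding 2^k a to y turns the upper block of a y from 1 into 1
  + a^2 and that of b y from 0 into a b; comparing signs forces 1 + a^2 and a^2 to have opposite
  signs. But a^2 is 1 modulo 4, so adding 1 turns the last digits 01 into 10 and keeps the
  sign.\<close>

lemma tm_sign_multiples_differ_aux:
  fixes a b :: nat
  assumes "odd a" "b < a"
  shows "\<exists>y. tm_sign (a * y) \<noteq> tm_sign (b * y)"
proof (rule ccontr)
  assume "\<not> ?thesis"
  then have eq: "tm_sign (a * y) = tm_sign (b * y)" for y by simp
  have a0: "a > 0" using assms by auto
  \<comment> \<open>Makes a^2 small against 2^k, so that b y stays below 2^k even for b = a -
    1.\<close>
  define k where "k = 2 * a * a"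
  define y where "y = 2 ^ k div a + 1"
  have k: "2 * a * a < 2 ^ k" unfolding k_def by (rule less_exp)
  have ay1: "2 ^ k < a * y" and ay2: "a * y \<le> 2 ^ k + a"
    unfolding y_def using a0 by (auto simp: dividend_less_times_div)
  have "a * (b * y) = b * (a * y)" by simp
  also have "\<dots> \<le> b * (2 ^ k + a)" using ay2 by simp
  also have "\<dots> \<le> (a - 1) * (2 ^ k + a)" using assms by (intro mult_right_mono) auto
  also have "\<dots> < a * 2 ^ k"
  proof -
    obtain c where c: "a = Suc c" using a0 by (cases a) auto
    show ?thesis using k unfolding c by (simp add: algebra_simps)
  qed
  finally have by1: "b * y < 2 ^ k" using a0 by simp
  have "a \<le> 2 * a * a" using a0 by (cases a) auto
  then have ay3: "a * y < 2 * 2 ^ k" using ay2 k by linarith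
  define x where "x = a * y - 2 ^ k"
  have x: "x < 2 ^ k" "a * y = x + 2 ^ k * 1" unfolding x_def using ay1 ay3 by auto
  have sx: "tm_sign (b * y) = - tm_sign x"
    using tm_sign_append[OF x(1), of 1] tm_sign_double_Suc[of 0] eq[of y] x(2) by simp
  have "tm_sign x * tm_sign (1 + a * a) = tm_sign (b * y) * tm_sign (b * a)"
    using eq[of "y + 2 ^ k * a"] tm_sign_append[OF x(1), of "1 + a * a"] tm_sign_append[OF by1, of "b * a"] x(2)
    by (simp add: algebra_simps)
  also have "\<dots> = - tm_sign x * tm_sign (a * a)" using eq[of a] sx by simp
  finally have contra: "tm_sign (1 + a * a) = - tm_sign (a * a)"
    using tm_sign_cases[of x] by auto
  obtain c where c: "a = Suc (2 * c)" using assms by (metis oddE Suc_eq_plus1)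
  define v where "v = c * c + c"
  have "a * a = Suc (2 * (2 * v))" unfolding c v_def by (simp add: algebra_simps)
  moreover have "1 + a * a = 2 * Suc (2 * v)" unfolding c v_def by (simp add: algebra_simps)
  ultimately have "tm_sign (1 + a * a) = - tm_sign v" "tm_sign (a * a) = - tm_sign v"
    by (simp_all only: tm_sign_double tm_sign_double_Suc)
  with contra tm_sign_cases[of v] show False by auto
qed

lemma tm_sign_multiples_differ:
  fixes a b :: nat
  assumes "odd a" "odd b" "a \<noteq> b"
  obtains y where "tm_sign (a * y) * tm_sign (b * y) = -1"
proof -
  have "\<exists>y. tm_sign (a * y) \<noteq> tm_sign (b * y)"
    using tm_sign_multiples_differ_aux[of a b] tm_sign_multiples_differ_aux[of b a] assms
    by (metis linorder_neqE_nat)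
  then obtain y where "tm_sign (a * y) \<noteq> tm_sign (b * y)" by blast
  then have "tm_sign (a * y) * tm_sign (b * y) = -1"
    using tm_sign_cases[of "a * y"] tm_sign_cases[of "b * y"] by auto
  then show ?thesis by (rule that)
qed

section \<open>Digit windows with carries and their Fourier transform\<close>

text \<open>\<open>i\<close> and \<open>j\<close> are the carries arriving from the digits below the
  window. For multiples by a and b they satisfy i < a and j < b, and the bounds on
  \<open>tm_fourier\<close> are uniform over this range.\<close>

definition tm_window :: "nat \<Rightarrow> nat \<Rightarrow> nat \<Rightarrow> nat \<Rightarrow> nat \<Rightarrow> nat \<Rightarrow> real" where
  "tm_window a b W i j x = tm_sign ((a * x + i) mod 2 ^ W) * tm_sign ((b * x + j) mod 2 ^ W)"

lemma abs_tm_window [simp]: "\<bar>tm_window a b W i j x\<bar> = 1"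
  by (simp add: tm_window_def abs_mult)

lemma tm_window_mod: "tm_window a b W i j (x mod 2 ^ W) = tm_window a b W i j x"
proof -
  have "(c * (x mod 2 ^ W) + k) mod 2 ^ W = (c * x + k) mod 2 ^ W" for c k :: nat
    by (metis mod_add_left_eq mod_mult_right_eq)
  then show ?thesis unfolding tm_window_def by simp
qed

text \<open>The low L digits act on the window above them only through the two carries they produce:
  a transfer step whose state is the pair of carries.\<close>

lemma tm_window_split:
  assumes "m < 2 ^ L"
  shows "tm_window a b (L + W) i j (m + 2 ^ L * x) =
    tm_window a b L i j m * tm_window a b W ((a * m + i) div 2 ^ L) ((b * m + j) div 2 ^ L) x"
proof -
  have *: "tm_sign ((c * (m + 2 ^ L * x) + k) mod 2 ^ (L + W)) =
     tm_sign ((c * m + k) mod 2 ^ L) * tm_sign ((c * x + (c * m + k) div 2 ^ L) mod 2 ^ W)" for c k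
  proof -
    have "c * (m + 2 ^ L * x) + k = (c * m + k) + 2 ^ L * (c * x)" by (simp add: algebra_simps)
    then have "tm_sign ((c * (m + 2 ^ L * x) + k) mod 2 ^ (L + W)) =
        tm_sign (((c * m + k) + 2 ^ L * (c * x)) mod 2 ^ L) * tm_sign (((c * m + k) + 2 ^ L * (c * x)) div 2 ^ L mod 2 ^ W)"
      by (simp only: tm_sign_mod_split)
    also have "((c * m + k) + 2 ^ L * (c * x)) mod 2 ^ L = (c * m + k) mod 2 ^ L" by (rule mod_mult_self2)
    also have "((c * m + k) + 2 ^ L * (c * x)) div 2 ^ L = c * x + (c * m + k) div 2 ^ L" by simp
    finally show ?thesis .
  qed
  show ?thesis unfolding tm_window_def * by simp
qed

definition tm_fourier :: "nat \<Rightarrow> nat \<Rightarrow> nat \<Rightarrow> nat \<Rightarrow> nat \<Rightarrow> real \<Rightarrow> complex" where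
  "tm_fourier a b W i j t = (\<Sum>x<2 ^ W. of_real (tm_window a b W i j x) * cis (real x * t))"

lemma sum_lessThan_prod:
  fixes f :: "nat \<Rightarrow> 'a::comm_monoid_add"
  shows "(\<Sum>x<p * q. f x) = (\<Sum>m<p. \<Sum>x<q. f (m + p * x))"
proof -
  have "(\<Sum>x<q. \<Sum>m<p. f (m + p * x)) = (\<Sum>x<q. sum f {x * p..<x * p + p})"
  proof (rule sum.cong[OF refl])
    fix x
    have "sum f {0 + x * p..<p + x * p} = (\<Sum>m = 0..<p. f (m + x * p))"
      by (rule sum.shift_bounds_nat_ivl)
    then show "(\<Sum>m<p. f (m + p * x)) = sum f {x * p..<x * p + p}"
      by (simp add: atLeast0LessThan add.commute mult.commute)
  qed
  also have "\<dots> = (\<Sum>x<p * q. f x)" by (simp add: sum.nat_group mult.commute)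
  finally show ?thesis by (subst sum.swap) simp
qed

lemma tm_fourier_split:
  "tm_fourier a b (L + W) i j t = (\<Sum>m<2 ^ L. of_real (tm_window a b L i j m) * cis (real m * t) *
     tm_fourier a b W ((a * m + i) div 2 ^ L) ((b * m + j) div 2 ^ L) (2 ^ L * t))"
proof -
  have "tm_fourier a b (L + W) i j t = (\<Sum>m<2 ^ L. \<Sum>x<2 ^ W.
          of_real (tm_window a b (L + W) i j (m + 2 ^ L * x)) * cis (real (m + 2 ^ L * x) * t))"
    unfolding tm_fourier_def power_add by (rule sum_lessThan_prod)
  also have "\<dots> = (\<Sum>m<2 ^ L. of_real (tm_window a b L i j m) * cis (real m * t) *
     tm_fourier a b W ((a * m + i) div 2 ^ L) ((b * m + j) div 2 ^ L) (2 ^ L * t))"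
    unfolding tm_fourier_def sum_distrib_left
    by (intro sum.cong refl) (simp add: tm_window_split cis_mult distrib_right mult.assoc mult.left_commute)
  finally show ?thesis .
qed

lemma norm_tm_fourier_le: "norm (tm_fourier a b W i j t) \<le> 2 ^ W"
proof -
  have "norm (tm_fourier a b W i j t) \<le> (\<Sum>x<(2::nat) ^ W. 1)"
    unfolding tm_fourier_def by (rule sum_norm_le) (simp add: norm_mult)
  then show ?thesis by simp
qed

text \<open>Factoring out the middle phase leaves a number with real part s and imaginary part - 2
  sin t, of norm at most sqrt 5. What matters later is a bound strictly below the trivial 3.\<close>

lemma norm_three_signs_le:
  fixes t s :: real
  assumes "s = 1 \<or> s = -1"
  shows "norm (1 + of_real s * cis t - cis (2 * t)) \<le> 5 / 2"
proof -
  have "1 + of_real s * cis t - cis (2 * t) = cis t * (of_real s - 2 * \<i> * of_real (sin t))"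
    using assms cos_double_sin[of t] sin_double[of t]
    by (auto simp: complex_eq_iff power2_eq_square algebra_simps)
  then have "norm (1 + of_real s * cis t - cis (2 * t)) = norm (of_real s - 2 * \<i> * of_real (sin t))"
    by (simp add: norm_mult)
  also have "\<dots> = sqrt (1 + 4 * (sin t)\<^sup>2)"
    using assms by (auto simp: cmod_def power_mult_distrib)
  also have "\<dots> \<le> sqrt ((5 / 2)\<^sup>2)"
    using power2_le_iff_abs_le[of 1 "sin t"] by (intro real_sqrt_le_mono) (simp add: power2_eq_square)
  finally show ?thesis by simp
qed

text \<open>The three indices \<open>0\<close>, \<open>2 ^ e * y\<close> and \<open>2 ^ (e + 1) * y\<close> lead to the same carries while the
  first and the last carry opposite signs, so their terms cannot all point in the same direction.\<close>

lemma tm_fourier_contraction: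
  fixes a b :: nat
  assumes ab: "odd a" "odd b" "a \<noteq> b"
  shows "\<exists>L (c::real). 0 \<le> c \<and> c < 1 \<and>
    (\<forall>W B. B \<ge> 0 \<longrightarrow> (\<forall>i<a. \<forall>j<b. \<forall>t. norm (tm_fourier a b W i j t) \<le> B) \<longrightarrow>
       (\<forall>i<a. \<forall>j<b. \<forall>t. norm (tm_fourier a b (L + W) i j t) \<le> 2 ^ L * c * B))"
proof -
  obtain y where y: "tm_sign (a * y) * tm_sign (b * y) = -1"
    using tm_sign_multiples_differ[OF ab] by blast
  have y0: "y > 0" using y by (cases y) auto
  \<comment> \<open>The incoming carries fit below position e, so adding them to a multiple of 2^e
    causes no carry.\<close>
  define e where "e = a + b"
  define d where "d = 2 ^ e * y"
  \<comment> \<open>Large enough that a m + i and b m + j stay below 2^L at the three special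
    indices, so their outgoing carries are 0.\<close>
  define L where "L = (a + b) * (2 * d + 1)"
  have e: "a < 2 ^ e" "b < 2 ^ e" unfolding e_def
    by (meson le_add1 le_add2 less_exp order_le_less_trans)+
  have d0: "d > 0" unfolding d_def using y0 by simp
  have L: "(a + b) * (2 * d + 1) < 2 ^ L" unfolding L_def by (rule less_exp)
  have ab0: "a > 0" "b > 0" using ab by (auto intro: odd_pos)
  \<comment> \<open>Three of the 2^L terms contribute at most 5/2 in place of 3, and 2^L c = 2^L -
    1/2 records this saving.\<close>
  define c where "c = 1 - 1 / (2 * 2 ^ L :: real)"
  have "1 / (2 * 2 ^ L :: real) \<le> 1 / 2" by (simp add: divide_simps)
  then have c: "0 \<le> c" "c < 1" unfolding c_def by (linarith, simp)
  have mL: "m < 2 ^ L" if "m \<le> 2 * d" for m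
  proof -
    have "2 * d + 1 \<le> (a + b) * (2 * d + 1)" using ab0 by (cases a) auto
    then show ?thesis using that L by linarith
  qed
  have carry0: "a * m + i < 2 ^ L" "b * m + j < 2 ^ L" if "m \<le> 2 * d" "i < a" "j < b" for m i j
  proof -
    have "a * m + i \<le> a * (2 * d) + a" "b * m + j \<le> b * (2 * d) + b"
      using that by (auto intro!: add_mono mult_left_mono)
    moreover have "a * (2 * d) + a \<le> (a + b) * (2 * d + 1)" "b * (2 * d) + b \<le> (a + b) * (2 * d + 1)"
      by (auto simp: algebra_simps)
    ultimately show "a * m + i < 2 ^ L" "b * m + j < 2 ^ L" using L by linarith+
  qed
  have "norm (tm_fourier a b (L + W) i j t) \<le> 2 ^ L * c * B"
    if B: "B \<ge> (0::real)" and IH0: "\<forall>i<a. \<forall>j<b. \<forall>t. norm (tm_fourier a b W i j t) \<le> B"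
      and ij: "i < a" "j < b" for W B i j t
  proof -
    have IH: "norm (tm_fourier a b W i j t) \<le> B" if "i < a" "j < b" for i j t
      using IH0 that by blast
    define w where "w m = of_real (tm_window a b L i j m) * cis (real m * t)" for m
    define g where "g m = tm_fourier a b W ((a * m + i) div 2 ^ L) ((b * m + j) div 2 ^ L) (2 ^ L * t)" for m
    have gB: "norm (g m) \<le> B" if "m < 2 ^ L" for m
    proof -
      \<comment> \<open>Outgoing carries stay in the range below a and below b, so the hypothesis on
        windows of width \<open>W\<close> applies to them.\<close>
      have "c * m + k < c * 2 ^ L" if "k < c" for c k :: nat
      proof -
        have "c * m + k < c * Suc m" using that by simp
        also have "\<dots> \<le> c * 2 ^ L" using \<open>m < 2 ^ L\<close> by (intro mult_left_mono) auto
        finally show ?thesis .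
      qed
      then show ?thesis unfolding g_def using ij by (intro IH) (auto simp: less_mult_imp_div_less)
    qed
    have norm_w: "norm (w m) = 1" for m by (simp add: w_def norm_mult)
    define X where "X = {0, d, 2 * d}"
    have X: "X \<subseteq> {..<2 ^ L}" unfolding X_def using mL[of 0] mL[of d] mL[of "2 * d"] by auto
    have cX: "card X = 3" unfolding X_def using d0 by simp
    have gX: "g m = tm_fourier a b W 0 0 (2 ^ L * t)" if "m \<in> X" for m
    proof -
      have "m \<le> 2 * d" using that unfolding X_def by auto
      then show ?thesis using carry0[of m i j] ij by (simp add: g_def)
    qed
    have win: "tm_window a b L i j m = tm_sign (a * m + i) * tm_sign (b * m + j)" if "m \<in> X" for m
    proof -
      have "m \<le> 2 * d" using that unfolding X_def by auto
      then show ?thesis using carry0[of m i j] ij by (simp add: tm_window_def)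
    qed
    have ap: "tm_sign (a * (2 ^ e * v) + i) = tm_sign i * tm_sign (a * v)"
      "tm_sign (b * (2 ^ e * v) + j) = tm_sign j * tm_sign (b * v)" for v
      using tm_sign_append[of i e "a * v"] tm_sign_append[of j e "b * v"] ij e
      by (simp_all add: ac_simps)
    define s where "s = tm_sign i * tm_sign j"
    define s' where "s' = tm_sign (a * y) * tm_sign (b * y)"
    have win0: "tm_window a b L i j 0 = s" using win[of 0] by (simp add: X_def s_def)
    have win1: "tm_window a b L i j d = s * s'"
      using win[of d] ap[of y] by (simp add: X_def s_def s'_def d_def ac_simps)
    have win2: "tm_window a b L i j (2 * d) = s * s'"
    proof -
      have "2 * d = 2 ^ e * (2 * y)" by (simp add: d_def)
      moreover have "tm_sign (a * (2 * y)) = tm_sign (a * y)" "tm_sign (b * (2 * y)) = tm_sign (b * y)"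
        using tm_sign_double[of "a * y"] tm_sign_double[of "b * y"] by (simp_all add: ac_simps)
      ultimately show ?thesis using win[of "2 * d"] ap[of "2 * y"] by (simp add: X_def s_def s'_def ac_simps)
    qed
    have s: "\<bar>s\<bar> = 1" by (simp add: s_def abs_mult)
    have "(\<Sum>m\<in>X. w m) = of_real s * (1 + of_real (-1) * cis (real d * t) - cis (2 * (real d * t)))"
    proof -
      have "s' = -1" using y by (simp add: s'_def)
      then have "w 0 = of_real s" "w d = - of_real s * cis (real d * t)"
        "w (2 * d) = - of_real s * cis (2 * (real d * t))"
        unfolding w_def win0 win1 win2 by (simp_all add: mult.assoc)
      moreover have "(\<Sum>m\<in>X. w m) = w 0 + (w d + w (2 * d))" unfolding X_def using d0 by simp
      ultimately show ?thesis by (simp add: algebra_simps)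
    qed
    then have wX: "norm (\<Sum>m\<in>X. w m) \<le> 5 / 2"
      using norm_three_signs_le[of "-1" "real d * t"] s by (simp add: norm_mult)
    have "tm_fourier a b (L + W) i j t = (\<Sum>m<2 ^ L. w m * g m)"
      unfolding tm_fourier_split w_def g_def ..
    also have "\<dots> = (\<Sum>m\<in>X. w m * g m) + (\<Sum>m\<in>{..<2 ^ L} - X. w m * g m)"
      using X by (simp add: sum.subset_diff)
    also have "(\<Sum>m\<in>X. w m * g m) = (\<Sum>m\<in>X. w m) * tm_fourier a b W 0 0 (2 ^ L * t)"
      unfolding sum_distrib_right by (intro sum.cong refl) (simp add: gX)
    finally have "norm (tm_fourier a b (L + W) i j t) \<le>
        norm ((\<Sum>m\<in>X. w m) * tm_fourier a b W 0 0 (2 ^ L * t)) + norm (\<Sum>m\<in>{..<2 ^ L} - X. w m * g m)"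
      using norm_triangle_ineq by simp
    also have "norm ((\<Sum>m\<in>X. w m) * tm_fourier a b W 0 0 (2 ^ L * t)) \<le> 5 / 2 * B"
      unfolding norm_mult using wX IH[of 0 0] ab0 by (intro mult_mono) auto
    also have "norm (\<Sum>m\<in>{..<2 ^ L} - X. w m * g m) \<le> (\<Sum>m\<in>{..<2 ^ L} - X. B)"
      using gB by (intro sum_norm_le) (auto simp: norm_mult norm_w)
    also have "(\<Sum>m\<in>{..<2 ^ L} - X. B) = (2 ^ L - 3) * B"
    proof -
      have "card X \<le> card {..<2 ^ L :: nat}" by (rule card_mono[OF _ X]) simp
      then show ?thesis using X cX by (simp add: card_Diff_subset finite_subset[OF X] of_nat_diff)
    qed
    also have "5 / 2 * B + (2 ^ L - 3) * B = 2 ^ L * c * B" unfolding c_def by (simp add: field_simps)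
    finally show ?thesis by simp
  qed
  then show ?thesis using c by blast
qed

text \<open>Iterates the contraction over blocks of length L; the remaining V digits get the trivial
  bound.\<close>

lemma tm_fourier_small:
  fixes a b :: nat
  assumes ab: "odd a" "odd b" "a \<noteq> b" and eps: "eps > 0"
  shows "\<forall>\<^sub>F W in sequentially. \<forall>i<a. \<forall>j<b. \<forall>t. norm (tm_fourier a b W i j t) \<le> eps * 2 ^ W"
proof -
  obtain L and c :: real where c: "0 \<le> c" "c < 1" and step:
    "\<forall>W B. B \<ge> 0 \<longrightarrow> (\<forall>i<a. \<forall>j<b. \<forall>t. norm (tm_fourier a b W i j t) \<le> B) \<longrightarrow>
       (\<forall>i<a. \<forall>j<b. \<forall>t. norm (tm_fourier a b (L + W) i j t) \<le> 2 ^ L * c * B)"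
    using tm_fourier_contraction[OF ab] by blast
  have iter: "\<forall>i<a. \<forall>j<b. \<forall>t. norm (tm_fourier a b (k * L + V) i j t) \<le> c ^ k * 2 ^ (k * L + V)" for k V
  proof (induction k)
    case 0
    then show ?case by (simp add: norm_tm_fourier_le)
  next
    case (Suc k)
    have "norm (tm_fourier a b (L + (k * L + V)) i j t) \<le> 2 ^ L * c * (c ^ k * 2 ^ (k * L + V))"
      if "i < a" "j < b" for i j t
      using step[rule_format, of "c ^ k * 2 ^ (k * L + V)" "k * L + V"] Suc.IH c that by auto
    then show ?case by (simp add: power_add algebra_simps)
  qed
  have "(\<lambda>k. c ^ k) \<longlonglongrightarrow> 0" using c by (intro LIMSEQ_realpow_zero) auto
  then have "\<forall>\<^sub>F k in sequentially. c ^ k < eps" using eps by (rule order_tendstoD(2))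
  then obtain k where k: "c ^ k < eps" by (auto simp: eventually_sequentially)
  show ?thesis
  proof (rule eventually_sequentiallyI[of "k * L"], intro allI impI)
    fix W i j t assume "k * L \<le> W" "i < a" "j < b"
    then obtain V where W: "W = k * L + V" using le_Suc_ex by blast
    have "norm (tm_fourier a b W i j t) \<le> c ^ k * 2 ^ W"
      using iter[of k V] W \<open>i < a\<close> \<open>j < b\<close> by auto
    also have "\<dots> \<le> eps * 2 ^ W" using k by (intro mult_right_mono) auto
    finally show "norm (tm_fourier a b W i j t) \<le> eps * 2 ^ W" .
  qed
qed

section \<open>Mean square of the window correlations\<close>

lemma sum_cis_orthogonality:
  fixes x y q :: nat
  assumes "x < q" "y < q"
  shows "(\<Sum>h<q. cis (2 * pi * real h * (real x - real y) / real q)) = (if x = y then of_nat q else 0)"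
proof (cases "x = y")
  case True
  then show ?thesis by simp
next
  case False
  define t where "t = 2 * pi * (real x - real y) / real q"
  have q: "real q > 0" using assms by simp
  have "cis t \<noteq> 1"
  proof
    assume "cis t = 1"
    then have "cos t = 1" by (metis cis.simps(1) one_complex.simps(1))
    then obtain n :: int where n: "t = of_int n * 2 * pi" by (auto simp: cos_one_2pi_int)
    then have "real x - real y = of_int n * real q"
    proof -
      have "2 * pi * (real x - real y) = 2 * pi * (of_int n * real q)"
        using n q by (simp add: t_def field_simps)
      then show ?thesis by (subst (asm) mult_cancel_left) simp
    qed
    then have eq: "int x - int y = n * int q"
      by (metis of_int_diff of_int_eq_iff of_int_mult of_int_of_nat_eq)
    have "\<bar>int x - int y\<bar> < int q" using assms by auto
    then have "\<bar>n\<bar> * int q < 1 * int q" by (simp add: eq abs_mult)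
    then have "n = 0" using q by (simp add: mult_less_cancel_right)
    then show False using eq False by simp
  qed
  moreover have "cis t ^ q = 1"
  proof -
    have "cis t ^ q = cis (real q * t)" by (rule Complex.DeMoivre)
    also have "real q * t = 2 * pi * of_int (int x - int y)" using q by (simp add: t_def)
    also have "cis \<dots> = 1" by (rule cis_multiple_2pi) simp
    finally show ?thesis .
  qed
  ultimately have "(\<Sum>h<q. cis t ^ h) = 0" by (simp add: geometric_sum)
  moreover have "cis (2 * pi * real h * (real x - real y) / real q) = cis t ^ h" for h
    by (simp add: Complex.DeMoivre t_def algebra_simps)
  ultimately show ?thesis using False by simp
qed

definition dft :: "nat \<Rightarrow> (nat \<Rightarrow> complex) \<Rightarrow> nat \<Rightarrow> complex" where
  "dft q F h = (\<Sum>x<q. F x * cis (2 * pi * real h * real x / real q))"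

lemma dft_Parseval: "(\<Sum>h<q. (norm (dft q F h))\<^sup>2) = real q * (\<Sum>x<q. (norm (F x))\<^sup>2)"
proof -
  have "complex_of_real (\<Sum>h<q. (norm (dft q F h))\<^sup>2) = (\<Sum>h<q. dft q F h * cnj (dft q F h))"
    by (simp add: complex_norm_square[symmetric])
  also have "\<dots> = (\<Sum>h<q. \<Sum>x<q. \<Sum>y<q. F x * cnj (F y) * cis (2 * pi * real h * (real x - real y) / real q))"
    unfolding dft_def cnj_sum sum_product
    by (intro sum.cong refl) (simp add: cis_cnj cis_mult algebra_simps diff_divide_distrib)
  also have "\<dots> = (\<Sum>x<q. \<Sum>y<q. \<Sum>h<q. F x * cnj (F y) * cis (2 * pi * real h * (real x - real y) / real q))"
    by (subst sum.swap) (rule sum.cong[OF refl sum.swap])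
  also have "\<dots> = (\<Sum>x<q. \<Sum>y<q. F x * cnj (F y) * (if x = y then of_nat q else 0))"
    unfolding sum_distrib_left[symmetric] by (intro sum.cong refl) (simp add: sum_cis_orthogonality)
  also have "\<dots> = (\<Sum>x<q. F x * cnj (F x) * of_nat q)"
    by (intro sum.cong refl) (simp add: if_distrib sum.delta cong: if_cong)
  also have "\<dots> = complex_of_real (real q * (\<Sum>x<q. (norm (F x))\<^sup>2))"
    by (simp add: complex_norm_square[symmetric] sum_distrib_left mult.commute)
  finally show ?thesis by (simp only: of_real_eq_iff)
qed

lemma sum_periodic_shift:
  fixes F :: "nat \<Rightarrow> 'a::ab_group_add"
  assumes "\<And>x. F (x + q) = F x"
  shows "(\<Sum>x<q. F (x + c)) = (\<Sum>x<q. F x)"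
proof (induction c)
  case (Suc c)
  have "(\<Sum>x<q. F (x + Suc c)) + F c = (\<Sum>x<Suc q. F (x + c))"
    by (subst sum.lessThan_Suc_shift) (simp add: add.commute)
  also have "\<dots> = (\<Sum>x<q. F (x + c)) + F c" using assms[of c] by (simp add: add.commute)
  finally show ?case using Suc.IH by simp
qed simp

lemma periodic_add_mult:
  fixes F :: "nat \<Rightarrow> 'a"
  assumes "\<And>x. F (x + q) = F x"
  shows "F (x + q * k) = F x"
proof (induction k)
  case (Suc k)
  have "F (x + q * Suc k) = F ((x + q * k) + q)" by (simp add: algebra_simps)
  then show ?case using assms Suc.IH by simp
qed simp

text \<open>The Wiener-Khinchin identity on the cyclic group of order q; periodicity lets the sum
  over u be recentred at x.\<close>

lemma dft_autocorrelation:
  fixes g :: "nat \<Rightarrow> real"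
  assumes per: "\<And>x. g (x + q) = g x"
  shows "dft q (\<lambda>u. of_real (\<Sum>x<q. g x * g (x + u))) h = of_real ((norm (dft q (\<lambda>x. of_real (g x)) h))\<^sup>2)"
proof (cases "q = 0")
  case False
  define e where "e n = cis (2 * pi * real h * real n / real q)" for n
  have e_add: "e (m + n) = e m * e n" for m n
    by (simp add: e_def cis_mult algebra_simps add_divide_distrib)
  have e_q: "e q = 1"
  proof -
    have "e q = cis (2 * pi * real h)" using False by (simp add: e_def)
    also have "\<dots> = 1" by (rule cis_multiple_2pi) simp
    finally show ?thesis .
  qed
  have e_cnj: "cnj (e n) * e n = 1" for n by (simp add: e_def cis_cnj cis_mult)
  have "dft q (\<lambda>u. of_real (\<Sum>x<q. g x * g (x + u))) h =
      (\<Sum>u<q. \<Sum>x<q. (of_real (g x) * cnj (e x)) * (of_real (g (u + x)) * e (u + x)))"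
    unfolding dft_def e_def[symmetric] of_real_sum sum_distrib_right
    using e_cnj by (intro sum.cong refl) (simp add: e_add algebra_simps)
  also have "\<dots> = (\<Sum>x<q. (of_real (g x) * cnj (e x)) * (\<Sum>u<q. of_real (g (u + x)) * e (u + x)))"
    by (subst sum.swap) (simp add: sum_distrib_left)
  also have "\<dots> = (\<Sum>x<q. (of_real (g x) * cnj (e x)) * (\<Sum>u<q. of_real (g u) * e u))"
    using sum_periodic_shift[of "\<lambda>u. of_real (g u) * e u" q] by (simp add: per e_add e_q)
  also have "\<dots> = cnj (dft q (\<lambda>x. of_real (g x)) h) * dft q (\<lambda>x. of_real (g x)) h"
    unfolding dft_def e_def[symmetric] sum_distrib_right[symmetric] cnj_sum by simp
  finally show ?thesis by (simp add: complex_norm_square[symmetric] mult.commute)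
qed (simp add: dft_def)

text \<open>By Parseval the left side is, up to normalisation, the sum of the fourth powers of the
  transform. Two of the four factors are bounded by B, the other two are summed by Parseval
  again.\<close>

lemma autocorrelation_mean_square_le:
  fixes g :: "nat \<Rightarrow> real"
  assumes per: "\<And>x. g (x + q) = g x" and g: "\<And>x. \<bar>g x\<bar> \<le> 1"
    and B: "\<And>h. norm (dft q (\<lambda>x. of_real (g x)) h) \<le> B"
  shows "(\<Sum>u<q. (\<Sum>x<q. g x * g (x + u))\<^sup>2) \<le> real q * B\<^sup>2"
proof (cases "q = 0")
  case False
  define G where "G = dft q (\<lambda>x. complex_of_real (g x))"
  define C where "C u = (\<Sum>x<q. g x * g (x + u))" for u
  have B0: "B \<ge> 0" using B[of 0] norm_ge_zero order_trans by blast
  have "real q * (\<Sum>u<q. (norm (complex_of_real (C u)))\<^sup>2) = (\<Sum>h<q. (norm (dft q (\<lambda>u. of_real (C u)) h))\<^sup>2)"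
    by (rule dft_Parseval[symmetric])
  also have "\<dots> = (\<Sum>h<q. (norm (G h))\<^sup>2 * (norm (G h))\<^sup>2)"
    unfolding C_def G_def by (simp only: dft_autocorrelation[of g, OF per]) (simp add: power2_eq_square norm_mult)
  also have "\<dots> \<le> (\<Sum>h<q. B\<^sup>2 * (norm (G h))\<^sup>2)"
    using B B0 unfolding G_def by (intro sum_mono mult_right_mono power_mono) auto
  also have "\<dots> = B\<^sup>2 * (real q * (\<Sum>x<q. (norm (complex_of_real (g x)))\<^sup>2))"
    unfolding sum_distrib_left[symmetric] G_def dft_Parseval ..
  also have "\<dots> \<le> B\<^sup>2 * (real q * (\<Sum>x<q. 1))"
    using g by (intro mult_left_mono sum_mono) (auto simp: abs_square_le_1)
  finally have "real q * (\<Sum>u<q. (C u)\<^sup>2) \<le> real q * (real q * B\<^sup>2)" by (simp add: ac_simps)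
  then show ?thesis using False by (simp add: C_def)
qed simp

text \<open>This covers t and q with common factors, as for even t and q = 2^W: the points t z are
  distinct as integers and lie within t periods, whence the factor t.\<close>

lemma sum_periodic_dilate_le:
  fixes F :: "nat \<Rightarrow> real"
  assumes per: "\<And>x. F (x + q) = F x" and pos: "\<And>x. F x \<ge> 0" and t: "t > 0"
  shows "(\<Sum>z<q. F (t * z)) \<le> real t * (\<Sum>u<q. F u)"
proof -
  have "(\<Sum>z<q. F (t * z)) = sum F ((*) t ` {..<q})"
    using t by (subst sum.reindex) (auto simp: inj_on_def)
  also have "\<dots> \<le> sum F {..<q * t}"
    using t pos by (intro sum_mono2) (auto simp: mult.commute)
  also have "\<dots> = (\<Sum>u<q. \<Sum>x<t. F (u + q * x))" by (rule sum_lessThan_prod)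
  also have "\<dots> = (\<Sum>u<q. real t * F u)" by (simp add: periodic_add_mult[of F, OF per])
  finally show ?thesis by (simp add: sum_distrib_left)
qed

text \<open>If \<open>j\<close> is the integer part of \<open>a b m / 2 ^ u\<close>, then \<open>tm_cell a b W j\<close> is the joint sign of the digits of
  \<open>a m\<close> and \<open>b m\<close> at the positions from \<open>u\<close> to \<open>u + W - 1\<close>.\<close>

definition tm_cell :: "nat \<Rightarrow> nat \<Rightarrow> nat \<Rightarrow> nat \<Rightarrow> real" where
  "tm_cell a b W j = tm_sign ((j div b) mod 2 ^ W) * tm_sign ((j div a) mod 2 ^ W)"

lemma abs_tm_cell [simp]: "\<bar>tm_cell a b W j\<bar> = 1"
  by (simp add: tm_cell_def abs_mult)

lemma tm_cell_square [simp]: "tm_cell a b W j * tm_cell a b W j = 1"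
  using abs_tm_cell[of a b W j] by (metis abs_mult_self_eq mult_1)

lemma tm_cell_periodic:
  assumes "a > 0" "b > 0"
  shows "tm_cell a b W (j + 2 ^ W * (a * b)) = tm_cell a b W j"
proof -
  have "(j + 2 ^ W * (a * b)) div b = j div b + 2 ^ W * a"
    using assms(2) div_mult_self1[of b j "2 ^ W * a"] by (simp add: ac_simps)
  moreover have "(j + 2 ^ W * (a * b)) div a = j div a + 2 ^ W * b"
    using assms(1) div_mult_self1[of a j "2 ^ W * b"] by (simp add: ac_simps)
  ultimately show ?thesis by (simp add: tm_cell_def)
qed

text \<open>Sorting cells by their residue i modulo a b turns them back into windows. For i < a b
  the carries i div b and i div a lie below a and below b, so the Fourier bounds apply.\<close>

lemma tm_cell_eq_window:
  assumes "a > 0" "b > 0"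
  shows "tm_cell a b W (i + a * b * x) = tm_window a b W (i div b) (i div a) x"
proof -
  have "(i + a * b * x) div b = a * x + i div b"
    using assms(2) div_mult_self1[of b i "a * x"] by (simp add: ac_simps)
  moreover have "(i + a * b * x) div a = b * x + i div a"
    using assms(1) div_mult_self1[of a i "b * x"] by (simp add: ac_simps)
  ultimately show ?thesis by (simp add: tm_cell_def tm_window_def)
qed

section \<open>Correlations of cells and their averages over shifts\<close>

definition tm_corr :: "nat \<Rightarrow> nat \<Rightarrow> nat \<Rightarrow> nat \<Rightarrow> real" where
  "tm_corr a b W u = (\<Sum>j<2 ^ W * (a * b). tm_cell a b W j * tm_cell a b W (j + u))"

lemma tm_corr_periodic:
  assumes "a > 0" "b > 0"
  shows "tm_corr a b W (u + 2 ^ W * (a * b)) = tm_corr a b W u"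
  unfolding tm_corr_def using tm_cell_periodic[OF assms, of W] by (simp add: add.assoc[symmetric])

text \<open>A shift by a multiple of a b preserves the residue of a cell modulo a b, so the
  correlation splits into a b autocorrelations of windows. Cauchy-Schwarz over the residues reduces
  the claim to each of them.\<close>

lemma tm_corr_mean_square_le:
  assumes a: "a > 0" "b > 0"
    and small: "\<And>i j t. i < a \<Longrightarrow> j < b \<Longrightarrow> norm (tm_fourier a b W i j t) \<le> eps * 2 ^ W"
  shows "(\<Sum>u<2 ^ W. (tm_corr a b W (u * (a * b)))\<^sup>2) \<le> eps\<^sup>2 * real (2 ^ W * (a * b)) ^ 2 * 2 ^ W"
proof -
  define q :: nat where "q = 2 ^ W"
  define g where "g i x = tm_window a b W (i div b) (i div a) x" for i x
  have g_per: "g i (x + q) = g i x" for i x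
    unfolding g_def q_def by (metis tm_window_mod mod_add_self2)
  have idiv: "i div b < a" "i div a < b" if "i < a * b" for i
    using that a by (auto simp: less_mult_imp_div_less mult.commute)
  have corr: "tm_corr a b W (u * (a * b)) = (\<Sum>i<a * b. \<Sum>x<q. g i x * g i (x + u))" for u
  proof -
    have "tm_corr a b W (u * (a * b)) = (\<Sum>j<(a * b) * 2 ^ W. tm_cell a b W j * tm_cell a b W (j + u * (a * b)))"
      unfolding tm_corr_def by (simp add: mult.commute)
    also have "\<dots> = (\<Sum>i<a * b. \<Sum>x<q. tm_cell a b W (i + a * b * x) * tm_cell a b W (i + a * b * x + u * (a * b)))"
      unfolding q_def by (rule sum_lessThan_prod)
    also have "\<dots> = (\<Sum>i<a * b. \<Sum>x<q. g i x * g i (x + u))"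
    proof (intro sum.cong refl)
      fix i x
      have "i + a * b * x + u * (a * b) = i + a * b * (x + u)" by (simp add: algebra_simps)
      then show "tm_cell a b W (i + a * b * x) * tm_cell a b W (i + a * b * x + u * (a * b)) = g i x * g i (x + u)"
        by (simp only: tm_cell_eq_window[OF a] g_def)
    qed
    finally show ?thesis .
  qed
  have C: "(\<Sum>u<q. (\<Sum>x<q. g i x * g i (x + u))\<^sup>2) \<le> real q * (eps * 2 ^ W)\<^sup>2" if i: "i < a * b" for i
  proof (rule autocorrelation_mean_square_le)
    fix h
    have "dft q (\<lambda>x. of_real (g i x)) h = tm_fourier a b W (i div b) (i div a) (2 * pi * real h / real q)"
      unfolding dft_def tm_fourier_def g_def q_def by (simp add: mult_ac)
    then show "norm (dft q (\<lambda>x. of_real (g i x)) h) \<le> eps * 2 ^ W" using small idiv[OF i] by simp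
  qed (use g_per in \<open>auto simp: g_def\<close>)
  have "(\<Sum>u<q. (tm_corr a b W (u * (a * b)))\<^sup>2) \<le> (\<Sum>u<q. real (a * b) * (\<Sum>i<a * b. (\<Sum>x<q. g i x * g i (x + u))\<^sup>2))"
  proof (intro sum_mono)
    fix u
    show "(tm_corr a b W (u * (a * b)))\<^sup>2 \<le> real (a * b) * (\<Sum>i<a * b. (\<Sum>x<q. g i x * g i (x + u))\<^sup>2)"
      unfolding corr using Cauchy_Schwarz_ineq_sum[of "\<lambda>_. 1" "\<lambda>i. (\<Sum>x<q. g i x * g i (x + u))" "{..<a * b}"]
      by simp
  qed
  also have "\<dots> = real (a * b) * (\<Sum>i<a * b. \<Sum>u<q. (\<Sum>x<q. g i x * g i (x + u))\<^sup>2)"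
    unfolding sum_distrib_left[symmetric] by (subst sum.swap) simp
  also have "\<dots> \<le> real (a * b) * (\<Sum>i<a * b. real q * (eps * 2 ^ W)\<^sup>2)"
    using C by (intro mult_left_mono sum_mono) auto
  also have "\<dots> = eps\<^sup>2 * real (2 ^ W * (a * b)) ^ 2 * 2 ^ W"
    by (simp add: q_def power2_eq_square)
  finally show ?thesis by (simp add: q_def)
qed

text \<open>Here j is the cell of n, j + d that of n + r, and z stands for n modulo 2^W. The k-th
  summand is what the product of the two cell signs becomes when n is replaced by n + k 2^u: up to
  full periods the cells move by 2 k n a b and 2 k (n + r) a b. The sum is not divided by K.\<close>

definition tm_average :: "nat \<Rightarrow> nat \<Rightarrow> nat \<Rightarrow> nat \<Rightarrow> nat \<Rightarrow> nat \<Rightarrow> nat \<Rightarrow> nat \<Rightarrow> real" where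
  "tm_average a b W K r j z d = (\<Sum>k<K. tm_cell a b W (j + 2 * k * z * (a * b)) *
     tm_cell a b W (j + d + 2 * k * (z + r) * (a * b)))"

text \<open>For fixed z the cells j and j + d run independently over a full period, so the double
  sum factors into two correlations. Their lags are the differences between the shifts number k' and
  k.\<close>

lemma tm_average_cross_term:
  fixes a b W K r :: nat
  defines "G \<equiv> tm_cell a b W" and "M \<equiv> 2 ^ W * (a * b)" and "m \<equiv> a * b"
  assumes a: "a > 0" "b > 0" and "k \<le> k'"
  shows "(\<Sum>j<M. \<Sum>d<M. (G (j + 2 * k * z * m) * G (j + d + 2 * k * (z + r) * m)) *
       (G (j + 2 * k' * z * m) * G (j + d + 2 * k' * (z + r) * m)))
     = tm_corr a b W (2 * (k' - k) * z * m) * tm_corr a b W (2 * (k' - k) * (z + r) * m)"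
proof -
  define s where "s = k' - k"
  have k': "k' = k + s" using assms by (simp add: s_def)
  have per: "G (x + M) = G x" for x unfolding G_def M_def by (rule tm_cell_periodic[OF a])
  have corr: "(\<Sum>j<M. G (j + c) * G (j + c + u)) = tm_corr a b W u" for c u
  proof -
    have "G (x + M + u) = G (x + u)" for x using per[of "x + u"] by (simp add: ac_simps)
    then have "(\<Sum>j<M. G (j + c) * G (j + c + u)) = (\<Sum>j<M. G j * G (j + u))"
      using per by (intro sum_periodic_shift[of "\<lambda>j. G j * G (j + u)"]) simp
    then show ?thesis by (simp add: tm_corr_def G_def M_def)
  qed
  have "(\<Sum>j<M. \<Sum>d<M. (G (j + 2 * k * z * m) * G (j + d + 2 * k * (z + r) * m)) *
       (G (j + 2 * k' * z * m) * G (j + d + 2 * k' * (z + r) * m))) =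
    (\<Sum>j<M. G (j + 2 * k * z * m) * G (j + 2 * k * z * m + 2 * s * z * m) *
      (\<Sum>d<M. G (d + (j + 2 * k * (z + r) * m)) * G (d + (j + 2 * k * (z + r) * m) + 2 * s * (z + r) * m)))"
    unfolding sum_distrib_left k' by (intro sum.cong refl) (simp add: algebra_simps)
  also have "\<dots> = tm_corr a b W (2 * s * z * m) * tm_corr a b W (2 * s * (z + r) * m)"
    unfolding corr sum_distrib_right[symmetric] ..
  finally show ?thesis by (simp add: s_def)
qed

text \<open>Expand the square. The K diagonal pairs contribute K. An off-diagonal pair is a product
  of correlations at lags proportional to z and to z + r; after summation over z it is bounded by
  the mean square of the correlations, at the cost of a factor at most 2 K for the dilation of z.
  With eps = 1 / K the total is 3 K in place of the trivial K^2.\<close>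

lemma tm_average_mean_square_le:
  fixes a b W K r :: nat
  defines "M \<equiv> 2 ^ W * (a * b)"
  assumes a: "a > 0" "b > 0"
    and small: "\<And>i j t. i < a \<Longrightarrow> j < b \<Longrightarrow> norm (tm_fourier a b W i j t) \<le> eps * 2 ^ W"
  shows "(\<Sum>z<2 ^ W. \<Sum>j<M. \<Sum>d<M. (tm_average a b W K r j z d)\<^sup>2) \<le>
    (real K + 2 * real K ^ 3 * eps\<^sup>2) * (real M ^ 2 * 2 ^ W)"
proof -
  define m where "m = a * b"
  define G where "G = tm_cell a b W"
  define C where "C u = tm_corr a b W (u * m)" for u
  define X where "X z j d k = G (j + 2 * k * z * m) * G (j + d + 2 * k * (z + r) * m)" for z j d k
  define V where "V k k' = (\<Sum>z<2 ^ W. \<Sum>j<M. \<Sum>d<M. X z j d k * X z j d k')" for k k'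
  have C_per: "C (u + 2 ^ W) = C u" for u
    unfolding C_def m_def using tm_corr_periodic[OF a, of W "u * (a * b)"] by (simp add: algebra_simps)
  have C_le: "(\<Sum>u<2 ^ W. (C u)\<^sup>2) \<le> eps\<^sup>2 * real M ^ 2 * 2 ^ W"
    unfolding C_def m_def M_def by (rule tm_corr_mean_square_le[OF a small])
  have V_sym: "V k k' = V k' k" for k k' unfolding V_def by (simp add: mult.commute)
  have V_diag: "V k k = real M ^ 2 * 2 ^ W" for k
  proof -
    have "X z j d k * X z j d k = 1" for z j d
      unfolding X_def G_def by (simp add: mult.assoc mult.left_commute[of _ "tm_cell a b W _"])
    then show ?thesis by (simp add: V_def power2_eq_square)
  qed
  have V_off: "V k k' \<le> 2 * real K * (eps\<^sup>2 * real M ^ 2 * 2 ^ W)" if kk: "k < k'" "k' < K" for k k'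
  proof -
    define s where "s = k' - k"
    have s: "s > 0" "s \<le> K" using kk by (auto simp: s_def)
    have "V k k' = (\<Sum>z<2 ^ W. C (2 * s * z) * C (2 * s * (z + r)))"
      unfolding V_def X_def G_def M_def m_def C_def s_def
      using kk by (intro sum.cong refl, subst tm_average_cross_term[OF a]) auto
    also have "\<dots> \<le> (\<Sum>z<2 ^ W. (C (2 * s * z))\<^sup>2 / 2 + (C (2 * s * (z + r)))\<^sup>2 / 2)"
    proof (intro sum_mono)
      fix z
      have "0 \<le> (C (2 * s * z) - C (2 * s * (z + r)))\<^sup>2" by simp
      then show "C (2 * s * z) * C (2 * s * (z + r)) \<le> (C (2 * s * z))\<^sup>2 / 2 + (C (2 * s * (z + r)))\<^sup>2 / 2"
        unfolding power2_diff by linarith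
    qed
    also have "\<dots> = (\<Sum>z<2 ^ W. (C (2 * s * z))\<^sup>2 / 2) + (\<Sum>z<2 ^ W. (C (2 * s * (z + r)))\<^sup>2 / 2)"
      by (rule sum.distrib)
    also have "(\<Sum>z<2 ^ W. (C (2 * s * (z + r)))\<^sup>2 / 2) = (\<Sum>z<2 ^ W. (C (2 * s * z))\<^sup>2 / 2)"
    proof (rule sum_periodic_shift[of "\<lambda>z. (C (2 * s * z))\<^sup>2 / 2"])
      fix z
      have "C (2 * s * (z + 2 ^ W)) = C (2 * s * z + 2 ^ W * (2 * s))" by (simp add: algebra_simps)
      then show "(C (2 * s * (z + 2 ^ W)))\<^sup>2 / 2 = (C (2 * s * z))\<^sup>2 / 2"
        by (simp only: periodic_add_mult[of C, OF C_per])
    qed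
    also have "(\<Sum>z<2 ^ W. (C (2 * s * z))\<^sup>2 / 2) + (\<Sum>z<2 ^ W. (C (2 * s * z))\<^sup>2 / 2) = (\<Sum>z<2 ^ W. (C (2 * s * z))\<^sup>2)"
      by (simp add: sum.distrib[symmetric])
    also have "\<dots> \<le> real (2 * s) * (\<Sum>u<2 ^ W. (C u)\<^sup>2)"
      using s C_per by (intro sum_periodic_dilate_le) auto
    also have "\<dots> \<le> real (2 * K) * (eps\<^sup>2 * real M ^ 2 * 2 ^ W)"
      using s C_le by (intro mult_mono) (auto intro!: sum_nonneg)
    finally show ?thesis by simp
  qed
  have V_le: "V k k' \<le> (if k = k' then real M ^ 2 * 2 ^ W else 0) + 2 * real K * (eps\<^sup>2 * real M ^ 2 * 2 ^ W)"
    if "k < K" "k' < K" for k k'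
    using V_diag V_off[of k k'] V_off[of k' k] V_sym[of k k'] that by (cases k k' rule: linorder_cases) auto
  have "(\<Sum>z<2 ^ W. \<Sum>j<M. \<Sum>d<M. (tm_average a b W K r j z d)\<^sup>2) =
      (\<Sum>z<2 ^ W. \<Sum>j<M. \<Sum>d<M. \<Sum>k<K. \<Sum>k'<K. X z j d k * X z j d k')"
    unfolding tm_average_def X_def G_def m_def power2_eq_square sum_product ..
  also have "\<dots> = (\<Sum>z<2 ^ W. \<Sum>j<M. \<Sum>k<K. \<Sum>d<M. \<Sum>k'<K. X z j d k * X z j d k')"
    by (rule sum.cong[OF refl], rule sum.cong[OF refl], rule sum.swap)
  also have "\<dots> = (\<Sum>z<2 ^ W. \<Sum>k<K. \<Sum>j<M. \<Sum>d<M. \<Sum>k'<K. X z j d k * X z j d k')"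
    by (rule sum.cong[OF refl], rule sum.swap)
  also have "\<dots> = (\<Sum>k<K. \<Sum>z<2 ^ W. \<Sum>j<M. \<Sum>d<M. \<Sum>k'<K. X z j d k * X z j d k')"
    by (rule sum.swap)
  also have "\<dots> = (\<Sum>k<K. \<Sum>z<2 ^ W. \<Sum>j<M. \<Sum>k'<K. \<Sum>d<M. X z j d k * X z j d k')"
    by (rule sum.cong[OF refl], rule sum.cong[OF refl], rule sum.cong[OF refl], rule sum.swap)
  also have "\<dots> = (\<Sum>k<K. \<Sum>z<2 ^ W. \<Sum>k'<K. \<Sum>j<M. \<Sum>d<M. X z j d k * X z j d k')"
    by (rule sum.cong[OF refl], rule sum.cong[OF refl], rule sum.swap)
  also have "\<dots> = (\<Sum>k<K. \<Sum>k'<K. V k k')"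
    unfolding V_def by (rule sum.cong[OF refl], rule sum.swap)
  also have "\<dots> \<le> (\<Sum>k<K. \<Sum>k'<K. (if k = k' then real M ^ 2 * 2 ^ W else 0) + 2 * real K * (eps\<^sup>2 * real M ^ 2 * 2 ^ W))"
    using V_le by (intro sum_mono) auto
  also have "\<dots> = (real K + 2 * real K ^ 3 * eps\<^sup>2) * (real M ^ 2 * 2 ^ W)"
    by (simp add: sum.distrib algebra_simps power3_eq_cube power2_eq_square)
  finally show ?thesis .
qed

section \<open>Van der Corput differencing and quadratic exponential sums\<close>

lemma norm_sum_shift_le:
  fixes u :: "nat \<Rightarrow> 'a::real_normed_vector"
  assumes "\<And>n. norm (u n) \<le> 1"
  shows "norm ((\<Sum>n<N. u (n + c)) - (\<Sum>n<N. u n)) \<le> 2 * real c"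
proof (induction c)
  case (Suc c)
  have "u c + (\<Sum>n<N. u (n + Suc c)) = (\<Sum>n<Suc N. u (n + c))"
    by (subst sum.lessThan_Suc_shift) simp
  also have "\<dots> = (\<Sum>n<N. u (n + c)) + u (N + c)" by simp
  finally have "(\<Sum>n<N. u (n + Suc c)) - (\<Sum>n<N. u n) =
      ((\<Sum>n<N. u (n + c)) - (\<Sum>n<N. u n)) + (u (N + c) - u c)" by (simp add: algebra_simps)
  also have "norm \<dots> \<le> 2 * real c + (norm (u (N + c)) + norm (u c))"
    by (intro norm_triangle_le add_mono Suc.IH norm_triangle_ineq4)
  also have "\<dots> \<le> 2 * real (Suc c)" using assms[of c] assms[of "N + c"] by simp
  finally show ?case .
qed simp

lemma norm_sum_square_le:
  fixes u :: "nat \<Rightarrow> complex"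
  shows "(norm (\<Sum>n<N. u n))\<^sup>2 \<le> real N * (\<Sum>n<N. (norm (u n))\<^sup>2)"
proof -
  have "(norm (\<Sum>n<N. u n))\<^sup>2 \<le> (\<Sum>n<N. norm (u n))\<^sup>2" by (intro power_mono norm_sum) auto
  also have "\<dots> \<le> real N * (\<Sum>n<N. (norm (u n))\<^sup>2)"
    using Cauchy_Schwarz_ineq_sum[of "\<lambda>_. 1" "\<lambda>n. norm (u n)" "{..<N}"] by simp
  finally show ?thesis .
qed

lemma sum_pairs_le:
  fixes f :: "nat \<Rightarrow> nat \<Rightarrow> real" and c :: "nat \<Rightarrow> real"
  assumes sym: "\<And>r r'. f r r' = f r' r" and diag: "\<And>r. r < R \<Longrightarrow> f r r \<le> D"
    and off: "\<And>r s. s > 0 \<Longrightarrow> r + s < R \<Longrightarrow> f r (r + s) \<le> c s" and c0: "\<And>s. c s \<ge> 0"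
  shows "(\<Sum>r<R. \<Sum>r'<R. f r r') \<le> real R * (D + 2 * (\<Sum>s=1..<R. c s))"
proof -
  have "(\<Sum>r'<R. f r r') \<le> D + 2 * (\<Sum>s=1..<R. c s)" if r: "r < R" for r
  proof -
    have "(\<Sum>r'<R. f r r') = (\<Sum>r'\<in>insert r ({r<..<R} \<union> {..<r}). f r r')"
      using r by (intro sum.cong) auto
    also have "\<dots> = f r r + ((\<Sum>r'\<in>{r<..<R}. f r r') + (\<Sum>r'<r. f r r'))"
      by (subst sum.insert, simp, simp, subst sum.union_disjoint) auto
    also have "(\<Sum>r'\<in>{r<..<R}. f r r') \<le> (\<Sum>s=1..<R. c s)"
    proof -
      have "(\<Sum>r'\<in>{r<..<R}. f r r') = (\<Sum>s\<in>{1..<R - r}. f r (r + s))"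
        using r by (intro sum.reindex_bij_witness[of _ "\<lambda>s. r + s" "\<lambda>r'. r' - r"]) auto
      also have "\<dots> \<le> (\<Sum>s\<in>{1..<R - r}. c s)" using off by (intro sum_mono) auto
      also have "\<dots> \<le> (\<Sum>s=1..<R. c s)" using c0 by (intro sum_mono2) auto
      finally show ?thesis .
    qed
    also have "(\<Sum>r'<r. f r r') \<le> (\<Sum>s=1..<R. c s)"
    proof -
      have "(\<Sum>r'<r. f r r') = (\<Sum>s\<in>{1..r}. f (r - s) (r - s + s))"
        using sym by (intro sum.reindex_bij_witness[of _ "\<lambda>s. r - s" "\<lambda>r'. r - r'"]) auto
      also have "\<dots> \<le> (\<Sum>s\<in>{1..r}. c s)" using off r by (intro sum_mono off) auto
      also have "\<dots> \<le> (\<Sum>s=1..<R. c s)" using c0 r by (intro sum_mono2) auto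
      finally show ?thesis .
    qed
    finally show ?thesis using diag[OF r] by simp
  qed
  then have "(\<Sum>r<R. \<Sum>r'<R. f r r') \<le> (\<Sum>r<R. D + 2 * (\<Sum>s=1..<R. c s))" by (intro sum_mono) auto
  then show ?thesis by simp
qed

text \<open>Average over R shifts and apply Cauchy-Schwarz in n. The sequence is not cut off at N,
  so each translation costs boundary terms: the leading \<open>real R\<close> comes from introducing
  the shifts, the \<open>2 * real R\<close> inside from moving a correlation back to the
  start.\<close>

lemma van_der_Corput:
  fixes u :: "nat \<Rightarrow> complex"
  assumes u: "\<And>n. norm (u n) \<le> 1" and R: "R > 0"
  shows "norm (\<Sum>n<N. u n) \<le> real R +
    sqrt (real N / real R * (real N + 2 * (\<Sum>s=1..<R. norm (\<Sum>n<N. u (n + s) * cnj (u n)) + 2 * real R)))"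
proof -
  define S where "S = (\<Sum>n<N. u n)"
  define C where "C s = norm (\<Sum>n<N. u (n + s) * cnj (u n)) + 2 * real R" for s
  define f where "f r r' = Re (\<Sum>n<N. u (n + r) * cnj (u (n + r')))" for r r'
  have "norm (of_nat R * S - (\<Sum>r<R. \<Sum>n<N. u (n + r))) = norm (\<Sum>r<R. (\<Sum>n<N. u (n + r)) - S)"
    by (simp add: sum_subtractf norm_minus_commute)
  also have "\<dots> \<le> (\<Sum>r<R. 2 * real r)"
    unfolding S_def by (intro sum_norm_le norm_sum_shift_le u)
  also have "(\<Sum>r<R. 2 * real r) \<le> real R * real R" by (induction R) (auto simp: algebra_simps)
  finally have 1: "real R * norm S \<le> real R * real R + norm (\<Sum>r<R. \<Sum>n<N. u (n + r))"
    using norm_triangle_sub[of "of_nat R * S" "\<Sum>r<R. \<Sum>n<N. u (n + r)"] by (simp add: norm_mult)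
  have sym: "f r r' = f r' r" for r r' unfolding f_def by (simp add: mult.commute)
  have "(norm (\<Sum>r<R. \<Sum>n<N. u (n + r)))\<^sup>2 = (norm (\<Sum>n<N. \<Sum>r<R. u (n + r)))\<^sup>2"
    by (subst sum.swap) simp
  also have "\<dots> \<le> real N * (\<Sum>n<N. (norm (\<Sum>r<R. u (n + r)))\<^sup>2)" by (rule norm_sum_square_le)
  also have "(\<Sum>n<N. (norm (\<Sum>r<R. u (n + r)))\<^sup>2) = (\<Sum>r<R. \<Sum>r'<R. f r r')"
  proof -
    have "complex_of_real (\<Sum>n<N. (norm (\<Sum>r<R. u (n + r)))\<^sup>2) = (\<Sum>n<N. (\<Sum>r<R. u (n + r)) * cnj (\<Sum>r<R. u (n + r)))"
      by (simp only: of_real_sum complex_norm_square)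
    also have "\<dots> = (\<Sum>n<N. \<Sum>r<R. \<Sum>r'<R. u (n + r) * cnj (u (n + r')))"
      by (simp add: sum_product)
    also have "\<dots> = (\<Sum>r<R. \<Sum>n<N. \<Sum>r'<R. u (n + r) * cnj (u (n + r')))" by (rule sum.swap)
    also have "\<dots> = (\<Sum>r<R. \<Sum>r'<R. \<Sum>n<N. u (n + r) * cnj (u (n + r')))"
      by (rule sum.cong[OF refl], rule sum.swap)
    finally have "(\<Sum>n<N. (norm (\<Sum>r<R. u (n + r)))\<^sup>2) = Re (\<Sum>r<R. \<Sum>r'<R. \<Sum>n<N. u (n + r) * cnj (u (n + r')))"
      by (metis Re_complex_of_real)
    then show ?thesis by (simp add: f_def)
  qed
  also have "real N * (\<Sum>r<R. \<Sum>r'<R. f r r') \<le> real N * (real R * (real N + 2 * (\<Sum>s=1..<R. C s)))"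
  proof (intro mult_left_mono sum_pairs_le sym)
    fix r
    have "f r r = (\<Sum>n<N. (norm (u (n + r)))\<^sup>2)" unfolding f_def Re_sum
      by (intro sum.cong refl) (simp only: complex_norm_square[symmetric] Re_complex_of_real)
    also have "\<dots> \<le> (\<Sum>n<N. 1)" using u by (intro sum_mono) (simp add: power_le_one)
    finally show "f r r \<le> real N" by simp
  next
    fix r s assume rs: "r + s < R"
    define v where "v n = u (n + s) * cnj (u n)" for n
    have v: "norm (v n) \<le> 1" for n
      unfolding v_def norm_mult complex_mod_cnj using u by (intro mult_le_one) auto
    have "f r (r + s) = f (r + s) r" by (rule sym)
    also have "\<dots> = Re (\<Sum>n<N. v (n + r))" unfolding f_def v_def by (simp add: ac_simps)
    also have "\<dots> \<le> norm (\<Sum>n<N. v (n + r))" by (rule complex_Re_le_cmod)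
    also have "\<dots> \<le> norm (\<Sum>n<N. v n) + 2 * real r"
      using norm_sum_shift_le[of v r N, OF v] norm_triangle_sub[of "\<Sum>n<N. v (n + r)" "\<Sum>n<N. v n"] by simp
    also have "\<dots> \<le> C s" using rs unfolding C_def v_def by simp
    finally show "f r (r + s) \<le> C s" .
  qed (auto simp: C_def)
  finally have "norm (\<Sum>r<R. \<Sum>n<N. u (n + r)) \<le> sqrt (real N * (real R * (real N + 2 * (\<Sum>s=1..<R. C s))))"
    by (rule real_le_rsqrt)
  also have "real N * (real R * (real N + 2 * (\<Sum>s=1..<R. C s))) =
      (real R)\<^sup>2 * (real N / real R * (real N + 2 * (\<Sum>s=1..<R. C s)))"
    using R by (simp add: power2_eq_square)
  also have "sqrt \<dots> = real R * sqrt (real N / real R * (real N + 2 * (\<Sum>s=1..<R. C s)))"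
    by (simp only: real_sqrt_mult real_sqrt_abs abs_of_nat)
  finally have "real R * norm S \<le> real R * (real R + sqrt (real N / real R * (real N + 2 * (\<Sum>s=1..<R. C s))))"
    using 1 by (simp add: distrib_left)
  then show ?thesis using R unfolding S_def C_def by simp
qed

section \<open>Exponential sums with a quadratic phase of large modulus\<close>

text \<open>Any bound of order o(R) would serve the differencing below; the square root fits an
  induction. The constant comes from sqrt (R + 1) + sqrt R \<le> 3 R.\<close>

lemma sum_inverse_le_sqrt: "(\<Sum>s=1..<R. 1 / real s) \<le> 3 * sqrt (real R)"
proof (induction R)
  case (Suc R)
  show ?case
  proof (cases "R = 0")
    case False
    have pos: "sqrt (real (Suc R)) + sqrt (real R) > 0" using False by (simp add: add_pos_pos)
    have "(sqrt (real (Suc R)) - sqrt (real R)) * (sqrt (real (Suc R)) + sqrt (real R)) = 1"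
      by (simp add: algebra_simps)
    then have eq: "sqrt (real (Suc R)) - sqrt (real R) = 1 / (sqrt (real (Suc R)) + sqrt (real R))"
      using pos by (metis less_numeral_extra(3) nonzero_eq_divide_eq)
    have "1 \<le> real R" using False by simp
    then have "1 * real R \<le> real R * real R" by (intro mult_right_mono) auto
    then have "1 + real R \<le> 4 * (real R * real R)" using \<open>1 \<le> real R\<close> by linarith
    then have "sqrt (real (Suc R)) \<le> 2 * real R" "sqrt (real R) \<le> real R"
      using False by (auto intro!: real_le_lsqrt simp: power2_eq_square)
    then have "1 / real R \<le> 3 * (sqrt (real (Suc R)) - sqrt (real R))"
      unfolding eq using False pos by (simp add: field_simps)
    moreover have "(\<Sum>s=1..<Suc R. 1 / real s) \<le> 3 * sqrt (real R) + 1 / real R" using Suc.IH False by simp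
    ultimately show ?thesis by (simp add: algebra_simps)
  qed simp
qed simp

lemma norm_cis_minus_1_ge:
  assumes "0 \<le> t" "t \<le> 1"
  shows "norm (cis t - 1) \<ge> t / 2"
proof (cases "t = 0")
  case False
  then have t: "t > 0" using assms by simp
  obtain x where x: "0 < x" "x < t" "sin t - sin 0 = (t - 0) * cos x"
    using MVT2[OF t, of sin cos] by (auto intro: DERIV_sin)
  have "1 \<le> pi / 3" using pi_gt3 by simp
  then have "cos (pi / 3) \<le> cos x" using x assms by (intro cos_monotone_0_pi_le) auto
  then have "t / 2 \<le> sin t" using x t by (simp add: cos_60)
  also have "\<dots> \<le> \<bar>Im (cis t - 1)\<bar>" by simp
  also have "\<dots> \<le> norm (cis t - 1)" by (rule abs_Im_le_cmod)
  finally show ?thesis .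
qed simp

lemma norm_geometric_cis_le:
  assumes "0 < t" "t \<le> 1"
  shows "norm (\<Sum>n<N. cis (c + real n * t)) \<le> 4 / t"
proof -
  have ge: "norm (cis t - 1) \<ge> t / 2" using norm_cis_minus_1_ge[of t] assms by simp
  then have ne: "cis t \<noteq> 1" using assms by auto
  have "(\<Sum>n<N. cis (c + real n * t)) = cis c * (\<Sum>n<N. cis t ^ n)"
    by (simp add: sum_distrib_left Complex.DeMoivre cis_mult)
  also have "\<dots> = cis c * ((cis t ^ N - 1) / (cis t - 1))" using ne by (simp add: geometric_sum)
  finally have "norm (\<Sum>n<N. cis (c + real n * t)) = norm (cis t ^ N - 1) / norm (cis t - 1)"
    by (simp add: norm_mult norm_divide)
  also have "\<dots> \<le> 2 / (t / 2)"
    using ge assms norm_triangle_ineq4[of "cis t ^ N" 1]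
    by (intro frac_le) (auto simp: norm_power)
  finally show ?thesis by simp
qed

text \<open>One differencing with lag s makes the phase linear with slope 4 pi h q^2 s / Q. Since h,
  q and s stay bounded while Q grows, the slope is at most 1, nothing wraps around the circle, and
  the geometric sum is at most Q / s. No arithmetic of Q is involved, and the bound is uniform in
  the starting point and the length.\<close>

lemma quadratic_exponential_sum_small:
  fixes h q :: nat
  assumes h: "h > 0" and q: "q > 0" and eps: "eps > 0"
  shows "\<forall>\<^sub>F Q :: nat in sequentially. \<forall>u l. l \<le> Q \<longrightarrow>
    norm (\<Sum>t<l. cis (2 * pi * real h * (real (u + q * t))\<^sup>2 / real Q)) \<le> eps * real Q"
proof -
  have "(\<lambda>R. 1 / real R + 6 / sqrt (real R)) \<longlonglongrightarrow> 0" by real_asymp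
  then have "\<forall>\<^sub>F R in sequentially. 1 / real R + 6 / sqrt (real R) < eps\<^sup>2 / 8"
    using eps by (intro order_tendstoD(2)) auto
  then have "\<forall>\<^sub>F R in sequentially. R > 0 \<and> 1 / real R + 6 / sqrt (real R) < eps\<^sup>2 / 8"
    using eventually_gt_at_top[of 0] by eventually_elim simp
  then obtain R :: nat where R: "R > 0" and R2: "1 / real R + 6 / sqrt (real R) < eps\<^sup>2 / 8"
    by (auto simp: eventually_sequentially)
  \<comment> \<open>The entries in turn keep the slope below 1, absorb the term 4 R Q into eps^2 Q^2
    / 8, make Q positive, and absorb the leading R.\<close>
  define Q0 where "Q0 = max (4 * pi * real h * real q ^ 2 * real R) (max (32 * real R / eps\<^sup>2) (max 1 (2 * real R / eps)))"
  have "norm (\<Sum>t<l. cis (2 * pi * real h * (real (u + q * t))\<^sup>2 / real Q)) \<le> eps * real Q"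
    if Q: "real Q \<ge> Q0" and l: "l \<le> Q" for Q u l
  proof -
    have Q1: "real Q \<ge> 4 * pi * real h * real q ^ 2 * real R" and Q2: "real Q \<ge> 32 * real R / eps\<^sup>2"
      and Q3: "real Q \<ge> 1" and Q4: "real Q \<ge> 2 * real R / eps"
      using Q by (auto simp: Q0_def)
    define U where "U t = cis (2 * pi * real h * (real (u + q * t))\<^sup>2 / real Q)" for t
    have C: "norm (\<Sum>t<l. U (t + s) * cnj (U t)) \<le> real Q * (1 / real s)" if s: "1 \<le> s" "s < R" for s
    proof -
      define p where "p = 4 * pi * real h * real q ^ 2 * real s / real Q"
      define c where "c = 2 * pi * real h * (2 * real q * real s * real u + (real q * real s)\<^sup>2) / real Q"
      have "U (t + s) * cnj (U t) = cis (c + real t * p)" for t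
      proof -
        have "2 * pi * real h * (real (u + q * (t + s)))\<^sup>2 / real Q - 2 * pi * real h * (real (u + q * t))\<^sup>2 / real Q
            = c + real t * p"
          unfolding c_def p_def using Q3 by (simp add: field_simps power2_eq_square)
        then show ?thesis unfolding U_def by (simp add: cis_cnj cis_mult)
      qed
      moreover have p0: "p > 0" unfolding p_def using h q s Q3 by simp
      moreover have "p \<le> 1"
      proof -
        have "4 * pi * real h * real q ^ 2 * real s \<le> 4 * pi * real h * real q ^ 2 * real R"
          using s by (intro mult_left_mono) auto
        then have "4 * pi * real h * real q ^ 2 * real s \<le> real Q" using Q1 by linarith
        then show ?thesis using Q3 by (simp add: p_def)
      qed
      ultimately have "norm (\<Sum>t<l. U (t + s) * cnj (U t)) \<le> 4 / p"
        using norm_geometric_cis_le[of p c l] by simp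
      also have "\<dots> \<le> 4 / (4 * real s / real Q)"
      proof (intro divide_left_mono)
        have "1 \<le> pi * real h * real q ^ 2"
        proof -
          have "1 * 1 * 1 \<le> pi * real h * real q ^ 2"
            using pi_gt3 h q by (intro mult_mono one_le_power) auto
          then show ?thesis by simp
        qed
        then have "4 * real s * 1 \<le> 4 * real s * (pi * real h * real q ^ 2)"
          by (intro mult_left_mono) auto
        then show "4 * real s / real Q \<le> p" using Q3 unfolding p_def
          by (intro divide_right_mono) (auto simp: mult_ac)
      qed (use s Q3 p0 in auto)
      finally show ?thesis by simp
    qed
    have "norm (\<Sum>t<l. U t) \<le> real R + sqrt (real l / real R *
        (real l + 2 * (\<Sum>s=1..<R. norm (\<Sum>t<l. U (t + s) * cnj (U t)) + 2 * real R)))"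
      by (rule van_der_Corput) (auto simp: U_def R)
    also have "real l / real R * (real l + 2 * (\<Sum>s=1..<R. norm (\<Sum>t<l. U (t + s) * cnj (U t)) + 2 * real R)) \<le>
       real Q / real R * (real Q + 2 * (\<Sum>s=1..<R. real Q * (1 / real s) + 2 * real R))"
      using l C by (intro mult_mono add_mono divide_right_mono mult_left_mono sum_mono)
        (auto intro!: add_nonneg_nonneg sum_nonneg)
    also have "\<dots> \<le> real Q / real R * (real Q + 2 * (real Q * (3 * sqrt (real R)) + 2 * real R * real R))"
    proof -
      have "(\<Sum>s=1..<R. real Q * (1 / real s) + 2 * real R) = real Q * (\<Sum>s=1..<R. 1 / real s) + 2 * real R * real (R - 1)"
        by (simp add: sum.distrib sum_distrib_left)
      also have "\<dots> \<le> real Q * (3 * sqrt (real R)) + 2 * real R * real R"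
        by (intro add_mono mult_left_mono sum_inverse_le_sqrt) auto
      finally show ?thesis by (intro mult_left_mono add_mono) auto
    qed
    also have "\<dots> = (real Q)\<^sup>2 * (1 / real R + 6 / sqrt (real R)) + 4 * real R * real Q"
    proof -
      have "sqrt (real R) / real R = 1 / sqrt (real R)" using R by (simp add: real_div_sqrt field_simps)
      then have *: "6 * (real Q)\<^sup>2 * (sqrt (real R) / real R) = 6 * (real Q)\<^sup>2 / sqrt (real R)" by simp
      have "real Q / real R * (real Q + 2 * (real Q * (3 * sqrt (real R)) + 2 * real R * real R)) =
         (real Q)\<^sup>2 / real R + 6 * (real Q)\<^sup>2 * (sqrt (real R) / real R) + 4 * real R * real Q"
        using R by (simp add: field_simps power2_eq_square)
      then show ?thesis unfolding * by (simp add: algebra_simps)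
    qed
    also have "\<dots> \<le> (real Q)\<^sup>2 * (eps\<^sup>2 / 8) + (real Q * eps\<^sup>2 / 8) * real Q"
    proof (intro add_mono mult_left_mono mult_right_mono)
      show "4 * real R \<le> real Q * eps\<^sup>2 / 8" using Q2 eps by (simp add: field_simps)
    qed (use R2 in auto)
    also have "\<dots> = (eps * real Q / 2)\<^sup>2" by (simp add: power2_eq_square)
    finally have "norm (\<Sum>t<l. U t) \<le> real R + sqrt ((eps * real Q / 2)\<^sup>2)" by simp
    also have "\<dots> = real R + eps * real Q / 2" using eps by simp
    also have "real R \<le> eps * real Q / 2" using Q4 eps by (simp add: field_simps)
    finally show ?thesis unfolding U_def by simp
  qed
  moreover have "\<forall>\<^sub>F Q :: nat in sequentially. real Q \<ge> Q0"
    using filterlim_real_sequentially unfolding filterlim_at_top by blast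
  ultimately show ?thesis by (auto elim!: eventually_mono)
qed

section \<open>Counting points in short arcs\<close>

text \<open>Membership of y, modulo 1, in the half-open arc from x / M to (x + 1) / M.\<close>

definition in_arc :: "nat \<Rightarrow> real \<Rightarrow> real \<Rightarrow> bool" where
  "in_arc M x y \<longleftrightarrow> (\<exists>k::int. x \<le> real M * (y - k) \<and> real M * (y - k) < x + 1)"

text \<open>The Fejer kernel majorises the indicator of an arc.\<close>

lemma card_arc_le:
  fixes y :: "'a \<Rightarrow> real" and S :: "'a set" and x0 B :: real
  assumes S: "finite S" and M: "M > 0"
    and B: "\<And>h. 1 \<le> h \<Longrightarrow> h \<le> M \<Longrightarrow> norm (\<Sum>n\<in>S. cis (2 * pi * real h * y n)) \<le> B"
  shows "real (card {n \<in> S. in_arc M x0 (y n)})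
    \<le> 24 * real (card S) / real M + 4 * B"
proof -
  define A where "A = {n \<in> S. in_arc M x0 (y n)}"
  \<comment> \<open>For m < L the phase of \<open>e m n\<close> at a point of the arc is at most 2
    pi / 6, so its real part is at least cos (pi / 3) = 1/2 and \<open>D n\<close> has norm at least
    L / 2. The 24 of the claim is 4 from this square times 6 from M \<le> 6 L.\<close>
  define L where "L = M div 6 + 1"
  define e where "e m n = cis (2 * pi * real m * (y n - x0 / real M))" for m n
  define D where "D n = (\<Sum>m<L. e m n)" for n
  have L: "L > 0" "6 * (L - 1) \<le> M" "M \<le> 6 * L" by (auto simp: L_def)
  have B0: "B \<ge> 0" using B[of 1] M norm_ge_zero order_trans by (metis One_nat_def Suc_leI order_refl)
  have D_ge: "(real L / 2)\<^sup>2 \<le> (norm (D n))\<^sup>2" if "n \<in> A" for n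
  proof -
    obtain k :: int where k: "x0 \<le> real M * (y n - k)" "real M * (y n - k) < x0 + 1" using \<open>n \<in> A\<close> by (auto simp: A_def in_arc_def)
    define th where "th = y n - k - x0 / real M"
    have th: "0 \<le> th" "th \<le> 1 / real M" 
    proof -
      have "real M * th = real M * (y n - k) - x0" unfolding th_def using M by (simp add: right_diff_distrib)
      then have "0 \<le> real M * th" "real M * th \<le> 1" using k by linarith+
      then show "0 \<le> th" "th \<le> 1 / real M" using M by (auto simp: field_simps zero_le_mult_iff)
    qed
    have "Re (e m n) \<ge> 1 / 2" if m: "m < L" for m
    proof -
      have "real m * th \<le> real (L - 1) * (1 / real M)" using th m by (intro mult_mono) auto
      also have "\<dots> \<le> 1 / 6" using L(2) M by (simp add: field_simps)
      finally have 1: "real m * th \<le> 1 / 6" .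
      have "e m n = cis (2 * pi * real m * th) * cis (2 * pi * of_int (int m * k))"
        unfolding e_def th_def by (simp add: cis_mult algebra_simps)
      also have "cis (2 * pi * of_int (int m * k)) = 1" by (rule cis_multiple_2pi) simp
      finally have "Re (e m n) = cos (2 * pi * (real m * th))" by (simp add: mult_ac)
      moreover have "cos (pi / 3) \<le> cos (2 * pi * (real m * th))"
      proof (rule cos_monotone_0_pi_le)
        show "0 \<le> 2 * pi * (real m * th)" using th by simp
        have "2 * pi * (real m * th) \<le> 2 * pi * (1 / 6)" using 1 by (intro mult_left_mono) auto
        then show "2 * pi * (real m * th) \<le> pi / 3" by simp
      qed simp
      ultimately show ?thesis by (simp add: cos_60)
    qed
    then have "(\<Sum>m<L. 1 / 2) \<le> Re (D n)" unfolding D_def Re_sum by (intro sum_mono) auto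
    then have "real L / 2 \<le> norm (D n)" using complex_Re_le_cmod[of "D n"] by simp
    then show ?thesis by (intro power_mono) auto
  qed
  have off: "norm (\<Sum>n\<in>S. e m n * cnj (e m' n)) \<le> (if m = m' then real (card S) else B)" if "m < L" "m' < L" for m m'
  proof -
    have ee: "e m n * cnj (e m' n) = cis (2 * pi * (real m - real m') * y n) * cis (- (2 * pi * (real m - real m') * x0 / real M))" for m m' n
      unfolding e_def by (simp add: cis_cnj cis_mult algebra_simps diff_divide_distrib)
    have eq: "norm (\<Sum>n\<in>S. e m n * cnj (e m' n)) = norm (\<Sum>n\<in>S. cis (2 * pi * (real m - real m') * y n))" for m m'
      unfolding ee sum_distrib_right[symmetric] by (simp add: norm_mult)
    have gt: "norm (\<Sum>n\<in>S. e m n * cnj (e m' n)) \<le> B" if "m' < m" "m < L" for m m'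
    proof -
      have "norm (\<Sum>n\<in>S. e m n * cnj (e m' n)) = norm (\<Sum>n\<in>S. cis (2 * pi * real (m - m') * y n))"
        unfolding eq using that by (simp add: of_nat_diff)
      also have "\<dots> \<le> B" using that L by (intro B) auto
      finally show ?thesis .
    qed
    have "norm (\<Sum>n\<in>S. e m n * cnj (e m' n)) = norm (cnj (\<Sum>n\<in>S. e m n * cnj (e m' n)))"
      by (simp only: complex_mod_cnj)
    also have "\<dots> = norm (\<Sum>n\<in>S. e m' n * cnj (e m n))" by (simp add: mult.commute)
    finally have "norm (\<Sum>n\<in>S. e m n * cnj (e m' n)) = norm (\<Sum>n\<in>S. e m' n * cnj (e m n))" .
    then show ?thesis using gt[of m' m] gt[of m m'] that eq[of m m]
      by (cases m m' rule: linorder_cases) auto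
  qed
  have "real (card A) * (real L / 2)\<^sup>2 = (\<Sum>n\<in>A. (real L / 2)\<^sup>2)" by simp
  also have "\<dots> \<le> (\<Sum>n\<in>A. (norm (D n))\<^sup>2)" using D_ge by (intro sum_mono) auto
  also have "\<dots> \<le> (\<Sum>n\<in>S. (norm (D n))\<^sup>2)" using S by (intro sum_mono2) (auto simp: A_def)
  also have "\<dots> = norm (complex_of_real (\<Sum>n\<in>S. (norm (D n))\<^sup>2))" by (simp only: norm_of_real) (simp add: sum_nonneg)
  also have "complex_of_real (\<Sum>n\<in>S. (norm (D n))\<^sup>2) = (\<Sum>n\<in>S. \<Sum>m<L. \<Sum>m'<L. e m n * cnj (e m' n))"
    unfolding of_real_sum complex_norm_square D_def cnj_sum sum_product ..
  also have "\<dots> = (\<Sum>m<L. \<Sum>n\<in>S. \<Sum>m'<L. e m n * cnj (e m' n))" by (rule sum.swap)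
  also have "\<dots> = (\<Sum>m<L. \<Sum>m'<L. \<Sum>n\<in>S. e m n * cnj (e m' n))"
    by (rule sum.cong[OF refl], rule sum.swap)
  also have "norm \<dots> \<le> (\<Sum>m<L. norm (\<Sum>m'<L. \<Sum>n\<in>S. e m n * cnj (e m' n)))" by (rule norm_sum)
  also have "\<dots> \<le> (\<Sum>m<L. \<Sum>m'<L. norm (\<Sum>n\<in>S. e m n * cnj (e m' n)))" by (intro sum_mono norm_sum)
  also have "\<dots> \<le> (\<Sum>m<L. \<Sum>m'<L. (if m = m' then real (card S) else B))" using off by (intro sum_mono) auto
  also have "\<dots> \<le> (\<Sum>m<L. \<Sum>m'<L. (if m = m' then real (card S) else 0) + B)" using B0 by (intro sum_mono) auto
  also have "\<dots> = real L * real (card S) + (real L)\<^sup>2 * B"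
    by (simp add: sum.distrib power2_eq_square algebra_simps)
  finally have "(real L)\<^sup>2 * real (card A) \<le> 4 * (real L * real (card S) + (real L)\<^sup>2 * B)"
    by (simp add: power_divide mult.commute)
  also have "\<dots> = (real L)\<^sup>2 * (4 * real (card S) / real L + 4 * B)"
    using L by (simp add: power2_eq_square field_simps)
  finally have "(real L)\<^sup>2 * real (card A) \<le> (real L)\<^sup>2 * (4 * real (card S) / real L + 4 * B)" .
  then have "real (card A) \<le> 4 * real (card S) / real L + 4 * B" using L by simp
  also have "4 * real (card S) / real L \<le> 24 * real (card S) / real M"
  proof -
    have "real M \<le> 6 * real L" using L(3) by (metis of_nat_le_iff of_nat_mult of_nat_numeral)
    then have "real (card S) * real M \<le> real (card S) * (6 * real L)" by (intro mult_left_mono) auto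
    then show ?thesis using L M by (simp add: field_simps)
  qed
  finally show ?thesis unfolding A_def by simp
qed

section \<open>Digit windows of squares\<close>

lemma less_ceiling_div_iff:
  fixes d m N :: nat
  assumes "d > 0"
  shows "m < (N + d - 1) div d \<longleftrightarrow> d * m < N"
proof -
  have "m < (N + d - 1) div d \<longleftrightarrow> Suc m * d \<le> N + d - 1"
    unfolding Suc_le_eq[symmetric, of m] using assms by (rule less_eq_div_iff_mult_less_eq)
  also have "\<dots> \<longleftrightarrow> d * m < N" using assms by (auto simp: mult.commute)
  finally show ?thesis .
qed

lemma residue_class_in_interval:
  fixes q z x l0 :: nat
  assumes q: "q > 0"
  obtains u l where "{n \<in> {x..<x + l0}. n mod q = z} = (\<lambda>t. u + q * t) ` {..<l}" "l \<le> l0 div q + 1"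
proof (cases "{n \<in> {x..<x + l0}. n mod q = z} = {}")
  case True
  then show ?thesis using that[of 0 0] by simp
next
  case False
  define S where "S = {n \<in> {x..<x + l0}. n mod q = z}"
  define u where "u = Min S"
  define l where "l = (x + l0 - u + q - 1) div q"
  have fS: "finite S" "S \<noteq> {}" using False by (auto simp: S_def)
  then have uS: "u \<in> S" unfolding u_def by (rule Min_in)
  have u_le: "u \<le> n" if "n \<in> S" for n unfolding u_def using that fS by simp
  have u: "x \<le> u" "u < x + l0" "u mod q = z" using uS by (auto simp: S_def)
  have l_iff: "t < l \<longleftrightarrow> u + q * t < x + l0" for t
    unfolding l_def less_ceiling_div_iff[OF q] using u by linarith
  have "S = (\<lambda>t. u + q * t) ` {..<l}"
  proof (intro equalityI subsetI)
    fix n assume n: "n \<in> S"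
    then have "n mod q = u mod q" using u by (simp add: S_def)
    then have "q dvd n - u" using u_le[OF n] by (metis mod_eq_dvd_iff_nat)
    then obtain t where "n - u = q * t" by (auto elim: dvdE)
    then have t: "n = u + q * t" using u_le[OF n] by simp
    moreover have "t < l" using n unfolding l_iff t[symmetric] by (simp add: S_def)
    ultimately show "n \<in> (\<lambda>t. u + q * t) ` {..<l}" by auto
  next
    fix n assume "n \<in> (\<lambda>t. u + q * t) ` {..<l}"
    then obtain t where "n = u + q * t" "t < l" by auto
    then show "n \<in> S" using u unfolding l_iff by (simp add: S_def)
  qed
  moreover have "l \<le> l0 div q + 1"
  proof -
    have "l \<le> (l0 + q) div q" unfolding l_def using u by (intro div_le_mono) auto
    then show ?thesis using q by simp
  qed
  ultimately show ?thesis using that[of u l] unfolding S_def by blast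
qed

text \<open>A residue class inside an interval shorter than Q is a progression with at most Q terms,
  so the quadratic sums bound every frequency used by \<open>card_arc_le\<close>. The threshold for
  Q is uniform in the interval, the class and the arc, as the later count over all cells
  requires.\<close>

lemma quadratic_cell_count:
  fixes q M :: nat
  assumes q: "q > 0" and M: "M > 0" and eps: "eps > 0"
  shows "\<forall>\<^sub>F Q :: nat in sequentially. \<forall>x l0 z x0. l0 < Q \<longrightarrow>
    real (card {n \<in> {x..<x + l0}. n mod q = z \<and>
        in_arc M x0 (real n ^ 2 / real Q)})
      \<le> 24 * (real l0 / real q + 1) / real M + eps * real Q"
proof -
  have "\<forall>\<^sub>F Q :: nat in sequentially. \<forall>h\<in>{1..M}. \<forall>u l. l \<le> Q \<longrightarrow>
    norm (\<Sum>t<l. cis (2 * pi * real h * (real (u + q * t))\<^sup>2 / real Q)) \<le> eps / 4 * real Q"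
    using q eps by (intro eventually_ball_finite ballI quadratic_exponential_sum_small) auto
  then show ?thesis
  proof eventually_elim
    case (elim Q)
    show ?case
    proof (intro allI impI)
      fix x l0 z x0 assume l0: "l0 < Q"
      define y where "y n = real n ^ 2 / real Q" for n
      obtain u l where S: "{n \<in> {x..<x + l0}. n mod q = z} = (\<lambda>t. u + q * t) ` {..<l}" and l: "l \<le> l0 div q + 1"
        using residue_class_in_interval[OF q] by blast
      define S' where "S' = (\<lambda>t. u + q * t) ` {..<l}"
      have inj: "inj_on (\<lambda>t. u + q * t) {..<l}" using q by (auto simp: inj_on_def)
      have cS: "card S' = l" unfolding S'_def using inj by (simp add: card_image)
      have lQ: "l \<le> Q"
      proof -
        have "l0 div q \<le> l0" by simp
        then show ?thesis using l l0 by linarith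
      qed
      have B: "norm (\<Sum>n\<in>S'. cis (2 * pi * real h * y n)) \<le> eps / 4 * real Q" if "1 \<le> h" "h \<le> M" for h
      proof -
        have "(\<Sum>n\<in>S'. cis (2 * pi * real h * y n)) = (\<Sum>t<l. cis (2 * pi * real h * (real (u + q * t))\<^sup>2 / real Q))"
          unfolding S'_def by (subst sum.reindex[OF inj]) (simp add: y_def)
        then show ?thesis using elim that lQ by auto
      qed
      have "{n \<in> {x..<x + l0}. n mod q = z \<and> in_arc M x0 (real n ^ 2 / real Q)}
          = {n \<in> S'. in_arc M x0 (y n)}"
        unfolding S'_def S[symmetric] y_def by auto
      also have "real (card \<dots>) \<le> 24 * real (card S') / real M + 4 * (eps / 4 * real Q)"
        using B M by (intro card_arc_le) (auto simp: S'_def)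
      also have "\<dots> \<le> 24 * (real l0 / real q + 1) / real M + eps * real Q"
      proof -
        have "real l \<le> real (l0 div q) + 1" using l by linarith
        also have "\<dots> \<le> real l0 / real q + 1" using of_nat_div_le_of_nat[of l0 q, where 'a=real] by simp
        finally show ?thesis unfolding cS by (intro add_mono divide_right_mono) auto
      qed
      finally show "real (card {n \<in> {x..<x + l0}. n mod q = z \<and>
        in_arc M x0 (real n ^ 2 / real Q)})
      \<le> 24 * (real l0 / real q + 1) / real M + eps * real Q" .
    qed
  qed
qed

text \<open>The digits of x and x + D from position l on coincide, and their signs cancel in the
  product.\<close>

lemma tm_sign_no_carry:
  assumes "x mod 2 ^ l + D < 2 ^ l"
  shows "tm_sign x * tm_sign (x + D) = tm_sign (x mod 2 ^ l) * tm_sign ((x + D) mod 2 ^ l)"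
proof -
  have "(x + D) div 2 ^ l = ((x mod 2 ^ l + D) + 2 ^ l * (x div 2 ^ l)) div 2 ^ l"
    by (metis add.assoc add.commute mod_mult_div_eq)
  also have "\<dots> = x div 2 ^ l + (x mod 2 ^ l + D) div 2 ^ l" by (rule div_mult_self2) simp
  also have "\<dots> = x div 2 ^ l" using assms by simp
  finally have "tm_sign (x + D) = tm_sign ((x + D) mod 2 ^ l) * tm_sign (x div 2 ^ l)"
    using tm_sign_split[of "x + D" l] by simp
  then have "tm_sign x * tm_sign (x + D) = (tm_sign (x mod 2 ^ l) * tm_sign ((x + D) mod 2 ^ l)) *
      (tm_sign (x div 2 ^ l) * tm_sign (x div 2 ^ l))"
    using tm_sign_split[of x l] by (simp only: ac_simps)
  then show ?thesis by simp
qed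

text \<open>A carry past Q needs a residue within D of Q. Since M0 D \<le> Q, such a residue divided
  by Q lies in the last of M0 equal arcs of the circle, the one with index M0 - 1.\<close>

lemma carry_count:
  fixes c M0 :: nat
  assumes c: "c > 0" and M0: "M0 > 0" and eps: "eps > 0"
  shows "\<forall>\<^sub>F Q :: nat in sequentially. \<forall>N D. N \<le> Q \<longrightarrow> M0 * D \<le> Q \<longrightarrow>
     real (card {n \<in> {..<N}. (c * n\<^sup>2) mod Q + D \<ge> Q}) \<le> 24 * real N / real M0 + eps * real Q"
proof -
  have "\<forall>\<^sub>F Q :: nat in sequentially. \<forall>h\<in>{1..M0}. \<forall>u l. l \<le> Q \<longrightarrow>
    norm (\<Sum>t<l. cis (2 * pi * real (h * c) * (real (u + 1 * t))\<^sup>2 / real Q)) \<le> eps / 4 * real Q"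
    using c eps by (intro eventually_ball_finite ballI quadratic_exponential_sum_small) auto
  then show ?thesis using eventually_gt_at_top[of 0]
  proof eventually_elim
    case (elim Q)
    show ?case
    proof (intro allI impI)
      fix N D assume N: "N \<le> Q" and D: "M0 * D \<le> Q"
      define y where "y n = real c * real n ^ 2 / real Q" for n
      have B: "norm (\<Sum>n<N. cis (2 * pi * real h * y n)) \<le> eps / 4 * real Q" if "1 \<le> h" "h \<le> M0" for h
      proof -
        have "(\<Sum>n<N. cis (2 * pi * real h * y n)) = (\<Sum>t<N. cis (2 * pi * real (h * c) * (real (0 + 1 * t))\<^sup>2 / real Q))"
          by (simp add: y_def mult_ac)
        then show ?thesis using elim(1) that N by (metis atLeastAtMost_iff)
      qed
      have "{n \<in> {..<N}. (c * n\<^sup>2) mod Q + D \<ge> Q} \<subseteq>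
         {n \<in> {..<N}. in_arc M0 (real M0 - 1) (y n)}"
      proof safe
        fix n assume n: "(c * n\<^sup>2) mod Q + D \<ge> Q"
        define k where "k = (c * n\<^sup>2) div Q"
        define m where "m = (c * n\<^sup>2) mod Q"
        have "c * n\<^sup>2 = Q * k + m" by (simp add: k_def m_def)
        then have "real c * real n ^ 2 = real Q * real k + real m" by (metis of_nat_add of_nat_mult of_nat_power)
        then have yk: "y n - real k = real m / real Q" using elim(2) by (simp add: y_def field_simps)
        have m1: "m < Q" using elim(2) by (simp add: m_def)
        have "real M0 * (real Q - real D) \<le> real M0 * real m" using n unfolding m_def[symmetric] by (intro mult_left_mono) auto
        moreover have "real M0 * real D \<le> real Q" using D by (metis of_nat_le_iff of_nat_mult)
        ultimately have "(real M0 - 1) * real Q \<le> real M0 * real m" by (simp add: algebra_simps)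
        then have "real M0 - 1 \<le> real M0 * (y n - real k)" unfolding yk using elim(2) by (simp add: field_simps)
        moreover have "real M0 * (y n - real k) < (real M0 - 1) + 1"
          unfolding yk using elim(2) M0 m1 by (simp add: field_simps)
        ultimately show "in_arc M0 (real M0 - 1) (y n)"
          unfolding in_arc_def by (intro exI[of _ "int k"]) simp
      qed
      then have "real (card {n \<in> {..<N}. (c * n\<^sup>2) mod Q + D \<ge> Q}) \<le> real (card
         {n \<in> {..<N}. in_arc M0 (real M0 - 1) (y n)})"
        by (intro of_nat_mono card_mono) auto
      also have "\<dots> \<le> 24 * real (card {..<N}) / real M0 + 4 * (eps / 4 * real Q)"
        using B M0 by (intro card_arc_le) auto
      finally show "real (card {n \<in> {..<N}. (c * n\<^sup>2) mod Q + D \<ge> Q}) \<le> 24 * real N / real M0 + eps * real Q"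
        by simp
    qed
  qed
qed

section \<open>Correlations of the truncated products\<close>

definition tm_trunc :: "nat \<Rightarrow> nat \<Rightarrow> nat \<Rightarrow> nat \<Rightarrow> real" where
  "tm_trunc a b l m = tm_sign ((a * m) mod 2 ^ l) * tm_sign ((b * m) mod 2 ^ l)"

lemma abs_tm_trunc [simp]: "\<bar>tm_trunc a b l m\<bar> = 1"
  by (simp add: tm_trunc_def abs_mult)

lemma tm_trunc_cong: "m mod 2 ^ l = m' mod 2 ^ l \<Longrightarrow> tm_trunc a b l m = tm_trunc a b l m'"
  unfolding tm_trunc_def by (metis mod_mult_right_eq)

text \<open>Nested integer divisions commute: a b m divided by 2^u and then by b gives a m divided
  by 2^u, and likewise for b m. So one cell index determines both windows.\<close>

lemma tm_trunc_split:
  assumes "a > 0" "b > 0"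
  shows "tm_trunc a b (u + W) m = tm_trunc a b u m * tm_cell a b W ((a * b * m) div 2 ^ u)"
proof -
  have div: "(c * k) div 2 ^ u div c = k div 2 ^ u" if "c > 0" for c k :: nat
    using that by (metis div_mult2_eq mult.commute nonzero_mult_div_cancel_left less_not_refl)
  have "(a * b * m) div 2 ^ u div b = (a * m) div 2 ^ u"
    using div[of b "a * m"] assms by (simp add: ac_simps)
  moreover have "(a * b * m) div 2 ^ u div a = (b * m) div 2 ^ u"
    using div[of a "b * m"] assms by (simp add: ac_simps)
  ultimately show ?thesis unfolding tm_trunc_def tm_cell_def tm_sign_mod_split by simp
qed

lemma tm_average_periodic:
  fixes a b W :: nat
  defines "M \<equiv> 2 ^ W * (a * b)"
  assumes a: "a > 0" "b > 0"
  shows "tm_average a b W K r (j mod M) (z mod 2 ^ W) (d mod M) = tm_average a b W K r j z d"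
proof -
  have per: "tm_cell a b W (x + M * t) = tm_cell a b W x" for x t
    unfolding M_def by (rule periodic_add_mult[of "tm_cell a b W"]) (rule tm_cell_periodic[OF a])
  have cong: "tm_cell a b W x = tm_cell a b W y" if "x mod M = y mod M" for x y
    using per[of "x mod M" "x div M"] per[of "y mod M" "y div M"] that by (metis mod_mult_div_eq)
  have z: "(2 * k * (z mod 2 ^ W + c) * (a * b)) mod M = (2 * k * (z + c) * (a * b)) mod M" for k c
  proof -
    have "2 * k * (z + c) * (a * b) = 2 * k * (z mod 2 ^ W + c) * (a * b) + M * (2 * k * (z div 2 ^ W))"
    proof -
      have "z = z mod 2 ^ W + 2 ^ W * (z div 2 ^ W)" by simp
      then have "2 * k * (z + c) * (a * b) = 2 * k * ((z mod 2 ^ W + 2 ^ W * (z div 2 ^ W)) + c) * (a * b)" by simp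
      also have "\<dots> = 2 * k * (z mod 2 ^ W + c) * (a * b) + M * (2 * k * (z div 2 ^ W))"
        unfolding M_def by (simp only: algebra_simps)
      finally show ?thesis .
    qed
    then show ?thesis by simp
  qed
  show ?thesis unfolding tm_average_def
  proof (intro sum.cong refl arg_cong2[where f = "(*)"] cong)
    fix k
    show "(j mod M + 2 * k * (z mod 2 ^ W) * (a * b)) mod M = (j + 2 * k * z * (a * b)) mod M"
      using z[of k 0] by (intro mod_add_cong) auto
    show "(j mod M + d mod M + 2 * k * (z mod 2 ^ W + r) * (a * b)) mod M =
        (j + d + 2 * k * (z + r) * (a * b)) mod M"
      using z[of k r] by (intro mod_add_cong) (auto simp: mod_simps)
  qed
qed

text \<open>Shifting \<open>n\<close> by a multiple of \<open>2 ^ u\<close> does not change the digits of \<open>n\<^sup>2\<close> below position \<open>u\<close>; averaging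
  over such shifts isolates the window of digits from \<open>u\<close> to \<open>u + W\<close>.\<close>

lemma tm_trunc_window_average:
  fixes a b W u K r :: nat
  defines "J \<equiv> (\<lambda>n. (a * b * n\<^sup>2) div 2 ^ u)" and "E \<equiv> (\<lambda>n. (a * b * (2 * r * n + r\<^sup>2)) div 2 ^ u)"
  assumes a: "a > 0" "b > 0" and uW: "W \<le> u"
  shows "real K * \<bar>\<Sum>n<N. tm_trunc a b (u + W) (n\<^sup>2) * tm_trunc a b (u + W) ((n + r)\<^sup>2)\<bar> \<le>
     real K ^ 2 * 2 ^ u + (\<Sum>n<N. sqrt ((tm_average a b W K r (J n) n (E n))\<^sup>2 + (tm_average a b W K r (J n) n (E n + 1))\<^sup>2))"
proof -
  define M where "M = 2 ^ W * (a * b)"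
  define G where "G = tm_cell a b W"
  define H where "H n = G (J n) * G (J (n + r))" for n
  define L where "L n = tm_trunc a b u (n\<^sup>2) * tm_trunc a b u ((n + r)\<^sup>2)" for n
  define v where "v n = tm_trunc a b (u + W) (n\<^sup>2) * tm_trunc a b (u + W) ((n + r)\<^sup>2)" for n
  have v: "v n = L n * H n" for n
    unfolding v_def L_def H_def J_def G_def tm_trunc_split[OF a] by simp
  have per: "G (x + M * t) = G x" for x t
    unfolding G_def M_def by (rule periodic_add_mult[of "tm_cell a b W"]) (rule tm_cell_periodic[OF a])
  have sq: "(n + k * 2 ^ u)\<^sup>2 = n\<^sup>2 + 2 ^ u * (2 * k * n + k\<^sup>2 * 2 ^ u)" for n k :: nat
    by (simp add: power2_eq_square algebra_simps)
  have L_shift: "L (n + k * 2 ^ u) = L n" for n k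
  proof -
    have "tm_trunc a b u ((m + k * 2 ^ u)\<^sup>2) = tm_trunc a b u (m\<^sup>2)" for m
      unfolding sq by (rule tm_trunc_cong) simp
    from this[of n] this[of "n + r"] show ?thesis unfolding L_def by (simp add: ac_simps)
  qed
  \<comment> \<open>The quadratic part a b k^2 2^u of the increment is a multiple of the period M
    because W \<le> u; only the part linear in n survives.\<close>
  have J_shift: "G (J (n + k * 2 ^ u)) = G (J n + 2 * k * n * (a * b))" for n k
  proof -
    have "a * b * (n + k * 2 ^ u)\<^sup>2 = a * b * n\<^sup>2 + 2 ^ u * (2 * k * n * (a * b) + a * b * k\<^sup>2 * 2 ^ u)"
      unfolding sq by (simp add: algebra_simps)
    then have "J (n + k * 2 ^ u) = J n + (2 * k * n * (a * b) + a * b * k\<^sup>2 * 2 ^ u)"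
      unfolding J_def by simp
    also have "a * b * k\<^sup>2 * 2 ^ u = M * (k\<^sup>2 * 2 ^ (u - W))"
      using uW unfolding M_def by (simp add: ac_simps flip: power_add)
    finally have "G (J (n + k * 2 ^ u)) = G ((J n + 2 * k * n * (a * b)) + M * (k\<^sup>2 * 2 ^ (u - W)))"
      by (simp add: add.assoc)
    then show ?thesis unfolding per .
  qed
  \<comment> \<open>The integer part of a sum exceeds the sum of the integer parts by 0 or
    1.\<close>
  have J_add: "J (n + r) = J n + E n \<or> J (n + r) = J n + (E n + 1)" for n
  proof -
    define x where "x = a * b * n\<^sup>2"
    define y where "y = a * b * (2 * r * n + r\<^sup>2)"
    have "a * b * (n + r)\<^sup>2 = x + y" unfolding x_def y_def by (simp add: power2_eq_square algebra_simps)
    then have "J (n + r) = x div 2 ^ u + y div 2 ^ u + (x mod 2 ^ u + y mod 2 ^ u) div 2 ^ u"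
      unfolding J_def using div_add1_eq[of x y "2 ^ u"] by simp
    moreover have "(x mod 2 ^ u + y mod 2 ^ u) div 2 ^ u < 2"
    proof (rule less_mult_imp_div_less)
      have "x mod 2 ^ u < 2 ^ u" "y mod 2 ^ u < 2 ^ u" by simp_all
      then show "x mod 2 ^ u + y mod 2 ^ u < 2 * 2 ^ u" by linarith
    qed
    ultimately show ?thesis unfolding J_def E_def x_def y_def by linarith
  qed
  define A where "A n = (\<Sum>k<K. H (n + k * 2 ^ u))" for n
  have A: "A n = tm_average a b W K r (J n) n (J (n + r) - J n)" for n
  proof -
    have "J n \<le> J (n + r)" unfolding J_def by (intro div_le_mono mult_le_mono power_mono) auto
    then have "H (n + k * 2 ^ u) = G (J n + 2 * k * n * (a * b)) * G (J n + (J (n + r) - J n) + 2 * k * (n + r) * (a * b))" for k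
      using J_shift[of n k] J_shift[of "n + r" k] unfolding H_def by (simp add: ac_simps)
    then show ?thesis unfolding A_def tm_average_def G_def by simp
  qed
  \<comment> \<open>Which of the two differences occurs for a given n is not tracked: the squares
    for both are added.\<close>
  have A_le: "\<bar>A n\<bar> \<le> sqrt ((tm_average a b W K r (J n) n (E n))\<^sup>2 + (tm_average a b W K r (J n) n (E n + 1))\<^sup>2)" for n
  proof -
    have "J (n + r) - J n = E n \<or> J (n + r) - J n = E n + 1" using J_add[of n] by auto
    then show ?thesis unfolding A by (intro real_le_rsqrt) auto
  qed
  have "real K * (\<Sum>n<N. v n) - (\<Sum>n<N. L n * A n) = (\<Sum>k<K. (\<Sum>n<N. v n) - (\<Sum>n<N. v (n + k * 2 ^ u)))"
  proof -
    have "(\<Sum>n<N. L n * A n) = (\<Sum>n<N. \<Sum>k<K. v (n + k * 2 ^ u))"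
      unfolding A_def v L_shift sum_distrib_left ..
    also have "\<dots> = (\<Sum>k<K. \<Sum>n<N. v (n + k * 2 ^ u))" by (rule sum.swap)
    finally show ?thesis by (simp add: sum_subtractf)
  qed
  also have "\<bar>\<dots>\<bar> \<le> (\<Sum>k<K. 2 * real (k * 2 ^ u))"
  proof (rule order_trans[OF sum_abs], intro sum_mono)
    fix k
    have "norm ((\<Sum>n<N. v (n + k * 2 ^ u)) - (\<Sum>n<N. v n)) \<le> 2 * real (k * 2 ^ u)"
      by (rule norm_sum_shift_le) (simp add: v_def abs_mult)
    then show "\<bar>(\<Sum>n<N. v n) - (\<Sum>n<N. v (n + k * 2 ^ u))\<bar> \<le> 2 * real (k * 2 ^ u)" by (simp add: abs_minus_commute)
  qed
  also have "(\<Sum>k<K. 2 * real (k * 2 ^ u)) = (\<Sum>k<K. 2 * real k) * 2 ^ u" by (simp add: sum_distrib_right mult.assoc)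
  also have "(\<Sum>k<K. 2 * real k) * 2 ^ u \<le> real K ^ 2 * 2 ^ u"
  proof (rule mult_right_mono)
    show "(\<Sum>k<K. 2 * real k) \<le> real K ^ 2" by (induction K) (auto simp: algebra_simps power2_eq_square)
  qed simp
  finally have "real K * \<bar>\<Sum>n<N. v n\<bar> \<le> real K ^ 2 * 2 ^ u + \<bar>\<Sum>n<N. L n * A n\<bar>" 
    using abs_mult[of "real K" "\<Sum>n<N. v n"] by simp
  also have "\<bar>\<Sum>n<N. L n * A n\<bar> \<le> (\<Sum>n<N. \<bar>A n\<bar>)"
    by (rule order_trans[OF sum_abs]) (simp add: abs_mult L_def)
  also have "\<dots> \<le> (\<Sum>n<N. sqrt ((tm_average a b W K r (J n) n (E n))\<^sup>2 + (tm_average a b W K r (J n) n (E n + 1))\<^sup>2))"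
    by (intro sum_mono A_le)
  finally show ?thesis unfolding v_def by simp
qed

text \<open>The third condition localises n: its left side grows by at least 1 whenever n grows by
  2^u, so a fixed value d confines n to an interval of length 2^u, which is below Q since W > 0. The
  second is an arc condition, because a b n^2 / 2^u = M n^2 / Q.\<close>

lemma window_cell_count_le:
  fixes a b r W u N q M Q :: nat
  defines "q \<equiv> 2 ^ W" and "M \<equiv> 2 ^ W * (a * b)" and "Q \<equiv> 2 ^ (u + W)"
  assumes a: "a > 0" "b > 0" and r: "r > 0" and W: "W > 0" and c0: "c \<ge> 0"
    and count: "\<And>x l0 z x0. l0 < Q \<Longrightarrow>
      real (card {n \<in> {x..<x + l0}. n mod q = z \<and>
        in_arc M x0 (real n ^ 2 / real Q)})
      \<le> 24 * (real l0 / real q + 1) / real M + c"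
  shows "real (card {n \<in> {..<N}. n mod q = z \<and> ((a * b * n\<^sup>2) div 2 ^ u) mod M = j \<and>
      (a * b * (2 * r * n + r\<^sup>2)) div 2 ^ u = d}) \<le> 24 * (2 ^ u / real q + 1) / real M + c"
    (is "real (card ?S) \<le> ?B")
proof (cases "?S = {}")
  case True
  have "real (card ?S) = 0" unfolding True by simp
  also have "0 \<le> ?B" using c0 by (intro add_nonneg_nonneg divide_nonneg_nonneg mult_nonneg_nonneg) auto
  finally show ?thesis .
next
  case False
  define x where "x = Min ?S"
  have fin: "finite ?S" by simp
  have x: "x \<in> ?S" unfolding x_def by (rule Min_in[OF fin False])
  have x_le: "x \<le> n" if "n \<in> ?S" for n unfolding x_def by (rule Min_le[OF fin that])
  have "?S \<subseteq> {n \<in> {x..<x + 2 ^ u}. n mod q = z \<and>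
        in_arc M (real j) (real n ^ 2 / real Q)}"
  proof
    fix n assume n: "n \<in> ?S"
    have xn: "x \<le> n" by (rule x_le[OF n])
    have "n < x + 2 ^ u"
    proof (rule ccontr)
      assume "\<not> ?thesis"
      then have le: "x + 2 ^ u \<le> n" by simp
      have "a * b * (2 * r * x + r\<^sup>2) + 2 ^ u \<le> a * b * (2 * r * x + r\<^sup>2) + a * b * (2 * r) * 2 ^ u"
        using a r by simp
      also have "\<dots> = a * b * (2 * r * (x + 2 ^ u) + r\<^sup>2)" by (simp add: algebra_simps)
      also have "\<dots> \<le> a * b * (2 * r * n + r\<^sup>2)" using le by (intro mult_le_mono add_le_mono) auto
      finally have "(a * b * (2 * r * x + r\<^sup>2) + 2 ^ u) div 2 ^ u \<le> (a * b * (2 * r * n + r\<^sup>2)) div 2 ^ u"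
        by (rule div_le_mono)
      then show False using x n by simp
    qed
    moreover have "in_arc M (real j) (real n ^ 2 / real Q)"
    proof -
      define X where "X = a * b * n\<^sup>2"
      define k where "k = (X div 2 ^ u) div M"
      have "X div 2 ^ u = M * k + j" using n unfolding k_def X_def by auto
      then have X: "X = 2 ^ u * (M * k + j) + X mod 2 ^ u" by (metis mult_div_mod_eq)
      have "X mod 2 ^ u < 2 ^ u" by simp
      then have X2: "real (X mod 2 ^ u) < 2 ^ u" by (metis of_nat_less_iff of_nat_numeral of_nat_power)
      have "real X = 2 ^ u * (real M * real k + real j) + real (X mod 2 ^ u)"
        by (subst X) (simp del: of_nat_mod)
      moreover have "real M * (real n ^ 2 / real Q) = real X / 2 ^ u"
        by (simp add: M_def Q_def X_def power_add)
      ultimately have "real M * (real n ^ 2 / real Q - real k) = real j + real (X mod 2 ^ u) / 2 ^ u"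
        by (simp add: right_diff_distrib add_divide_distrib)
      moreover have "0 \<le> real (X mod 2 ^ u) / 2 ^ u" "real (X mod 2 ^ u) / 2 ^ u < 1" using X2 by simp_all
      ultimately have "real j \<le> real M * (real n ^ 2 / real Q - real k)" "real M * (real n ^ 2 / real Q - real k) < real j + 1"
        by linarith+
      then show ?thesis unfolding in_arc_def by (intro exI[of _ "int k"]) simp
    qed
    ultimately show "n \<in> {n \<in> {x..<x + 2 ^ u}. n mod q = z \<and>
        in_arc M (real j) (real n ^ 2 / real Q)}"
      using n xn by auto
  qed
  then have "real (card ?S) \<le> real (card {n \<in> {x..<x + 2 ^ u}. n mod q = z \<and>
        in_arc M (real j) (real n ^ 2 / real Q)})"
    by (intro of_nat_mono card_mono) auto
  also have "\<dots> \<le> 24 * (real (2 ^ u) / real q + 1) / real M + c"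
    using W by (intro count) (auto simp: Q_def)
  finally show ?thesis by simp
qed

lemma sum_by_cells_le:
  fixes f :: "'a \<Rightarrow> real" and F :: "'b \<Rightarrow> real"
  assumes "finite S" "finite T" "key ` S \<subseteq> T" "\<And>n. n \<in> S \<Longrightarrow> f n \<le> F (key n)"
    "\<And>t. t \<in> T \<Longrightarrow> real (card {n \<in> S. key n = t}) \<le> c" "\<And>t. F t \<ge> 0"
  shows "(\<Sum>n\<in>S. f n) \<le> c * (\<Sum>t\<in>T. F t)"
proof -
  have "(\<Sum>n\<in>S. f n) \<le> (\<Sum>n\<in>S. F (key n))" using assms by (intro sum_mono) auto
  also have "\<dots> = (\<Sum>t\<in>T. \<Sum>n\<in>{n \<in> S. key n = t}. F (key n))" using assms by (intro sum.group[symmetric]) auto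
  also have "\<dots> = (\<Sum>t\<in>T. real (card {n \<in> S. key n = t}) * F t)" by (intro sum.cong refl) simp
  also have "\<dots> \<le> (\<Sum>t\<in>T. c * F t)" using assms by (intro sum_mono mult_right_mono) auto
  finally show ?thesis by (simp add: sum_distrib_left)
qed

text \<open>The n < N are sorted into q M^2 cells by \<open>n mod q\<close>,
  \<open>J n mod M\<close> and \<open>E n\<close>, and no cell holds more than a constant multiple
  of Q / (q^2 M) of them. So the sum of squared averages over n is at most a constant, depending
  only on a, b and P, times N times the mean square over all cells, which is of order K.\<close>

lemma tm_trunc_correlation_small:
  fixes a b r P :: nat
  assumes ab: "odd a" "odd b" "a \<noteq> b" and r: "r > 0" and P: "3 * r \<le> P" and delta: "delta > 0"
  shows "\<forall>\<^sub>F N :: nat in sequentially. \<forall>l. P * N \<le> 2 ^ l \<longrightarrow> 2 ^ l \<le> 2 * P * N \<longrightarrow>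
     \<bar>\<Sum>n<N. tm_trunc a b l (n\<^sup>2) * tm_trunc a b l ((n + r)\<^sup>2)\<bar> \<le> delta * real N"
proof -
  have a: "a > 0" "b > 0" using ab by (auto intro: odd_pos)
  have P0: "P > 0" using P r by linarith
  \<comment> \<open>The squared sum of the averages comes out as at most 576 P a b K N^2, to be
    compared with (K N delta / 2)^2; this gives 4 * 576 = 2304.\<close>
  obtain K :: nat where K: "real K > 2304 * real P * real a * real b / delta\<^sup>2"
    using reals_Archimedean2 by blast
  have "0 \<le> 2304 * real P * real a * real b / delta\<^sup>2" by simp
  then have K0: "K > 0" using K by (metis le_less_trans of_nat_0_less_iff)
  have "\<forall>\<^sub>F W in sequentially. (1/2::real) ^ W < delta / (4 * real K * real P)"
    using delta K0 P0 by (intro order_tendstoD(2)[OF LIMSEQ_realpow_zero]) auto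
  moreover have "\<forall>\<^sub>F W in sequentially. \<forall>i<a. \<forall>j<b. \<forall>t. norm (tm_fourier a b W i j t) \<le> 1 / real K * 2 ^ W"
    using K0 by (intro tm_fourier_small ab) simp
  ultimately have "\<forall>\<^sub>F W in sequentially. W > 0 \<and> (1/2::real) ^ W < delta / (4 * real K * real P) \<and>
      (\<forall>i<a. \<forall>j<b. \<forall>t. norm (tm_fourier a b W i j t) \<le> 1 / real K * 2 ^ W)"
    using eventually_gt_at_top[of 0] by eventually_elim simp
  \<comment> \<open>The first smallness condition pays for the shifting error K^2 2^u, as 2^u is Q /
    2^W; the second brings all off-diagonal pairs together down to the size of the diagonal.\<close>
  then obtain W where W: "W > 0" "(1/2::real) ^ W < delta / (4 * real K * real P)" and
    four: "\<And>i j t. i < a \<Longrightarrow> j < b \<Longrightarrow> norm (tm_fourier a b W i j t) \<le> 1 / real K * 2 ^ W"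
    by (auto simp: eventually_sequentially)
  define q :: nat where "q = 2 ^ W"
  define M where "M = 2 ^ W * (a * b)"
  have q0: "q > 0" and M0: "M > 0" using a by (auto simp: q_def M_def)
  \<comment> \<open>Over the common denominator q^2 M the cell bound has the parts 24 Q, 24 q^2
    \<le> 12 Q and, by this choice, 12 Q; together they make the 48 Q of \<open>c\<close>.\<close>
  define eta where "eta = 12 / (real q ^ 2 * real M)"
  have eta: "eta > 0" using q0 M0 by (simp add: eta_def)
  obtain Q0 where Q0: "\<And>Q x l0 z x0. Q \<ge> Q0 \<Longrightarrow> l0 < Q \<Longrightarrow>
    real (card {n \<in> {x..<x + l0}. n mod q = z \<and>
        in_arc M x0 (real n ^ 2 / real Q)})
      \<le> 24 * (real l0 / real q + 1) / real M + eta * real Q"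
    using quadratic_cell_count[OF q0 M0 eta] unfolding eventually_sequentially by blast
  show ?thesis
  proof (rule eventually_sequentiallyI[of "max (max Q0 (2 * q\<^sup>2)) r"], intro allI impI)
    fix N l assume N: "max (max Q0 (2 * q\<^sup>2)) r \<le> N" and l1: "P * N \<le> 2 ^ l" and l2: "2 ^ l \<le> 2 * P * N"
    define Q :: nat where "Q = 2 ^ l"
    have NQ: "N \<le> Q" using l1 P0 unfolding Q_def
      by (metis One_nat_def Suc_leI le_trans mult.commute mult_le_mono2 nat_mult_1_right)
    have "q\<^sup>2 \<le> Q" using NQ N by simp
    then have "(2::nat) ^ (2 * W) \<le> 2 ^ l" unfolding q_def Q_def by (simp only: power_mult[symmetric] mult.commute)
    then have lW: "2 * W \<le> l" by (simp add: power_le_imp_le_exp)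
    define u where "u = l - W"
    have l: "l = u + W" and uW: "W \<le> u" using lW by (auto simp: u_def)
    have Qu: "real Q = 2 ^ u * real q" unfolding Q_def l q_def by (simp add: power_add)
    define J where "J n = (a * b * n\<^sup>2) div 2 ^ u" for n
    define E where "E n = (a * b * (2 * r * n + r\<^sup>2)) div 2 ^ u" for n
    define phi where "phi z j d = (tm_average a b W K r j z d)\<^sup>2" for z j d
    define F where "F = (\<lambda>(z, j, d). phi z j d + phi z j (d + 1))"
    define V where "V n = (tm_average a b W K r (J n) n (E n))\<^sup>2 + (tm_average a b W K r (J n) n (E n + 1))\<^sup>2" for n
    define key where "key n = (n mod q, J n mod M, E n)" for n
    define c where "c = 48 * real Q / (real q ^ 2 * real M)"
    define T where "T = {..<q} \<times> {..<M} \<times> {..<M}"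
    \<comment> \<open>The differences \<open>E n\<close> stay within one period M. This is the
      purpose of 3 r \<le> P and P N \<le> 2^l.\<close>
    have E_lt: "E n < M" if "n < N" for n
    proof -
      have "2 * r * n + r\<^sup>2 < 2 * r * N + r * N"
        using that r N by (intro add_less_le_mono) (auto simp: power2_eq_square)
      also have "\<dots> = 3 * r * N" by simp
      also have "\<dots> \<le> P * N" using P by (intro mult_le_mono1) auto
      also have "\<dots> \<le> 2 ^ l" by (rule l1)
      finally have "a * b * (2 * r * n + r\<^sup>2) < a * b * 2 ^ l" using a by simp
      also have "\<dots> = M * 2 ^ u" unfolding M_def l by (simp add: power_add)
      finally show ?thesis unfolding E_def by (rule less_mult_imp_div_less)
    qed
    have cell: "real (card {n \<in> {..<N}. key n = t}) \<le> c" for t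
    proof -
      obtain z j d where t: "t = (z, j, d)" by (cases t)
      have "{n \<in> {..<N}. key n = t} = {n \<in> {..<N}. n mod 2 ^ W = z \<and> ((a * b * n\<^sup>2) div 2 ^ u) mod (2 ^ W * (a * b)) = j \<and>
          (a * b * (2 * r * n + r\<^sup>2)) div 2 ^ u = d}"
        unfolding t key_def J_def E_def q_def M_def by auto
      also have "real (card \<dots>) \<le> 24 * (2 ^ u / real (2 ^ W) + 1) / real (2 ^ W * (a * b)) + eta * real Q"
      proof (rule window_cell_count_le[OF a r W(1)])
        show "0 \<le> eta * real Q" using eta by simp
        have QQ: "Q \<ge> Q0" using N NQ by simp
        show "real (card {n \<in> {x..<x + l0}. n mod 2 ^ W = z \<and> in_arc (2 ^ W * (a * b)) x0 (real n ^ 2 / real (2 ^ (u + W)))})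
          \<le> 24 * (real l0 / real (2 ^ W) + 1) / real (2 ^ W * (a * b)) + eta * real Q"
          if "l0 < 2 ^ (u + W)" for x l0 z x0
          using Q0[OF QQ, of l0 x z x0] that unfolding Q_def l q_def M_def by blast
      qed
      also have "\<dots> = 24 * (2 ^ u / real q + 1) / real M + eta * real Q"
        unfolding q_def M_def ..
      also have "\<dots> = (24 * (2 ^ u * real q) + 24 * real q ^ 2 + 12 * real Q) / (real q ^ 2 * real M)"
        unfolding eta_def using q0 M0 by (simp add: field_simps power2_eq_square)
      also have "\<dots> \<le> c"
      proof -
        have "2 * q\<^sup>2 \<le> Q" using N NQ by simp
        then have "2 * real q ^ 2 \<le> real Q" by (metis of_nat_le_iff of_nat_mult of_nat_numeral of_nat_power)
        then show ?thesis unfolding c_def Qu[symmetric] by (intro divide_right_mono) auto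
      qed
      finally show ?thesis .
    qed
    have per: "tm_average a b W K r (j mod M) (z mod q) d = tm_average a b W K r j z d" for j z d
      using tm_average_periodic[OF a, of W K r j z d] tm_average_periodic[OF a, of W K r "j mod M" "z mod q" d]
      by (simp add: q_def M_def)
    have phi_per: "phi z j (d + M) = phi z j d" for z j d
      unfolding phi_def using tm_average_periodic[OF a, of W K r j z d] tm_average_periodic[OF a, of W K r j z "d + M"]
      by (simp add: M_def)
    have S1: "(\<Sum>n<N. V n)
        \<le> c * (\<Sum>t\<in>T. F t)"
    proof (rule sum_by_cells_le[where key = key])
      show "key ` {..<N} \<subseteq> T" using E_lt q0 M0 by (auto simp: T_def key_def)
      fix n
      show "V n \<le> F (key n)"
        unfolding V_def F_def key_def phi_def by (simp add: per)
    qed (use cell in \<open>auto simp: T_def F_def phi_def\<close>)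
    have "(\<Sum>t\<in>T. F t) = (\<Sum>z<q. \<Sum>j<M. \<Sum>d<M. phi z j d + phi z j (d + 1))"
      unfolding T_def F_def by (simp add: sum.cartesian_product)
    also have "\<dots> = 2 * (\<Sum>z<q. \<Sum>j<M. \<Sum>d<M. phi z j d)"
    proof -
      have "(\<Sum>d<M. phi z j d + phi z j (d + 1)) = 2 * (\<Sum>d<M. phi z j d)" for z j
        using sum_periodic_shift[of "phi z j" M 1] phi_per by (simp add: sum.distrib)
      then show ?thesis by (simp add: sum_distrib_left)
    qed
    also have "(\<Sum>z<q. \<Sum>j<M. \<Sum>d<M. phi z j d) \<le> (real K + 2 * real K ^ 3 * (1 / real K)\<^sup>2) * (real M ^ 2 * 2 ^ W)"
      unfolding phi_def q_def M_def by (rule tm_average_mean_square_le[OF a four])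
    also have "(real K + 2 * real K ^ 3 * (1 / real K)\<^sup>2) * (real M ^ 2 * 2 ^ W) = 3 * real K * real M ^ 2 * real q"
      using K0 by (simp add: q_def power2_eq_square power3_eq_cube field_simps)
    finally have "(\<Sum>t\<in>T. F t) \<le> 2 * (3 * real K * real M ^ 2 * real q)" by simp
    then have "c * (\<Sum>t\<in>T. F t) \<le> c * (2 * (3 * real K * real M ^ 2 * real q))"
      by (rule mult_left_mono) (simp add: c_def)
    with S1 have "(\<Sum>n<N. V n)
       \<le> c * (2 * (3 * real K * real M ^ 2 * real q))" by (rule order_trans)
    also have "\<dots> = 288 * real K * real Q * (real M / real q)"
      unfolding c_def using q0 M0 by (simp add: field_simps power2_eq_square)
    also have "real M / real q = real a * real b" unfolding M_def q_def by simp
    finally have sumF: "(\<Sum>n<N. V n)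
       \<le> 288 * real K * real Q * (real a * real b)" .
    have Q2: "real Q \<le> 2 * real P * real N" using l2 unfolding Q_def by (metis of_nat_le_iff of_nat_mult of_nat_numeral)
    have V0: "V n \<ge> 0" for n by (simp add: V_def)
    have "(\<Sum>n<N. sqrt (V n))\<^sup>2 \<le> real N * (\<Sum>n<N. V n)"
      using Cauchy_Schwarz_ineq_sum[of "\<lambda>_. 1" "\<lambda>n. sqrt (V n)" "{..<N}"] V0 by simp
    also have "\<dots> \<le> real N * (288 * real K * (2 * real P * real N) * (real a * real b))"
    proof (rule mult_left_mono)
      have "(\<Sum>n<N. V n) \<le> 288 * real K * real Q * (real a * real b)" by (rule sumF)
      also have "\<dots> \<le> 288 * real K * (2 * real P * real N) * (real a * real b)"
        using Q2 by (intro mult_right_mono mult_left_mono) auto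
      finally show "(\<Sum>n<N. V n) \<le> 288 * real K * (2 * real P * real N) * (real a * real b)" .
    qed simp
    also have "\<dots> = (real N)\<^sup>2 * real K * (576 * real P * real a * real b)"
      by (simp add: power2_eq_square)
    also have "\<dots> \<le> (real N)\<^sup>2 * real K * (real K * (delta / 2)\<^sup>2)"
      using K delta by (intro mult_left_mono) (auto simp: field_simps power2_eq_square)
    also have "\<dots> = (real N * real K * (delta / 2))\<^sup>2" by (simp add: power2_eq_square)
    finally have sumV: "(\<Sum>n<N. sqrt (V n)) \<le> real N * real K * (delta / 2)"
      by (rule power2_le_imp_le) (use delta in simp)
    have "real K * \<bar>\<Sum>n<N. tm_trunc a b l (n\<^sup>2) * tm_trunc a b l ((n + r)\<^sup>2)\<bar> \<le> real K ^ 2 * 2 ^ u + (\<Sum>n<N. sqrt (V n))"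
      unfolding l V_def J_def E_def by (rule tm_trunc_window_average[OF a uW])
    also have "real K ^ 2 * 2 ^ u \<le> real N * real K * (delta / 2)"
    proof -
      have "2 ^ u = real Q * (1/2) ^ W" unfolding Qu q_def by (simp add: power_one_over)
      also have "\<dots> \<le> (2 * real P * real N) * (delta / (4 * real K * real P))"
        using Q2 W(2) by (intro mult_mono) auto
      finally have "real K ^ 2 * 2 ^ u \<le> real K ^ 2 * ((2 * real P * real N) * (delta / (4 * real K * real P)))"
        by (intro mult_left_mono) auto
      then show ?thesis using K0 P0 by (simp add: power2_eq_square field_simps)
    qed
    finally have "real K * \<bar>\<Sum>n<N. tm_trunc a b l (n\<^sup>2) * tm_trunc a b l ((n + r)\<^sup>2)\<bar> \<le> real K * (delta * real N)"
      using sumV by (simp add: algebra_simps)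
    then show "\<bar>\<Sum>n<N. tm_trunc a b l (n\<^sup>2) * tm_trunc a b l ((n + r)\<^sup>2)\<bar> \<le> delta * real N"
      using K0 by simp
  qed
qed

section \<open>Removing the truncation\<close>

text \<open>The increment of c n^2 is enlarged to its value at n = N, independent of n, so the
  exceptional sets have the form counted by \<open>carry_count\<close>. Outside both sets the two
  products agree; inside they differ by at most 2.\<close>

lemma tm_truncation_error_le:
  fixes a b r l N :: nat
  defines "B \<equiv> (\<lambda>c. {n \<in> {..<N}. (c * n\<^sup>2) mod 2 ^ l + c * (2 * r * N + r\<^sup>2) \<ge> 2 ^ l})"
    and "g \<equiv> (\<lambda>n. tm_sign (a * n\<^sup>2) * tm_sign (b * n\<^sup>2))"
  shows "\<bar>(\<Sum>n<N. g n * g (n + r)) - (\<Sum>n<N. tm_trunc a b l (n\<^sup>2) * tm_trunc a b l ((n + r)\<^sup>2))\<bar>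
    \<le> 2 * (real (card (B a)) + real (card (B b)))"
proof -
  define D where "D n = g n * g (n + r) - tm_trunc a b l (n\<^sup>2) * tm_trunc a b l ((n + r)\<^sup>2)" for n
  have sq: "c * (n + r)\<^sup>2 = c * n\<^sup>2 + c * (2 * r * n + r\<^sup>2)" for c n :: nat
    by (simp add: power2_eq_square algebra_simps)
  have good: "tm_sign (c * n\<^sup>2) * tm_sign (c * (n + r)\<^sup>2) =
      tm_sign ((c * n\<^sup>2) mod 2 ^ l) * tm_sign ((c * (n + r)\<^sup>2) mod 2 ^ l)" if "n < N" "n \<notin> B c" for c n
  proof -
    have "c * (2 * r * n + r\<^sup>2) \<le> c * (2 * r * N + r\<^sup>2)" using that by (intro mult_le_mono add_le_mono) auto
    moreover have "(c * n\<^sup>2) mod 2 ^ l + c * (2 * r * N + r\<^sup>2) < 2 ^ l" using that by (auto simp: B_def)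
    ultimately have "(c * n\<^sup>2) mod 2 ^ l + c * (2 * r * n + r\<^sup>2) < 2 ^ l" by linarith
    then show ?thesis unfolding sq by (rule tm_sign_no_carry)
  qed
  have D0: "D n = 0" if "n < N" "n \<notin> B a" "n \<notin> B b" for n
  proof -
    have "g n * g (n + r) = (tm_sign (a * n\<^sup>2) * tm_sign (a * (n + r)\<^sup>2)) * (tm_sign (b * n\<^sup>2) * tm_sign (b * (n + r)\<^sup>2))"
      unfolding g_def by (simp only: ac_simps)
    also have "\<dots> = tm_trunc a b l (n\<^sup>2) * tm_trunc a b l ((n + r)\<^sup>2)"
      using good[OF that(1,2)] good[OF that(1,3)] unfolding tm_trunc_def by (simp only: ac_simps)
    finally show ?thesis by (simp add: D_def)
  qed
  have D2: "\<bar>D n\<bar> \<le> 2" for n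
  proof -
    have "\<bar>g n * g (n + r)\<bar> = 1" "\<bar>tm_trunc a b l (n\<^sup>2) * tm_trunc a b l ((n + r)\<^sup>2)\<bar> = 1"
      by (simp_all add: g_def abs_mult)
    then show ?thesis unfolding D_def by linarith
  qed
  have "(\<Sum>n<N. g n * g (n + r)) - (\<Sum>n<N. tm_trunc a b l (n\<^sup>2) * tm_trunc a b l ((n + r)\<^sup>2)) = (\<Sum>n<N. D n)"
    by (simp add: D_def sum_subtractf)
  also have "\<dots> = (\<Sum>n\<in>B a \<union> B b. D n)"
    by (rule sum.mono_neutral_right) (auto simp: B_def D0[unfolded B_def])
  also have "\<bar>\<dots>\<bar> \<le> (\<Sum>n\<in>B a \<union> B b. 2)" by (rule order_trans[OF sum_abs]) (intro sum_mono D2)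
  also have "\<dots> = 2 * real (card (B a \<union> B b))" by simp
  also have "\<dots> \<le> 2 * (real (card (B a)) + real (card (B b)))"
    using card_Un_le[of "B a" "B b"] by (metis mult_left_mono of_nat_add of_nat_mono zero_le_numeral)
  finally show ?thesis .
qed

lemma tm_squares_correlation_small:
  fixes a b r :: nat
  defines "g \<equiv> (\<lambda>n. tm_sign (a * n\<^sup>2) * tm_sign (b * n\<^sup>2))"
  assumes ab: "odd a" "odd b" "a \<noteq> b" and r: "r > 0" and delta: "delta > 0"
  shows "\<forall>\<^sub>F N in sequentially. \<bar>\<Sum>n<N. g n * g (n + r)\<bar> \<le> delta * real N"
proof -
  have a: "a > 0" "b > 0" using ab by (auto intro: odd_pos)
  \<comment> \<open>384 = 16 * 24: the arc term 24 N / M0 becomes at most delta N / 16, and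
    \<open>eta\<close> below makes the other error equally small.\<close>
  obtain M0 :: nat where M0: "real M0 > 384 / delta" using reals_Archimedean2 by blast
  have "0 < 384 / delta" using delta by simp
  then have M00: "M0 > 0" using M0 by (metis less_trans of_nat_0_less_iff)
  \<comment> \<open>With 2^l \<ge> P N the increments of a n^2 and b n^2 are at most 2^l / M0, as
    \<open>carry_count\<close> asks.\<close>
  define P where "P = 3 * r * (M0 * (a * b))"
  have P0: "P > 0" using r M00 a by (simp add: P_def)
  have Pr: "3 * r \<le> P" using M00 a unfolding P_def by simp
  define eta where "eta = delta / (32 * real P)"
  have eta: "eta > 0" using delta P0 by (simp add: eta_def)
  obtain Q1 where Q1: "\<And>Q N D. Q \<ge> Q1 \<Longrightarrow> N \<le> Q \<Longrightarrow> M0 * D \<le> Q \<Longrightarrow>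
     real (card {n \<in> {..<N}. (a * n\<^sup>2) mod Q + D \<ge> Q}) \<le> 24 * real N / real M0 + eta * real Q"
    using carry_count[OF a(1) M00 eta] unfolding eventually_sequentially by blast
  obtain Q2 where Q2: "\<And>Q N D. Q \<ge> Q2 \<Longrightarrow> N \<le> Q \<Longrightarrow> M0 * D \<le> Q \<Longrightarrow>
     real (card {n \<in> {..<N}. (b * n\<^sup>2) mod Q + D \<ge> Q}) \<le> 24 * real N / real M0 + eta * real Q"
    using carry_count[OF a(2) M00 eta] unfolding eventually_sequentially by blast
  have "\<forall>\<^sub>F N :: nat in sequentially. \<forall>l. P * N \<le> 2 ^ l \<longrightarrow> 2 ^ l \<le> 2 * P * N \<longrightarrow>
     \<bar>\<Sum>n<N. tm_trunc a b l (n\<^sup>2) * tm_trunc a b l ((n + r)\<^sup>2)\<bar> \<le> delta / 2 * real N"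
    using delta by (intro tm_trunc_correlation_small ab r Pr) simp
  then show ?thesis
    using eventually_ge_at_top[of "max (max Q1 Q2) (max r 2)"]
  proof eventually_elim
    case (elim N)
    have N: "N \<ge> Q1" "N \<ge> Q2" "N \<ge> r" "N \<ge> 2" using elim(2) by auto
    have PN: "2 \<le> P * N" using N P0 by (metis One_nat_def Suc_leI mult_le_mono mult_1)
    obtain k where k: "2 ^ k < P * N" "P * N \<le> 2 ^ (k + 1)" using ex_power_ivl2[of 2 "P * N"] PN by auto
    define l where "l = k + 1"
    define Q :: nat where "Q = 2 ^ l"
    have l: "P * N \<le> Q" "Q \<le> 2 * P * N" using k by (auto simp: l_def Q_def)
    have NQ: "N \<le> Q" using l(1) P0 by (metis One_nat_def Suc_leI le_trans mult.commute mult_le_mono2 nat_mult_1_right)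
    have QN: "real Q \<le> 2 * real P * real N" using l(2) by (metis of_nat_le_iff of_nat_mult of_nat_numeral)
    have DQ: "M0 * (c * (2 * r * N + r\<^sup>2)) \<le> Q" if "c \<le> a * b" for c
    proof -
      have "2 * r * N + r\<^sup>2 \<le> 3 * r * N" using N by (simp add: power2_eq_square)
      then have "M0 * (c * (2 * r * N + r\<^sup>2)) \<le> M0 * ((a * b) * (3 * r * N))"
        using that by (intro mult_le_mono) auto
      also have "\<dots> = P * N" by (simp add: P_def)
      finally show ?thesis using l(1) by simp
    qed
    have bound: "24 * real N / real M0 + eta * real Q \<le> delta / 8 * real N"
    proof -
      have "24 * real N / real M0 \<le> delta / 16 * real N"
      proof -
        have "384 * real N \<le> (delta * real M0) * real N" using M0 delta M00 by (intro mult_right_mono) (auto simp: field_simps)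
        then show ?thesis using M00 by (simp add: field_simps)
      qed
      moreover have "eta * real Q \<le> eta * (2 * real P * real N)" using QN eta by (intro mult_left_mono) auto
      moreover have "eta * (2 * real P * real N) = delta / 16 * real N" using P0 by (simp add: eta_def field_simps)
      ultimately show ?thesis by linarith
    qed
    define B where "B c = {n \<in> {..<N}. (c * n\<^sup>2) mod 2 ^ l + c * (2 * r * N + r\<^sup>2) \<ge> 2 ^ l}" for c
    define X where "X = (\<Sum>n<N. g n * g (n + r))"
    define Y where "Y = (\<Sum>n<N. tm_trunc a b l (n\<^sup>2) * tm_trunc a b l ((n + r)\<^sup>2))"
    have 1: "real (card (B a)) \<le> delta / 8 * real N"
      using Q1[of Q N "a * (2 * r * N + r\<^sup>2)"] DQ[of a] N NQ a bound unfolding Q_def B_def by simp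
    have 2: "real (card (B b)) \<le> delta / 8 * real N"
      using Q2[of Q N "b * (2 * r * N + r\<^sup>2)"] DQ[of b] N NQ a bound unfolding Q_def B_def by simp
    have 3: "\<bar>Y\<bar> \<le> delta / 2 * real N"
      using elim(1) l unfolding Q_def Y_def by blast
    have "\<bar>X - Y\<bar> \<le> 2 * (real (card (B a)) + real (card (B b)))"
      unfolding X_def Y_def B_def g_def by (rule tm_truncation_error_le)
    also have "\<dots> \<le> 2 * (delta / 8 * real N + delta / 8 * real N)" using 1 2 by (intro mult_left_mono add_mono) auto
    also have "\<dots> = delta / 2 * real N" by simp
    finally have "\<bar>X\<bar> \<le> delta / 2 * real N + delta / 2 * real N" using 3 by linarith
    then show ?case unfolding X_def by simp
  qed
qed

text \<open>A second moment over R shifts: fewer than R correlations, each at most N / R, add up to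
  no more than the diagonal N. The sum is then at most 3 N / sqrt R, whence R > 9 / delta^2.\<close>

theorem tm_squares_dilates_orthogonal:
  fixes a b :: nat
  assumes ab: "odd a" "odd b" "a \<noteq> b" and delta: "delta > 0"
  shows "\<forall>\<^sub>F N in sequentially. \<bar>\<Sum>n<N. tm_sign (a * n\<^sup>2) * tm_sign (b * n\<^sup>2)\<bar> \<le> delta * real N"
proof -
  define g where "g n = tm_sign (a * n\<^sup>2) * tm_sign (b * n\<^sup>2)" for n
  obtain R :: nat where R: "real R > 9 / delta\<^sup>2" using reals_Archimedean2 by blast
  have "0 < 9 / delta\<^sup>2" using delta by simp
  then have R0: "R > 0" using R by (metis less_trans of_nat_0_less_iff)
  have "\<forall>\<^sub>F N in sequentially. \<forall>s\<in>{1..<R}. \<bar>\<Sum>n<N. g n * g (n + s)\<bar> \<le> 1 / real R * real N"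
    unfolding g_def using R0 by (intro eventually_ball_finite ballI tm_squares_correlation_small ab) auto
  then show ?thesis using eventually_ge_at_top[of "4 * R\<^sup>2"]
  proof eventually_elim
    case (elim N)
    have N4: "4 * (real R)\<^sup>2 \<le> real N" using elim(2) by (metis of_nat_le_iff of_nat_mult of_nat_numeral of_nat_power)
    define u where "u n = complex_of_real (g n)" for n
    have C: "norm (\<Sum>n<N. u (n + s) * cnj (u n)) \<le> 1 / real R * real N" if "1 \<le> s" "s < R" for s
    proof -
      have "(\<Sum>n<N. u (n + s) * cnj (u n)) = complex_of_real (\<Sum>n<N. g n * g (n + s))"
        by (simp add: u_def mult.commute)
      then have "norm (\<Sum>n<N. u (n + s) * cnj (u n)) = \<bar>\<Sum>n<N. g n * g (n + s)\<bar>" by (simp only: norm_of_real)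
      then show ?thesis using elim(1) that by auto
    qed
    have "\<bar>\<Sum>n<N. g n\<bar> = norm (\<Sum>n<N. u n)" unfolding u_def of_real_sum[symmetric] norm_of_real ..
    also have "\<dots> \<le> real R + sqrt (real N / real R * (real N + 2 * (\<Sum>s=1..<R. norm (\<Sum>n<N. u (n + s) * cnj (u n)) + 2 * real R)))"
      by (rule van_der_Corput) (auto simp: u_def g_def R0 norm_mult)
    also have "real N / real R * (real N + 2 * (\<Sum>s=1..<R. norm (\<Sum>n<N. u (n + s) * cnj (u n)) + 2 * real R))
      \<le> real N / real R * (real N + 2 * (\<Sum>s=1..<R. 1 / real R * real N + 2 * real R))"
      using C by (intro mult_left_mono add_mono sum_mono) auto
    also have "\<dots> \<le> real N / real R * (real N + 2 * (real R * (1 / real R * real N + 2 * real R)))"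
      by (intro mult_left_mono add_mono) (auto intro!: mult_right_mono)
    also have "\<dots> = real N / real R * (3 * real N + 4 * (real R)\<^sup>2)" using R0 by (simp add: field_simps power2_eq_square)
    also have "\<dots> \<le> real N / real R * (4 * real N)" using N4 by (intro mult_left_mono) auto
    also have "\<dots> = (2 * real N)\<^sup>2 / real R" by (simp add: power2_eq_square)
    also have "sqrt ((2 * real N)\<^sup>2 / real R) = 2 * real N / sqrt (real R)" by (simp only: real_sqrt_divide real_sqrt_abs abs_mult abs_numeral abs_of_nat)
    finally have 1: "\<bar>\<Sum>n<N. g n\<bar> \<le> real R + 2 * real N / sqrt (real R)" by simp
    have 2: "real R \<le> real N / sqrt (real R)"
    proof -
      have "sqrt (real R) \<le> real R" using R0 by (auto intro!: real_le_lsqrt simp: power2_eq_square)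
      then have "real R * sqrt (real R) \<le> (real R)\<^sup>2" by (simp add: power2_eq_square mult_left_mono)
      also have "\<dots> \<le> real N" using N4 by (smt (verit) zero_le_power2)
      finally show ?thesis using R0 by (simp add: field_simps)
    qed
    have "\<bar>\<Sum>n<N. g n\<bar> \<le> real N / sqrt (real R) + 2 * real N / sqrt (real R)" using 1 2 by linarith
    also have "\<dots> = (3 / sqrt (real R)) * real N" by simp
    also have "\<dots> \<le> delta * real N"
    proof (rule mult_right_mono)
      have "(3 / delta)\<^sup>2 \<le> real R" using R by (simp add: power_divide)
      then have "3 / delta \<le> sqrt (real R)" by (rule real_le_rsqrt)
      then show "3 / sqrt (real R) \<le> delta" using delta R0 by (simp add: field_simps)
    qed simp
    finally show ?case unfolding g_def by simp
  qed
qed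

section \<open>The Katai criterion\<close>

lemma moebius_mu_prime_mult:
  assumes p: "prime p" and "\<not> p dvd m"
  shows "moebius_mu (p * m) = - moebius_mu m"
proof (cases "m = 0")
  case False
  have cop: "coprime p m" using assms by (simp add: prime_imp_coprime)
  have sf: "squarefree (p * m) \<longleftrightarrow> squarefree m"
    using squarefree_mult_coprime[OF cop squarefree_prime[OF p]] squarefree_multD(2) by blast
  have "prime_factors (p * m) = insert p (prime_factors m)"
    using False p by (simp add: prime_factors_product prime_prime_factors not_prime_0) 
  moreover have "p \<notin> prime_factors m" using assms by auto
  ultimately show ?thesis by (simp add: moebius_mu_def sf)
qed (use assms in simp)

lemma moebius_mu_prime_square_mult:
  assumes "prime p" "p dvd m"
  shows "moebius_mu (p * m) = 0"
proof -
  have "p ^ 2 dvd p * m" using assms by (simp add: power2_eq_square mult_dvd_mono)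
  then have "\<not> squarefree (p * m)" using assms by (auto simp: squarefree_def)
  then show ?thesis by (simp add: moebius_mu_def)
qed

lemma abs_moebius_mu_le: "\<bar>real_of_int (moebius_mu n)\<bar> \<le> 1"
  by (simp add: moebius_mu_def)

lemma card_multiples_below:
  fixes d N :: nat
  assumes "d > 0"
  shows "real N / real d \<le> real (card {n \<in> {..<N}. d dvd n})" "real (card {n \<in> {..<N}. d dvd n}) \<le> real N / real d + 1"
proof -
  define k where "k = (N + d - 1) div d"
  have iff: "m < k \<longleftrightarrow> d * m < N" for m
    unfolding k_def by (rule less_ceiling_div_iff[OF assms])
  have "{n \<in> {..<N}. d dvd n} = (*) d ` {m. d * m < N}" by (auto elim!: dvdE)
  also have "{m. d * m < N} = {..<k}" by (simp add: iff[symmetric] lessThan_def)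
  finally have "{n \<in> {..<N}. d dvd n} = (*) d ` {..<k}" .
  then have card: "card {n \<in> {..<N}. d dvd n} = k"
    using assms by (simp add: card_image inj_on_def)
  have "N \<le> d * k" using iff[of k] by simp
  then have "real N \<le> real d * real k" by (metis of_nat_le_iff of_nat_mult)
  then show "real N / real d \<le> real (card {n \<in> {..<N}. d dvd n})"
    unfolding card using assms by (simp add: field_simps)
  show "real (card {n \<in> {..<N}. d dvd n}) \<le> real N / real d + 1"
  proof (cases k)
    case (Suc m)
    then have "d * m < N" using iff[of m] by simp
    then have "real d * real m < real N" by (metis of_nat_less_iff of_nat_mult)
    then show ?thesis unfolding card Suc using assms by (simp add: field_simps)
  next
    case 0
    then show ?thesis unfolding card by simp
  qed
qed

lemma card_multiples_below_image:
  fixes d N :: nat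
  assumes "d > 0"
  shows "real (card {m. d * m < N}) \<le> real N / real d + 1"
proof -
  have "{n \<in> {..<N}. d dvd n} = (*) d ` {m. d * m < N}" by (auto elim!: dvdE)
  then have "card {m. d * m < N} = card {n \<in> {..<N}. d dvd n}"
    using assms by (simp add: card_image inj_on_def)
  then show ?thesis using card_multiples_below(2)[OF assms, of N] by simp
qed

lemma sum_inverse_squares_le:
  fixes P :: "nat set"
  assumes "finite P" "\<And>p. p \<in> P \<Longrightarrow> p \<ge> 2"
  shows "(\<Sum>p\<in>P. 1 / (real p)\<^sup>2) \<le> 1"
proof -
  have tele: "(\<Sum>n=2..<K + 2. 1 / (real n)\<^sup>2) \<le> 1 - 1 / real (K + 1)" for K
  proof (induction K)
    case (Suc K)
    have "(\<Sum>n=2..<Suc K + 2. 1 / (real n)\<^sup>2) = (\<Sum>n=2..<K + 2. 1 / (real n)\<^sup>2) + 1 / (real (K + 2))\<^sup>2"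
      by simp
    also have "1 / (real (K + 2))\<^sup>2 \<le> 1 / (real (K + 1) * real (K + 2))"
      by (intro divide_left_mono) (auto simp: power2_eq_square)
    also have "1 / (real (K + 1) * real (K + 2)) = 1 / real (K + 1) - 1 / real (Suc K + 1)"
      by (simp add: field_simps)
    finally show ?case using Suc.IH by simp
  qed simp
  define K where "K = Max (insert 0 P)"
  have "P \<subseteq> {2..<K + 2}" using assms unfolding K_def by (auto simp: less_Suc_eq_le intro!: le_SucI)
  then have "(\<Sum>p\<in>P. 1 / (real p)\<^sup>2) \<le> (\<Sum>n=2..<K + 2. 1 / (real n)\<^sup>2)" by (intro sum_mono2) auto
  also have "\<dots> \<le> 1" by (rule order_trans[OF tele]) simp
  finally show ?thesis .
qed

definition prime_divisor_count :: "nat set \<Rightarrow> nat \<Rightarrow> real" where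
  "prime_divisor_count P n = (\<Sum>p\<in>P. of_bool (p dvd n))"

lemma sum_of_bool_eq_card: "finite A \<Longrightarrow> (\<Sum>n\<in>A. of_bool (Q n)) = real (card {n \<in> A. Q n})"
  by (simp add: of_bool_def sum.If_cases Int_def)

text \<open>For distinct primes p and q the second moment counts multiples of p q. A lower bound for
  the first moment is enough, since it enters with the factor - 2 H.\<close>

lemma Turan_Kubilius:
  fixes P :: "nat set"
  assumes fin: "finite P" and pr: "\<And>p. p \<in> P \<Longrightarrow> prime p"
  defines "H \<equiv> (\<Sum>p\<in>P. 1 / real p)"
  shows "(\<Sum>n<N. (prime_divisor_count P n - H)\<^sup>2) \<le> real N * H + real (card P) + (real (card P))\<^sup>2"
proof -
  define c where "c d = real (card {n \<in> {..<N}. d dvd n})" for d :: nat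
  have H0: "H \<ge> 0" unfolding H_def by (intro sum_nonneg) auto
  have p0: "p > 0" if "p \<in> P" for p using pr[OF that] by (rule prime_gt_0_nat)
  have S1: "(\<Sum>n<N. prime_divisor_count P n) \<ge> real N * H"
  proof -
    have "(\<Sum>n<N. prime_divisor_count P n) = (\<Sum>p\<in>P. c p)"
      unfolding prime_divisor_count_def c_def by (subst sum.swap) (simp only: sum_of_bool_eq_card finite_lessThan)
    also have "\<dots> \<ge> (\<Sum>p\<in>P. real N * (1 / real p))"
      unfolding c_def using card_multiples_below(1)[OF p0] by (intro sum_mono) auto
    finally show ?thesis by (simp add: H_def sum_distrib_left)
  qed
  have both: "(\<Sum>n<N. of_bool (p dvd n) * of_bool (q dvd n)) = real (card {n \<in> {..<N}. p dvd n \<and> q dvd n})" for p q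
    by (simp only: of_bool_conj[symmetric] sum_of_bool_eq_card finite_lessThan)
  have pair: "(\<Sum>n<N. of_bool (p dvd n) * of_bool (q dvd n)) \<le>
      (if p = q then real N * (1 / real p) else 0) + real N * (1 / real p) * (1 / real q) + 1 + (0::real)"
    if p: "p \<in> P" and q: "q \<in> P" for p q
  proof (cases "p = q")
    case True
    have "(\<Sum>n<N. of_bool (p dvd n) * of_bool (q dvd n)) = c p"
      using both[of p q] True by (simp add: c_def)
    also have "\<dots> \<le> real N / real p + 1" unfolding c_def by (rule card_multiples_below(2)[OF p0[OF p]])
    also have "\<dots> \<le> (real N / real p + 1) + real N * (1 / real p) * (1 / real q)" by simp
    finally show ?thesis using True by simp
  next
    case False
    have "coprime p q" using False pr p q primes_coprime by blast
    then have "(p dvd n \<and> q dvd n) \<longleftrightarrow> p * q dvd n" for n by (meson divides_mult dvd_mult_left dvd_mult_right)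
    then have "(\<Sum>n<N. of_bool (p dvd n) * of_bool (q dvd n)) = c (p * q)"
      using both[of p q] by (simp add: c_def)
    also have "\<dots> \<le> real N / real (p * q) + 1" unfolding c_def using p0 p q by (intro card_multiples_below(2)) auto
    finally show ?thesis using False by simp
  qed
  have "(\<Sum>n<N. (prime_divisor_count P n)\<^sup>2) = (\<Sum>p\<in>P. \<Sum>q\<in>P. \<Sum>n<N. of_bool (p dvd n) * of_bool (q dvd n))"
  proof -
    have "(\<Sum>n<N. (prime_divisor_count P n)\<^sup>2) = (\<Sum>n<N. \<Sum>p\<in>P. \<Sum>q\<in>P. of_bool (p dvd n) * of_bool (q dvd n))"
      unfolding prime_divisor_count_def power2_eq_square sum_product ..
    also have "\<dots> = (\<Sum>p\<in>P. \<Sum>n<N. \<Sum>q\<in>P. of_bool (p dvd n) * of_bool (q dvd n))" by (rule sum.swap)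
    also have "\<dots> = (\<Sum>p\<in>P. \<Sum>q\<in>P. \<Sum>n<N. of_bool (p dvd n) * of_bool (q dvd n))"
      by (rule sum.cong[OF refl], rule sum.swap)
    finally show ?thesis .
  qed
  also have "\<dots> \<le> (\<Sum>p\<in>P. \<Sum>q\<in>P. (if p = q then real N * (1 / real p) else 0) + real N * (1 / real p) * (1 / real q) + 1 + (0::real))"
    by (intro sum_mono pair)
  also have "\<dots> = real N * H + real N * H * H + (real (card P))\<^sup>2"
  proof -
    have "(\<Sum>p\<in>P. \<Sum>q\<in>P. real N * (1 / real p) * (1 / real q)) = real N * (H * H)"
      unfolding H_def sum_product by (simp only: sum_distrib_left mult.assoc)
    moreover have "(\<Sum>p\<in>P. \<Sum>q\<in>P. if p = q then real N * (1 / real p) else 0) = real N * H"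
      using fin by (simp add: H_def sum_distrib_left)
    ultimately show ?thesis by (simp only: sum.distrib) (simp add: power2_eq_square)
  qed
  finally have S2: "(\<Sum>n<N. (prime_divisor_count P n)\<^sup>2) \<le> real N * H + real N * H * H + (real (card P))\<^sup>2" .
  have "(\<Sum>n<N. (prime_divisor_count P n - H)\<^sup>2) =
      (\<Sum>n<N. (prime_divisor_count P n)\<^sup>2) - 2 * H * (\<Sum>n<N. prime_divisor_count P n) + real N * (H * H)"
    unfolding power2_diff by (simp add: sum.distrib sum_subtractf sum_distrib_left mult_ac power2_eq_square)
  also have "\<dots> \<le> (real N * H + real N * H * H + (real (card P))\<^sup>2) - 2 * H * (real N * H) + real N * (H * H)"
    using S1 S2 H0 by (intro add_mono diff_mono mult_left_mono) auto
  also have "\<dots> \<le> real N * H + real (card P) + (real (card P))\<^sup>2" by (simp add: algebra_simps)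
  finally show ?thesis .
qed

lemma sum_mult_square_le:
  fixes f g :: "'a \<Rightarrow> real"
  assumes "\<And>n. n \<in> A \<Longrightarrow> \<bar>f n\<bar> \<le> 1"
  shows "\<bar>\<Sum>n\<in>A. f n * g n\<bar> \<le> sqrt (real (card A) * (\<Sum>n\<in>A. (g n)\<^sup>2))"
proof (rule real_le_rsqrt)
  have "(\<Sum>n\<in>A. f n * g n)\<^sup>2 \<le> (\<Sum>n\<in>A. (f n)\<^sup>2) * (\<Sum>n\<in>A. (g n)\<^sup>2)" by (rule Cauchy_Schwarz_ineq_sum)
  also have "\<dots> \<le> (\<Sum>n\<in>A. 1) * (\<Sum>n\<in>A. (g n)\<^sup>2)"
    using assms by (intro mult_right_mono sum_mono sum_nonneg) (auto simp: abs_square_le_1)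
  finally show "\<bar>\<Sum>n\<in>A. f n * g n\<bar>\<^sup>2 \<le> real (card A) * (\<Sum>n\<in>A. (g n)\<^sup>2)" by simp
qed

lemma sum_multiples_reindex:
  fixes d N :: nat and f :: "nat \<Rightarrow> real"
  assumes "d > 0"
  shows "(\<Sum>n<N. f n * of_bool (d dvd n)) = (\<Sum>m\<in>{m. d * m < N}. f (d * m))"
proof -
  have "(\<Sum>n<N. f n * of_bool (d dvd n)) = (\<Sum>n\<in>{n \<in> {..<N}. d dvd n}. f n)"
    by (rule sum.mono_neutral_cong_right) auto
  also have "{n \<in> {..<N}. d dvd n} = (*) d ` {m. d * m < N}" by (auto elim!: dvdE)
  also have "(\<Sum>n\<in>(*) d ` {m. d * m < N}. f n) = (\<Sum>m\<in>{m. d * m < N}. f (d * m))"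
    using assms by (subst sum.reindex) (auto simp: inj_on_def)
  finally show ?thesis .
qed

lemma finite_mult_less: "d > 0 \<Longrightarrow> finite {m::nat. d * m < N}"
  by (rule finite_subset[of _ "{..<N}"]) (auto intro: le_less_trans[rotated])

text \<open>The three summands are the costs of three replacements in H times the sum. The weight H
  becomes the number of prime divisors of n in P, by Turan-Kubilius. Writing n = p m, \<mu>(p m)
  becomes - \<mu>(m), which is wrong only when p divides m, for at most N / p^2 + 1 values. Finally
  Cauchy-Schwarz in m removes \<mu>, leaving correlations of F along p m and q m; their diagonal
  gives N H + k.\<close>

lemma Katai_inequality:
  fixes F :: "nat \<Rightarrow> real" and P :: "nat set"
  assumes F: "\<And>n. \<bar>F n\<bar> \<le> 1" and fin: "finite P" and pr: "\<And>p. p \<in> P \<Longrightarrow> prime p"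
    and corr: "\<And>p q. p \<in> P \<Longrightarrow> q \<in> P \<Longrightarrow> p \<noteq> q \<Longrightarrow>
        \<bar>\<Sum>m\<in>{m. p * m < N \<and> q * m < N}. F (p * m) * F (q * m)\<bar> \<le> B" and B: "B \<ge> 0"
  defines "H \<equiv> (\<Sum>p\<in>P. 1 / real p)" and "k \<equiv> real (card P)"
  shows "H * \<bar>\<Sum>n<N. real_of_int (moebius_mu n) * F n\<bar> \<le>
     sqrt (real N * (real N * H + k + k\<^sup>2)) + (real N + k) + sqrt (real N * (real N * H + k + k\<^sup>2 * B))"
proof -
  define mu where "mu n = real_of_int (moebius_mu n)" for n
  define S where "S = (\<Sum>n<N. mu n * F n)"
  have mu1: "\<bar>mu n\<bar> \<le> 1" for n unfolding mu_def by (rule abs_moebius_mu_le)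
  have muF: "\<bar>mu n * F n'\<bar> \<le> 1" for n n' unfolding abs_mult using mu1 F by (intro mult_le_one) auto
  have p0: "p > 0" "p \<ge> 2" if "p \<in> P" for p using pr[OF that] prime_gt_0_nat prime_ge_2_nat by auto
  have H0: "H \<ge> 0" unfolding H_def by (intro sum_nonneg) auto
  define w where "w = prime_divisor_count P"
  have T1: "\<bar>\<Sum>n<N. (mu n * F n) * (w n - H)\<bar> \<le> sqrt (real N * (real N * H + k + k\<^sup>2))"
  proof -
    have "\<bar>\<Sum>n<N. (mu n * F n) * (w n - H)\<bar> \<le> sqrt (real (card {..<N}) * (\<Sum>n<N. (w n - H)\<^sup>2))"
      by (rule sum_mult_square_le) (rule muF)
    also have "\<dots> \<le> sqrt (real N * (real N * H + k + k\<^sup>2))"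
      unfolding card_lessThan w_def H_def k_def
      by (intro real_sqrt_le_mono mult_left_mono Turan_Kubilius fin pr) auto
    finally show ?thesis .
  qed
  define U where "U = (\<Sum>p\<in>P. \<Sum>m\<in>{m. p * m < N}. mu m * F (p * m))"
  have wsum: "(\<Sum>n<N. mu n * F n * w n) = (\<Sum>p\<in>P. \<Sum>m\<in>{m. p * m < N}. mu (p * m) * F (p * m))"
  proof -
    have "(\<Sum>n<N. mu n * F n * w n) = (\<Sum>n<N. \<Sum>p\<in>P. mu n * F n * of_bool (p dvd n))"
      unfolding w_def prime_divisor_count_def sum_distrib_left ..
    also have "\<dots> = (\<Sum>p\<in>P. \<Sum>n<N. mu n * F n * of_bool (p dvd n))" by (rule sum.swap)
    also have "\<dots> = (\<Sum>p\<in>P. \<Sum>m\<in>{m. p * m < N}. mu (p * m) * F (p * m))"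
      using p0 by (intro sum.cong refl sum_multiples_reindex) auto
    finally show ?thesis .
  qed
  have T2: "\<bar>(\<Sum>n<N. mu n * F n * w n) + U\<bar> \<le> real N + k"
  proof -
    have inner: "\<bar>\<Sum>m\<in>{m. p * m < N}. (mu (p * m) + mu m) * F (p * m)\<bar> \<le> real N * (1 / (real p)\<^sup>2) + 1" if p: "p \<in> P" for p
    proof -
      have finp: "finite {m. p * m < N}" using p0[OF p] by (intro finite_mult_less)
      have "\<bar>\<Sum>m\<in>{m. p * m < N}. (mu (p * m) + mu m) * F (p * m)\<bar> \<le> (\<Sum>m\<in>{m. p * m < N}. of_bool (p dvd m))"
      proof (rule order_trans[OF sum_abs], intro sum_mono)
        fix m
        show "\<bar>(mu (p * m) + mu m) * F (p * m)\<bar> \<le> of_bool (p dvd m)"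
        proof (cases "p dvd m")
          case True
          then show ?thesis using moebius_mu_prime_square_mult[OF pr[OF p] True] muF[of m "p * m"] by (simp add: mu_def)
        next
          case False
          then show ?thesis using moebius_mu_prime_mult[OF pr[OF p] False] by (simp add: mu_def)
        qed
      qed
      also have "\<dots> = real (card {m \<in> {m. p * m < N}. p dvd m})" by (rule sum_of_bool_eq_card[OF finp])
      also have "{m \<in> {m. p * m < N}. p dvd m} = (*) p ` {l. (p * p) * l < N}" by (auto elim!: dvdE simp: mult.assoc)
      also have "card \<dots> = card {l. (p * p) * l < N}" using p0[OF p] by (simp add: card_image inj_on_def)
      also have "real \<dots> \<le> real N / real (p * p) + 1" using p0[OF p] by (intro card_multiples_below_image) auto
      finally show ?thesis by (simp add: power2_eq_square)
    qed
    have "(\<Sum>n<N. mu n * F n * w n) + U = (\<Sum>p\<in>P. \<Sum>m\<in>{m. p * m < N}. (mu (p * m) + mu m) * F (p * m))"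
      unfolding wsum U_def by (simp add: sum.distrib distrib_right)
    also have "\<bar>\<dots>\<bar> \<le> (\<Sum>p\<in>P. real N * (1 / (real p)\<^sup>2) + 1)"
      by (rule order_trans[OF sum_abs]) (intro sum_mono inner)
    also have "\<dots> = real N * (\<Sum>p\<in>P. 1 / (real p)\<^sup>2) + k" by (simp add: sum.distrib k_def sum_distrib_left)
    also have "\<dots> \<le> real N * 1 + k" using p0 by (intro add_mono mult_left_mono sum_inverse_squares_le fin) auto
    finally show ?thesis by simp
  qed
  have T3: "\<bar>U\<bar> \<le> sqrt (real N * (real N * H + k + k\<^sup>2 * B))"
  proof -
    define V where "V m = (\<Sum>p\<in>P. of_bool (p * m < N) * F (p * m))" for m
    have sub: "{m. p * m < N} \<subseteq> {..<N}" if "p \<in> P" for p using p0[OF that] by (auto intro: le_less_trans[rotated])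
    have "U = (\<Sum>p\<in>P. \<Sum>m<N. mu m * (of_bool (p * m < N) * F (p * m)))"
      unfolding U_def using sub by (intro sum.cong refl sum.mono_neutral_cong_left) auto
    also have "\<dots> = (\<Sum>m<N. \<Sum>p\<in>P. mu m * (of_bool (p * m < N) * F (p * m)))" by (rule sum.swap)
    also have "\<dots> = (\<Sum>m<N. mu m * V m)" unfolding V_def sum_distrib_left ..
    also have "\<bar>\<dots>\<bar> \<le> sqrt (real (card {..<N}) * (\<Sum>m<N. (V m)\<^sup>2))" by (rule sum_mult_square_le) (rule mu1)
    also have "\<dots> \<le> sqrt (real N * (real N * H + k + k\<^sup>2 * B))"
    proof -
      define c where "c p q = (\<Sum>m<N. (of_bool (p * m < N) * F (p * m)) * (of_bool (q * m < N) * F (q * m)))" for p q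
      have c: "c p q = (\<Sum>m\<in>{m. p * m < N \<and> q * m < N}. F (p * m) * F (q * m))" if "p \<in> P" for p q
        unfolding c_def using sub[OF that] by (intro sum.mono_neutral_cong_right) auto
      have "c p q \<le> (if p = q then real N * (1 / real p) + 1 else 0) + B" if p: "p \<in> P" and q: "q \<in> P" for p q
      proof (cases "p = q")
        case True
        have "c p q = (\<Sum>m\<in>{m. p * m < N}. F (p * m) * F (p * m))" using c[OF p, of q] True by simp
        also have "\<dots> \<le> (\<Sum>m\<in>{m. p * m < N}. 1)" using F by (intro sum_mono) (metis abs_square_le_1 power2_eq_square)
        also have "\<dots> \<le> real N / real p + 1" using card_multiples_below_image[of p N] p0[OF p] by simp
        finally show ?thesis using True B by simp
      next
        case False
        then show ?thesis using corr[OF p q False] c[OF p, of q] by simp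
      qed
      then have "(\<Sum>p\<in>P. \<Sum>q\<in>P. c p q) \<le> (\<Sum>p\<in>P. \<Sum>q\<in>P. (if p = q then real N * (1 / real p) + 1 else 0) + B)"
        by (intro sum_mono) auto
      also have "\<dots> = real N * H + k + k\<^sup>2 * B"
        using fin by (simp add: sum.distrib H_def k_def sum_distrib_left power2_eq_square)
      finally have cc: "(\<Sum>p\<in>P. \<Sum>q\<in>P. c p q) \<le> real N * H + k + k\<^sup>2 * B" .
      have "(\<Sum>m<N. (V m)\<^sup>2) = (\<Sum>m<N. \<Sum>p\<in>P. \<Sum>q\<in>P. (of_bool (p * m < N) * F (p * m)) * (of_bool (q * m < N) * F (q * m)))"
        unfolding V_def power2_eq_square sum_product ..
      also have "\<dots> = (\<Sum>p\<in>P. \<Sum>m<N. \<Sum>q\<in>P. (of_bool (p * m < N) * F (p * m)) * (of_bool (q * m < N) * F (q * m)))"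
        by (rule sum.swap)
      also have "\<dots> = (\<Sum>p\<in>P. \<Sum>q\<in>P. c p q)" unfolding c_def by (rule sum.cong[OF refl], rule sum.swap)
      finally show ?thesis using cc by (intro real_sqrt_le_mono) (simp add: mult_left_mono)
    qed
    finally show ?thesis .
  qed
  have "H * S = ((\<Sum>n<N. mu n * F n * w n) + U) - U - (\<Sum>n<N. (mu n * F n) * (w n - H))"
    unfolding S_def by (simp add: algebra_simps sum_subtractf sum_distrib_left)
  then have "\<bar>H * S\<bar> \<le> sqrt (real N * (real N * H + k + k\<^sup>2)) + (real N + k) + sqrt (real N * (real N * H + k + k\<^sup>2 * B))"
    using T1 T2 T3 by linarith
  then show ?thesis using H0 unfolding S_def mu_def by (simp add: abs_mult)
qed

text \<open>With d the larger of p and q both conditions together say d m < N, so the sum is an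
  initial segment of length at most N.\<close>

lemma eventually_sum_mult_less:
  fixes G :: "nat \<Rightarrow> real" and p q :: nat
  assumes pq: "p > 0" "q > 0" and eta: "eta > 0"
    and lim: "\<And>e. e > 0 \<Longrightarrow> \<forall>\<^sub>F N in sequentially. \<bar>\<Sum>m<N. G m\<bar> \<le> e * real N"
  shows "\<forall>\<^sub>F N in sequentially. \<bar>\<Sum>m\<in>{m. p * m < N \<and> q * m < N}. G m\<bar> \<le> eta * real N"
proof -
  obtain N0 where N0: "\<And>N. N \<ge> N0 \<Longrightarrow> \<bar>\<Sum>m<N. G m\<bar> \<le> eta * real N"
    using lim[OF eta] unfolding eventually_sequentially by blast
  define d where "d = max p q"
  have d: "d > 0" using pq by (simp add: d_def)
  show ?thesis
  proof (rule eventually_sequentiallyI[of "d * N0"])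
    fix N assume N: "d * N0 \<le> N"
    define K where "K = (N + d - 1) div d"
    have iff: "m < K \<longleftrightarrow> d * m < N" for m
      unfolding K_def by (rule less_ceiling_div_iff[OF d])
    have "(p * m < N \<and> q * m < N) \<longleftrightarrow> m < K" for m
    proof -
      have "p * m \<le> d * m" "q * m \<le> d * m" unfolding d_def by (intro mult_le_mono; simp)+
      moreover have "d * m = p * m \<or> d * m = q * m" by (simp add: d_def max_def)
      ultimately show ?thesis unfolding iff by linarith
    qed
    then have eq: "{m. p * m < N \<and> q * m < N} = {..<K}" by auto
    have "N0 \<le> K"
    proof (rule ccontr)
      assume "\<not> N0 \<le> K"
      then have "Suc K \<le> N0" by simp
      then have "d * Suc K \<le> N" using N by (meson le_trans mult_le_mono2)
      then have "d * K < N" using d by simp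
      then show False using iff[of K] by simp
    qed
    then have "\<bar>\<Sum>m<K. G m\<bar> \<le> eta * real K" by (rule N0)
    also have "K \<le> N"
    proof (rule ccontr)
      assume "\<not> K \<le> N"
      then have "d * N < N" using iff[of N] by simp
      then show False using d by simp
    qed
    then have "eta * real K \<le> eta * real N" using eta by (intro mult_left_mono) auto
    finally show "\<bar>\<Sum>m\<in>{m. p * m < N \<and> q * m < N}. G m\<bar> \<le> eta * real N" unfolding eq .
  qed
qed

text \<open>P is fixed, with H large, before N grows. Then k + k^2 is absorbed by N, each
  correlation is at most N / k^2 so that all k^2 of them cost one more N, and division by H leaves 4
  N sqrt (H + 2) / H.\<close>

theorem Katai_criterion:
  fixes F :: "nat \<Rightarrow> real" and A :: "nat set"
  assumes F: "\<And>n. \<bar>F n\<bar> \<le> 1" and pr: "\<And>p. p \<in> A \<Longrightarrow> prime p"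
    and div: "\<And>C. \<exists>P\<subseteq>A. finite P \<and> C \<le> (\<Sum>p\<in>P. 1 / real p)"
    and corr: "\<And>p q e. p \<in> A \<Longrightarrow> q \<in> A \<Longrightarrow> p \<noteq> q \<Longrightarrow> e > 0 \<Longrightarrow>
       \<forall>\<^sub>F N in sequentially. \<bar>\<Sum>m<N. F (p * m) * F (q * m)\<bar> \<le> e * real N"
    and delta: "delta > 0"
  shows "\<forall>\<^sub>F N in sequentially. \<bar>\<Sum>n<N. real_of_int (moebius_mu n) * F n\<bar> \<le> delta * real N"
proof -
  have "((\<lambda>H. 4 * sqrt (H + 2) / H) \<longlongrightarrow> 0) (at_top :: real filter)" by real_asymp
  then have "\<forall>\<^sub>F H :: real in at_top. 4 * sqrt (H + 2) / H < delta" using delta by (rule order_tendstoD(2))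
  then obtain H0 where H0: "\<And>H :: real. H \<ge> H0 \<Longrightarrow> 4 * sqrt (H + 2) / H < delta"
    unfolding eventually_at_top_linorder by blast
  obtain P where P: "P \<subseteq> A" "finite P" and PH: "max H0 1 \<le> (\<Sum>p\<in>P. 1 / real p)" using div by blast
  define H where "H = (\<Sum>p\<in>P. 1 / real p)"
  define k where "k = real (card P)"
  have H: "H \<ge> 1" "4 * sqrt (H + 2) / H < delta" using PH H0[of H] by (auto simp: H_def)
  have k0: "k > 0"
  proof -
    have "P \<noteq> {}" using H(1) unfolding H_def by auto
    then show ?thesis using P by (simp add: k_def card_gt_0_iff)
  qed
  have "\<forall>\<^sub>F N in sequentially. \<forall>p\<in>P. \<forall>q\<in>P. p \<noteq> q \<longrightarrow>
      \<bar>\<Sum>m\<in>{m. p * m < N \<and> q * m < N}. F (p * m) * F (q * m)\<bar> \<le> 1 / k\<^sup>2 * real N"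
  proof (intro eventually_ball_finite ballI P)
    fix p q assume pq: "p \<in> P" "q \<in> P"
    show "\<forall>\<^sub>F N in sequentially. p \<noteq> q \<longrightarrow>
      \<bar>\<Sum>m\<in>{m. p * m < N \<and> q * m < N}. F (p * m) * F (q * m)\<bar> \<le> 1 / k\<^sup>2 * real N"
    proof (cases "p = q")
      case False
      have "\<forall>\<^sub>F N in sequentially. \<bar>\<Sum>m\<in>{m. p * m < N \<and> q * m < N}. F (p * m) * F (q * m)\<bar> \<le> 1 / k\<^sup>2 * real N"
      proof (intro eventually_sum_mult_less corr)
        show "p > 0" "q > 0" using pq P pr prime_gt_0_nat by blast+
      qed (use pq P False k0 in auto)
      then show ?thesis by (rule eventually_mono) simp
    qed simp
  qed
  moreover have "\<forall>\<^sub>F N in sequentially. real N \<ge> k + k\<^sup>2"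
    using filterlim_real_sequentially unfolding filterlim_at_top by blast
  ultimately show ?thesis
  proof eventually_elim
    case (elim N)
    define S where "S = \<bar>\<Sum>n<N. real_of_int (moebius_mu n) * F n\<bar>"
    have "H * S \<le> sqrt (real N * (real N * H + k + k\<^sup>2)) + (real N + k) + sqrt (real N * (real N * H + k + k\<^sup>2 * (1 / k\<^sup>2 * real N)))"
      unfolding S_def H_def k_def
    proof (rule Katai_inequality[OF F P(2)])
      show "prime p" if "p \<in> P" for p using that P pr by blast
    qed (use elim(1) in \<open>auto simp: k_def\<close>)
    also have "\<dots> \<le> real N * sqrt (H + 2) + (real N * sqrt (H + 2) + real N * sqrt (H + 2)) + real N * sqrt (H + 2)"
    proof -
      have k1: "k \<le> real N" using elim(2) by (smt (verit) zero_le_power2)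
      have NN: "sqrt ((real N)\<^sup>2 * (H + 2)) = real N * sqrt (H + 2)" by (simp add: real_sqrt_mult)
      have "real N * (real N * H + k + k\<^sup>2) \<le> real N * (real N * H + 2 * real N)"
        using elim(2) by (intro mult_left_mono) auto
      also have "\<dots> = (real N)\<^sup>2 * (H + 2)" by (simp add: algebra_simps power2_eq_square)
      finally have 1: "sqrt (real N * (real N * H + k + k\<^sup>2)) \<le> real N * sqrt (H + 2)"
        unfolding NN[symmetric] by (rule real_sqrt_le_mono)
      have "real N * (real N * H + k + k\<^sup>2 * (1 / k\<^sup>2 * real N)) \<le> real N * (real N * H + 2 * real N)"
        using k1 k0 by (intro mult_left_mono) auto
      also have "\<dots> = (real N)\<^sup>2 * (H + 2)" by (simp add: algebra_simps power2_eq_square)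
      finally have 2: "sqrt (real N * (real N * H + k + k\<^sup>2 * (1 / k\<^sup>2 * real N))) \<le> real N * sqrt (H + 2)"
        unfolding NN[symmetric] by (rule real_sqrt_le_mono)
      have "real N * 1 \<le> real N * sqrt (H + 2)" using H by (intro mult_left_mono) auto
      then show ?thesis using 1 2 k1 by linarith
    qed
    also have "\<dots> = H * ((4 * sqrt (H + 2) / H) * real N)" using H by (simp add: field_simps)
    also have "\<dots> \<le> H * (delta * real N)" using H by (intro mult_left_mono mult_right_mono) auto
    finally show ?case using H unfolding S_def by simp
  qed
qed

section \<open>The zeta function on the line of real part one\<close>

text \<open>Built from the real logarithm so that it is entire in the exponent and no branch of the
  complex logarithm appears.\<close>

definition rpow :: "real \<Rightarrow> complex \<Rightarrow> complex" where
  "rpow x w = exp (w * of_real (ln x))"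

lemma rpow_1 [simp]: "rpow 1 w = 1"
  by (simp add: rpow_def)

lemma norm_rpow: "x > 0 \<Longrightarrow> norm (rpow x w) = x powr (Re w)"
  by (simp add: rpow_def powr_def)

lemma rpow_mult: "x > 0 \<Longrightarrow> y > 0 \<Longrightarrow> rpow (x * y) w = rpow x w * rpow y w"
  by (simp add: rpow_def ln_mult distrib_left exp_add)

lemma rpow_add: "rpow x (v + w) = rpow x v * rpow x w"
  by (simp add: rpow_def distrib_right exp_add)

lemma rpow_0 [simp]: "rpow x 0 = 1"
  by (simp add: rpow_def)

lemma rpow_of_real: "x > 0 \<Longrightarrow> rpow x (of_real w) = of_real (x powr w)"
  by (simp add: rpow_def powr_def exp_of_real flip: of_real_mult)

lemma rpow_holomorphic [holomorphic_intros]: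
  "f holomorphic_on S \<Longrightarrow> (\<lambda>s. rpow x (f s)) holomorphic_on S"
  unfolding rpow_def by (intro holomorphic_intros)

lemma rpow_has_vector_derivative:
  assumes "x > 0"
  shows "((\<lambda>x. rpow x w) has_vector_derivative w * rpow x (w - 1)) (at x within S)"
proof -
  have ln: "((\<lambda>x. of_real (ln x) :: complex) has_vector_derivative of_real (1 / x)) (at x within S)"
    using assms by (auto intro!: derivative_eq_intros has_vector_derivative_of_real simp: has_real_derivative_iff_has_vector_derivative[symmetric])
  have ex: "((\<lambda>z. exp (w * z)) has_field_derivative w * exp (w * of_real (ln x))) (at (of_real (ln x)) within (\<lambda>x. of_real (ln x)) ` S)"
    by (auto intro!: derivative_eq_intros)
  have "((\<lambda>x. rpow x w) has_vector_derivative of_real (1 / x) * (w * exp (w * of_real (ln x)))) (at x within S)"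
    using field_vector_diff_chain_within[OF ln ex] by (simp add: rpow_def o_def)
  also have "of_real (1 / x) * (w * exp (w * of_real (ln x))) = w * rpow x (w - 1)"
  proof -
    have "exp (complex_of_real (ln x)) = of_real x" using assms by (simp add: exp_of_real)
    then show ?thesis using assms by (simp add: rpow_def left_diff_distrib exp_diff)
  qed
  finally show ?thesis .
qed

text \<open>The constant 3 comes from the linearisation bound: two derivative bounds for the
  remainder and one for the linear part.\<close>

lemma norm_rpow_diff_le:
  assumes n: "n \<ge> 1" and s: "Re s \<ge> 0" and x: "n \<le> x" "x \<le> n + 1"
  shows "norm (rpow x (-s) - rpow n (-s)) \<le> 3 * norm s * n powr (- Re s - 1)"
proof -
  define f' where "f' x = - s * rpow x (- s - 1)" for x
  have bd: "norm (f' x) \<le> norm s * n powr (- Re s - 1)" if "x \<in> {n..n + 1}" for x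
  proof -
    have "x powr (- Re s - 1) \<le> n powr (- Re s - 1)" using that n s by (intro powr_mono2') auto
    then show ?thesis using that n unfolding f'_def by (simp add: norm_mult norm_rpow mult_left_mono)
  qed
  have "norm (rpow x (-s) - rpow n (-s) - (x - n) *\<^sub>R f' n) \<le> norm (x - n) * (2 * (norm s * n powr (- Re s - 1)))"
  proof (rule vector_differentiable_bound_linearization[where S = "{n..n + 1}" and f' = f'])
    fix y assume y: "y \<in> {n..n + 1}"
    show "((\<lambda>x. rpow x (- s)) has_vector_derivative f' y) (at y within {n..n + 1})"
      unfolding f'_def using y n by (intro rpow_has_vector_derivative) auto
    have "norm (f' y - f' n) \<le> norm (f' y) + norm (f' n)" by (rule norm_triangle_ineq4)
    then show "norm (f' y - f' n) \<le> 2 * (norm s * n powr (- Re s - 1))" using bd[OF y] bd[of n] by simp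
  qed (use x in \<open>auto simp: closed_segment_eq_real_ivl\<close>)
  also have "\<dots> \<le> 1 * (2 * (norm s * n powr (- Re s - 1)))" using x by (intro mult_right_mono) auto
  finally have 1: "norm (rpow x (-s) - rpow n (-s) - (x - n) *\<^sub>R f' n) \<le> 2 * (norm s * n powr (- Re s - 1))" by simp
  have "norm ((x - n) *\<^sub>R f' n) \<le> 1 * (norm s * n powr (- Re s - 1))"
    unfolding norm_scaleR using x bd[of n] by (intro mult_mono) auto
  then show ?thesis using 1 norm_triangle_ineq[of "rpow x (-s) - rpow n (-s) - (x - n) *\<^sub>R f' n" "(x - n) *\<^sub>R f' n"] by simp
qed

text \<open>\<open>zterm n s\<close> is \<open>s - 1\<close> times the integral of \<open>(n + 1) powr (- s) - x powr (- s)\<close> over \<open>n + 1 \<le> x \<le> n + 2\<close>; hence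
  \<open>Hzeta\<close> below continues \<open>(s - 1) \<zeta>(s)\<close> to the half-plane \<open>Re s > 0\<close>.\<close>

definition zterm :: "nat \<Rightarrow> complex \<Rightarrow> complex" where
  "zterm n s = rpow (real (n + 2)) (1 - s) - rpow (real (n + 1)) (1 - s) + (s - 1) * rpow (real (n + 1)) (- s)"

text \<open>\<open>zterm n s\<close> is the first-order Taylor remainder of x \<mapsto>
  \<open>rpow x (1 - s)\<close> between n + 1 and n + 2, so it is controlled by the variation of the
  derivative. This gains the extra power of n that gives convergence down to Re s > 0.\<close>

lemma norm_zterm_le:
  assumes s: "Re s \<ge> 0"
  shows "norm (zterm n s) \<le> 3 * norm (s - 1) * norm s * real (n + 1) powr (- Re s - 1)"
proof -
  define m where "m = real (n + 1)"
  define f' where "f' x = (1 - s) * rpow x (1 - s - 1)" for x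
  have "norm (rpow (m + 1) (1 - s) - rpow m (1 - s) - (m + 1 - m) *\<^sub>R f' m) \<le>
      norm (m + 1 - m) * (norm (s - 1) * (3 * norm s * m powr (- Re s - 1)))"
  proof (rule vector_differentiable_bound_linearization[where S = "{m..m + 1}" and f' = f'])
    fix y assume y: "y \<in> {m..m + 1}"
    show "((\<lambda>x. rpow x (1 - s)) has_vector_derivative f' y) (at y within {m..m + 1})"
      unfolding f'_def using y by (intro rpow_has_vector_derivative) (auto simp: m_def)
    have "f' y - f' m = (1 - s) * (rpow y (-s) - rpow m (-s))" by (simp add: f'_def algebra_simps)
    moreover have "norm (rpow y (-s) - rpow m (-s)) \<le> 3 * norm s * m powr (- Re s - 1)"
      using y s by (intro norm_rpow_diff_le) (auto simp: m_def)
    ultimately show "norm (f' y - f' m) \<le> norm (s - 1) * (3 * norm s * m powr (- Re s - 1))"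
      by (simp add: norm_mult norm_minus_commute mult_left_mono)
  qed (auto simp: closed_segment_eq_real_ivl)
  then show ?thesis by (simp add: zterm_def f'_def m_def algebra_simps)
qed

definition Hzeta :: "complex \<Rightarrow> complex" where
  "Hzeta s = 1 + (\<Sum>n. zterm n s)"

lemma summable_Suc_powr: "a < -1 \<Longrightarrow> summable (\<lambda>n. real (n + 1) powr a)"
  using summable_real_powr_iff[of a] summable_Suc_iff[of "\<lambda>n. real n powr a"] by simp

lemma Hzeta_holomorphic: "Hzeta holomorphic_on {s. Re s > 0}"
proof -
  have "(\<lambda>s. \<Sum>i. zterm i s) holomorphic_on {s. 0 < Re s}"
  proof (rule holomorphic_uniform_sequence[where f = "\<lambda>n s. \<Sum>i<n. zterm i s"])
    show "open {s. 0 < Re s}" by (rule open_halfspace_Re_gt)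
    show "(\<lambda>s. \<Sum>i<n. zterm i s) holomorphic_on {s. 0 < Re s}" for n
      unfolding zterm_def by (intro holomorphic_intros)
    fix x assume x: "x \<in> {s. 0 < Re s}"
    define d where "d = Re x / 2"
    have d: "d > 0" using x by (simp add: d_def)
    have ge: "Re s \<ge> d" if "s \<in> cball x d" for s
    proof -
      have "Re (x - s) \<le> norm (x - s)" by (rule complex_Re_le_cmod)
      then show ?thesis using that by (simp add: dist_norm d_def)
    qed
    have le: "norm s \<le> norm x + d" "norm (s - 1) \<le> norm x + d + 1" if "s \<in> cball x d" for s
    proof -
      have "norm s \<le> norm x + norm (s - x)" by (rule norm_triangle_sub)
      then show 1: "norm s \<le> norm x + d" using that by (simp add: dist_norm norm_minus_commute)
      show "norm (s - 1) \<le> norm x + d + 1" using norm_triangle_ineq4[of s 1] 1 by simp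
    qed
    have "uniform_limit (cball x d) (\<lambda>n s. \<Sum>i<n. zterm i s) (\<lambda>s. \<Sum>i. zterm i s) sequentially"
    proof (rule Weierstrass_m_test)
      show "summable (\<lambda>n. 3 * (norm x + d + 1) * (norm x + d) * real (n + 1) powr (- d - 1))"
        using d by (intro summable_mult summable_Suc_powr) auto
      fix n s assume s: "s \<in> cball x d"
      have "norm (zterm n s) \<le> 3 * norm (s - 1) * norm s * real (n + 1) powr (- Re s - 1)"
        using ge[OF s] d by (intro norm_zterm_le) auto
      also have "\<dots> \<le> 3 * (norm x + d + 1) * (norm x + d) * real (n + 1) powr (- d - 1)"
        using ge[OF s] le[OF s] d by (intro mult_mono powr_mono) auto
      finally show "norm (zterm n s) \<le> 3 * (norm x + d + 1) * (norm x + d) * real (n + 1) powr (- d - 1)" .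
    qed
    moreover have "cball x d \<subseteq> {s. 0 < Re s}" using ge d by force
    ultimately show "\<exists>d>0. cball x d \<subseteq> {s. 0 < Re s} \<and>
        uniform_limit (cball x d) (\<lambda>n s. \<Sum>i<n. zterm i s) (\<lambda>s. \<Sum>i. zterm i s) sequentially"
      using d by blast
  qed
  then show ?thesis unfolding Hzeta_def[abs_def] by (intro holomorphic_intros)
qed

lemma isCont_Hzeta: "Re w > 0 \<Longrightarrow> isCont Hzeta w"
  using holomorphic_on_imp_continuous_on[OF Hzeta_holomorphic] open_halfspace_Re_gt[of 0]
  by (simp add: continuous_on_eq_continuous_at)

lemma Hzeta_1 [simp]: "Hzeta 1 = 1"
  by (simp add: Hzeta_def zterm_def)

definition zeta_sum :: "complex \<Rightarrow> complex" where
  "zeta_sum s = (\<Sum>n. rpow (real (n + 1)) (- s))"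

lemma summable_norm_rpow: "Re s > 1 \<Longrightarrow> summable (\<lambda>n. norm (rpow (real (n + 1)) (- s)))"
  using summable_Suc_powr[of "- Re s"] by (simp add: norm_rpow)

text \<open>The telescoping part of the series sums to - 1, which the leading 1 of
  \<open>Hzeta\<close> cancels.\<close>

lemma Hzeta_eq:
  assumes s: "Re s > 1"
  shows "Hzeta s = (s - 1) * zeta_sum s"
proof -
  have "(\<lambda>n. real (n + 1) powr (1 - Re s)) \<longlonglongrightarrow> 0"
    using s by real_asymp
  then have "(\<lambda>n. norm (rpow (real (n + 1)) (1 - s))) \<longlonglongrightarrow> 0" by (simp add: norm_rpow)
  then have "(\<lambda>n. rpow (real (n + 1)) (1 - s)) \<longlonglongrightarrow> 0" by (rule tendsto_norm_zero_cancel)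
  then have "(\<lambda>n. rpow (real (Suc n + 1)) (1 - s) - rpow (real (n + 1)) (1 - s)) sums (0 - rpow (real (0 + 1)) (1 - s))"
    by (rule telescope_sums)
  moreover have "(\<lambda>n. rpow (real (n + 1)) (- s)) sums zeta_sum s"
    unfolding zeta_sum_def using summable_norm_cancel[OF summable_norm_rpow[OF s]] by (rule summable_sums)
  ultimately have "(\<lambda>n. zterm n s) sums (- 1 + (s - 1) * zeta_sum s)"
    unfolding zterm_def by (intro sums_add sums_mult) simp_all
  then show ?thesis unfolding Hzeta_def by (simp add: sums_iff)
qed

section \<open>Sieved Dirichlet series\<close>

definition coprime_to :: "nat set \<Rightarrow> nat set" where
  "coprime_to A = {n. n \<ge> 1 \<and> (\<forall>p\<in>A. \<not> p dvd n)}"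

text \<open>One step of the sieve: the n divisible by p are the p m with m free of primes from A,
  because p is not in A.\<close>

lemma infsum_coprime_to_insert:
  fixes f :: "nat \<Rightarrow> complex"
  assumes f: "(\<lambda>n. norm (f n)) summable_on {1..}" and p: "prime p" "p \<notin> A" and A: "\<And>q. q \<in> A \<Longrightarrow> prime q"
  shows "infsum f (coprime_to A) = infsum f (coprime_to (insert p A)) + infsum (\<lambda>m. f (p * m)) (coprime_to A)"
proof -
  have summ: "f summable_on B" if "B \<subseteq> {1..}" for B
    using summable_on_subset_banach[OF Infinite_Sum.abs_summable_summable[OF f] that] .
  have p0: "p > 0" using p(1) by (rule prime_gt_0_nat)
  have "coprime_to A = coprime_to (insert p A) \<union> (*) p ` coprime_to A"
  proof (intro equalityI subsetI)
    fix n assume n: "n \<in> coprime_to A"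
    show "n \<in> coprime_to (insert p A) \<union> (*) p ` coprime_to A"
    proof (cases "p dvd n")
      case True
      then obtain m where m: "n = p * m" by (auto elim: dvdE)
      then have "m \<in> coprime_to A" using n by (auto simp: coprime_to_def)
      then show ?thesis using m by blast
    qed (use n in \<open>auto simp: coprime_to_def\<close>)
  next
    fix n assume "n \<in> coprime_to (insert p A) \<union> (*) p ` coprime_to A"
    then show "n \<in> coprime_to A"
    proof
      assume "n \<in> (*) p ` coprime_to A"
      then obtain m where m: "n = p * m" "m \<in> coprime_to A" by auto
      have "\<not> q dvd p * m" if "q \<in> A" for q
        using that m p A prime_dvd_mult_iff[of q p m] primes_dvd_imp_eq[of q p] by (auto simp: coprime_to_def)
      then show ?thesis using m p0 by (auto simp: coprime_to_def)
    qed (auto simp: coprime_to_def)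
  qed
  then have "infsum f (coprime_to A) = infsum f (coprime_to (insert p A) \<union> (*) p ` coprime_to A)" by simp
  also have "\<dots> = infsum f (coprime_to (insert p A)) + infsum f ((*) p ` coprime_to A)"
    using p0 by (intro infsum_Un_disjoint summ) (auto simp: coprime_to_def)
  also have "infsum f ((*) p ` coprime_to A) = infsum (\<lambda>m. f (p * m)) (coprime_to A)"
    using p0 by (subst infsum_reindex) (auto simp: inj_on_def o_def)
  finally show ?thesis .
qed

definition npow :: "complex \<Rightarrow> nat \<Rightarrow> complex" where
  "npow s n = rpow (real n) (- s)"

lemma npow_mult: "m > 0 \<Longrightarrow> n > 0 \<Longrightarrow> npow s (m * n) = npow s m * npow s n"
  by (simp add: npow_def rpow_mult)

lemma norm_npow: "n > 0 \<Longrightarrow> norm (npow s n) = real n powr (- Re s)"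
  by (simp add: npow_def norm_rpow)

lemma abs_summable_on_Suc:
  fixes f :: "nat \<Rightarrow> 'a::banach"
  assumes "summable (\<lambda>n. norm (f (n + 1)))"
  shows "(\<lambda>n. norm (f n)) summable_on {1..}" "infsum f {1..} = (\<Sum>n. f (n + 1))"
proof -
  have 1: "(\<lambda>n. norm (f (n + 1))) summable_on UNIV"
    by (rule norm_summable_imp_summable_on) (use assms in simp)
  have 2: "((\<lambda>n. f (n + 1)) has_sum (\<Sum>n. f (n + 1))) UNIV"
    by (rule norm_summable_imp_has_sum[OF assms summable_sums[OF summable_norm_cancel[OF assms]]])
  have bij: "bij_betw (\<lambda>n::nat. n + 1) UNIV {1..}"
    by (rule bij_betwI[where g = "\<lambda>n. n - 1"]) auto
  show "(\<lambda>n. norm (f n)) summable_on {1..}"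
    using summable_on_reindex_bij_betw[OF bij, of "\<lambda>n. norm (f n)"] 1 by blast
  have "infsum f {1..} = infsum (\<lambda>n. f (n + 1)) UNIV"
    by (rule infsum_reindex_bij_betw[OF bij, symmetric])
  also have "\<dots> = (\<Sum>n. f (n + 1))" by (rule infsumI[OF 2])
  finally show "infsum f {1..} = (\<Sum>n. f (n + 1))" .
qed

lemma abs_summable_npow:
  assumes "Re s > 1"
  shows "(\<lambda>n. norm (npow s n)) summable_on {1..}"
  by (rule abs_summable_on_Suc(1)) (unfold npow_def, rule summable_norm_rpow[OF assms])

lemma abs_summable_moebius_npow:
  assumes "Re s > 1"
  shows "(\<lambda>n. norm (of_int (moebius_mu n) * npow s n :: complex)) summable_on {1..}"
proof (rule Infinite_Sum.abs_summable_on_comparison_test[OF abs_summable_npow[OF assms]])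
  fix n
  have "norm (of_int (moebius_mu n) :: complex) \<le> 1" using abs_moebius_mu_le[of n] by simp
  then show "norm (of_int (moebius_mu n) * npow s n) \<le> norm (npow s n)"
    unfolding norm_mult by (rule mult_left_le_one_le[rotated 2]) simp_all
qed

lemma infsum_npow_eq:
  assumes "Re s > 1"
  shows "infsum (npow s) {1..} = zeta_sum s"
proof -
  have "infsum (npow s) {1..} = (\<Sum>n. npow s (n + 1))"
    by (rule abs_summable_on_Suc(2)) (unfold npow_def, rule summable_norm_rpow[OF assms])
  then show ?thesis by (simp only: npow_def zeta_sum_def)
qed

text \<open>The Euler product in finite form. As A exhausts the primes the left side tends to 1,
  which stands in for the convergence of an infinite product.\<close>

lemma infsum_npow_coprime_to:
  assumes s: "Re s > 1" and A: "finite A" "\<And>q. q \<in> A \<Longrightarrow> prime q"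
  shows "infsum (npow s) (coprime_to A) = zeta_sum s * (\<Prod>p\<in>A. 1 - npow s p)"
  using A
proof (induction A)
  case empty
  have "coprime_to {} = {1..}" by (auto simp: coprime_to_def)
  then show ?case using infsum_npow_eq[OF s] by simp
next
  case (insert p A)
  have "infsum (npow s) (coprime_to A) = infsum (npow s) (coprime_to (insert p A)) + infsum (\<lambda>m. npow s (p * m)) (coprime_to A)"
    using insert by (intro infsum_coprime_to_insert abs_summable_npow s) auto
  also have "infsum (\<lambda>m. npow s (p * m)) (coprime_to A) = infsum (\<lambda>m. npow s p * npow s m) (coprime_to A)"
    using insert by (intro infsum_cong npow_mult) (auto simp: coprime_to_def prime_gt_0_nat)
  also have "\<dots> = npow s p * infsum (npow s) (coprime_to A)" by (rule infsum_cmult_right')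
  finally have "infsum (npow s) (coprime_to (insert p A)) = infsum (npow s) (coprime_to A) - npow s p * infsum (npow s) (coprime_to A)"
    by (metis add_diff_cancel_right')
  also have "\<dots> = (1 - npow s p) * infsum (npow s) (coprime_to A)" by (simp only: left_diff_distrib mult_1)
  finally show ?case using insert by (simp add: mult_ac)
qed

text \<open>Sieving out p multiplies the first series by 1 - p^(-s) and divides the Moebius series
  by the same factor, since \<mu>(p m) is - \<mu>(m) or 0. So the product of the two is invariant
  under sieving.\<close>

lemma zeta_moebius_coprime_to:
  fixes s :: complex
  defines "g \<equiv> (\<lambda>n. of_int (moebius_mu n) * npow s n)"
  assumes s: "Re s > 1" and A: "finite A" "\<And>q. q \<in> A \<Longrightarrow> prime q"
  shows "infsum (npow s) (coprime_to A) * infsum g (coprime_to A) = zeta_sum s * infsum g {1..}"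
proof -
  have "(\<Prod>p\<in>A. 1 - npow s p) * infsum g (coprime_to A) = infsum g {1..}" using A
  proof (induction A)
    case empty
    have "coprime_to {} = {1..}" by (auto simp: coprime_to_def)
    then show ?case by simp
  next
    case (insert p A)
    have p: "prime p" using insert by simp
    have "infsum g (coprime_to A) = infsum g (coprime_to (insert p A)) + infsum (\<lambda>m. g (p * m)) (coprime_to A)"
      unfolding g_def using insert by (intro infsum_coprime_to_insert abs_summable_moebius_npow s) auto
    also have "infsum (\<lambda>m. g (p * m)) (coprime_to A) = infsum (\<lambda>m. - npow s p * g m) (coprime_to (insert p A))"
    proof (rule infsum_cong_neutral)
      fix m assume "m \<in> coprime_to (insert p A) - coprime_to A"
      then show "- npow s p * g m = 0" by (auto simp: coprime_to_def)
    next
      fix m assume "m \<in> coprime_to A - coprime_to (insert p A)"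
      then have "p dvd m" by (auto simp: coprime_to_def)
      then show "g (p * m) = 0" using moebius_mu_prime_square_mult[OF p] by (simp add: g_def)
    next
      fix m assume "m \<in> coprime_to A \<inter> coprime_to (insert p A)"
      then have "\<not> p dvd m" "m > 0" by (auto simp: coprime_to_def)
      then show "g (p * m) = - npow s p * g m"
        using moebius_mu_prime_mult[OF p] npow_mult[of p m s] prime_gt_0_nat[OF p] by (simp add: g_def)
    qed
    also have "\<dots> = - npow s p * infsum g (coprime_to (insert p A))" by (rule infsum_cmult_right')
    finally have "infsum g (coprime_to A) = (1 - npow s p) * infsum g (coprime_to (insert p A))"
      by (simp add: algebra_simps)
    then show ?case using insert by (simp add: mult_ac)
  qed
  then show ?thesis using infsum_npow_coprime_to[OF s A] by simp
qed

definition primes_upto :: "nat \<Rightarrow> nat set" where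
  "primes_upto N = {p. prime p \<and> p \<le> N}"

lemma finite_primes_upto [simp]: "finite (primes_upto N)"
  by (rule finite_subset[of _ "{..N}"]) (auto simp: primes_upto_def)

text \<open>Apart from 1, a number without prime factors up to N exceeds N; what remains is bounded
  by a tail of the series.\<close>

lemma infsum_coprime_to_primes_tendsto:
  fixes f :: "nat \<Rightarrow> complex"
  assumes f: "(\<lambda>n. norm (f n)) summable_on {1..}"
  shows "(\<lambda>N. infsum f (coprime_to (primes_upto N))) \<longlonglongrightarrow> f 1"
proof -
  define C where "C N = coprime_to (primes_upto N)" for N
  define T where "T = infsum (\<lambda>n. norm (f n)) {1..}"
  have summ: "f summable_on B" "(\<lambda>n. norm (f n)) summable_on B" if "B \<subseteq> {1..}" for B
    using summable_on_subset_banach[OF Infinite_Sum.abs_summable_summable[OF f] that] summable_on_subset_banach[OF f that] by auto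
  have C1: "1 \<in> C N" for N by (auto simp: C_def coprime_to_def primes_upto_def)
  have C2: "C N - {1} \<subseteq> {N<..}" for N
  proof
    fix n assume n: "n \<in> C N - {1}"
    then have "n \<noteq> 1" by simp
    then obtain p where p: "prime p" "p dvd n" using prime_factor_nat by blast
    then have "\<not> p \<le> N" using n by (auto simp: C_def coprime_to_def primes_upto_def)
    moreover have "p \<le> n" using p n by (intro dvd_imp_le) (auto simp: C_def coprime_to_def primes_upto_def)
    ultimately show "n \<in> {N<..}" by simp
  qed
  have tail: "infsum (\<lambda>n. norm (f n)) {N<..} = T - (\<Sum>n\<in>{1..N}. norm (f n))" for N
  proof -
    have "T = infsum (\<lambda>n. norm (f n)) ({1..N} \<union> {N<..})"
      unfolding T_def by (rule arg_cong[where f = "infsum _"]) auto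
    also have "\<dots> = infsum (\<lambda>n. norm (f n)) {1..N} + infsum (\<lambda>n. norm (f n)) {N<..}"
      by (intro infsum_Un_disjoint summ) auto
    finally show ?thesis by simp
  qed
  have bound: "norm (infsum f (C N) - f 1) \<le> T - (\<Sum>n\<in>{1..N}. norm (f n))" for N
  proof -
    have sub: "C N - {1} \<subseteq> {1..}" by (auto simp: C_def coprime_to_def primes_upto_def)
    have "infsum f (C N) = infsum f ({1} \<union> (C N - {1}))" using C1[of N] by (simp add: insert_absorb)
    also have "\<dots> = infsum f {1} + infsum f (C N - {1})" using sub by (intro infsum_Un_disjoint summ) auto
    finally have "norm (infsum f (C N) - f 1) = norm (infsum f (C N - {1}))" by simp
    also have "\<dots> \<le> infsum (\<lambda>n. norm (f n)) (C N - {1})" using sub by (intro norm_infsum_bound summ)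
    also have "\<dots> \<le> infsum (\<lambda>n. norm (f n)) {N<..}"
      using sub C2[of N] by (intro infsum_mono_neutral summ) auto
    finally show ?thesis unfolding tail .
  qed
  have "((\<lambda>n. norm (f n)) has_sum T) {1..}" unfolding T_def using f by (rule has_sum_infsum)
  moreover have "((\<lambda>n. norm (f n)) has_sum T) {1..} \<longleftrightarrow> ((\<lambda>n. if n \<ge> 1 then norm (f n) else 0) has_sum T) UNIV"
    by (rule has_sum_cong_neutral) auto
  ultimately have "(\<lambda>n. if n \<ge> 1 then norm (f n) else 0) sums T" by (intro has_sum_imp_sums) simp
  then have "(\<lambda>N. \<Sum>n\<le>N. if n \<ge> 1 then norm (f n) else 0) \<longlonglongrightarrow> T" by (simp add: sums_def_le)
  moreover have "(\<Sum>n\<le>N. if n \<ge> 1 then norm (f n) else 0) = (\<Sum>n\<in>{1..N}. norm (f n))" for N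
    by (rule sum.mono_neutral_cong_right) auto
  ultimately have "(\<lambda>N. \<Sum>n\<in>{1..N}. norm (f n)) \<longlonglongrightarrow> T" by simp
  then have "(\<lambda>N. T - (\<Sum>n\<in>{1..N}. norm (f n))) \<longlonglongrightarrow> T - T" by (intro tendsto_intros)
  then have "(\<lambda>N. T - (\<Sum>n\<in>{1..N}. norm (f n))) \<longlonglongrightarrow> 0" by simp
  then have "(\<lambda>N. infsum f (C N) - f 1) \<longlonglongrightarrow> 0"
    by (rule Lim_null_comparison[OF always_eventually, rotated]) (use bound in blast)
  then show ?thesis unfolding C_def by (rule LIM_zero_cancel)
qed

text \<open>The product of the sieved series is constant in N, and each factor tends to its term at
  1.\<close>

lemma zeta_times_moebius:
  assumes s: "Re s > 1"
  shows "zeta_sum s * infsum (\<lambda>n. of_int (moebius_mu n) * npow s n) {1..} = 1"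
proof -
  define g where "g n = of_int (moebius_mu n) * npow s n" for n
  define A where "A = primes_upto"
  have "(\<lambda>N. infsum (npow s) (coprime_to (A N)) * infsum g (coprime_to (A N))) \<longlonglongrightarrow> npow s 1 * g 1"
    unfolding A_def g_def
    by (intro tendsto_mult infsum_coprime_to_primes_tendsto abs_summable_npow abs_summable_moebius_npow s)
  moreover have "infsum (npow s) (coprime_to (A N)) * infsum g (coprime_to (A N)) = zeta_sum s * infsum g {1..}" for N
    unfolding g_def using s by (intro zeta_moebius_coprime_to) (auto simp: A_def primes_upto_def)
  ultimately have "zeta_sum s * infsum g {1..} = npow s 1 * g 1" by (simp add: LIMSEQ_const_iff)
  moreover have "npow s 1 * g 1 = 1" by (simp add: g_def npow_def moebius_mu_def)
  ultimately show ?thesis unfolding g_def by simp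
qed

section \<open>Non-vanishing on the line of real part one\<close>

text \<open>Take logarithms and expand in powers of u: the n-th coefficient is - 1 / n times 3 + 4
  cos \<theta> + cos (2 \<theta>) = 2 (1 + cos \<theta>)^2, where \<theta> is the argument of z^n.
  The factors are those of 1 / \<zeta>, so the inequality points downwards.\<close>

lemma three_four_one:
  fixes u :: real and z :: complex
  assumes u: "0 \<le> u" "u < 1" and z: "norm z = 1"
  shows "(norm (1 - of_real u :: complex)) ^ 3 * (norm (1 - of_real u * z)) ^ 4 * norm (1 - of_real u * z\<^sup>2) \<le> 1"
proof -
  \<comment> \<open>The sum starts at n = 0, where division by zero makes the term 0.\<close>
  have series: "(\<lambda>n. - (u ^ n / real n) * Re (w ^ n)) sums ln (norm (1 - of_real u * w)) \<and> norm (1 - of_real u * w) > 0"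
    if w: "norm w = 1" for w :: complex
  proof -
    have lt: "norm (- (of_real u * w)) < 1" using u w by (simp add: norm_mult)
    then have ne: "1 - of_real u * w \<noteq> 0" by auto
    have "(\<lambda>n. - ((- (- (of_real u * w))) ^ n) / of_nat n) sums ln (1 + - (of_real u * w))"
      using lt by (rule Ln_series')
    then have "(\<lambda>n. Re (- ((- (- (of_real u * w))) ^ n) / of_nat n)) sums Re (ln (1 + - (of_real u * w)))"
      by (rule sums_Re)
    moreover have trm: "Re (- ((- (- (of_real u * w))) ^ n) / of_nat n) = - (u ^ n / real n) * Re (w ^ n)" for n
    proof -
      have "- ((- (- (of_real u * w))) ^ n) / of_nat n = of_real (- (u ^ n / real n)) * w ^ n"
        by (simp add: power_mult_distrib)
      then have "Re (- ((- (- (of_real u * w))) ^ n) / of_nat n) = Re (of_real (- (u ^ n / real n)) * w ^ n)"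
        by (rule arg_cong)
      also have "\<dots> = - (u ^ n / real n) * Re (w ^ n)" by (simp only: times_complex.sel Re_complex_of_real Im_complex_of_real)
      finally show ?thesis .
    qed
    moreover have "Re (ln (1 + - (of_real u * w))) = ln (norm (1 - of_real u * w))" using ne by (simp add: Re_Ln)
    ultimately show ?thesis using ne by (simp only: trm) simp
  qed
  define a where "a = norm (1 - of_real u :: complex)"
  define b where "b = norm (1 - of_real u * z)"
  define c where "c = norm (1 - of_real u * z\<^sup>2)"
  have pos: "a > 0" "b > 0" "c > 0"
    using series[of 1] series[of z] series[of "z\<^sup>2"] z by (auto simp: a_def b_def c_def norm_power)
  have "(\<lambda>n. 3 * (- (u ^ n / real n) * Re (1 ^ n)) + 4 * (- (u ^ n / real n) * Re (z ^ n)) + - (u ^ n / real n) * Re ((z\<^sup>2) ^ n))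
      sums (3 * ln a + 4 * ln b + ln c)"
    using series[of 1] series[of z] series[of "z\<^sup>2"] z unfolding a_def b_def c_def
    by (intro sums_add sums_mult) (auto simp: norm_power)
  moreover have "3 * (- (u ^ n / real n) * Re (1 ^ n)) + 4 * (- (u ^ n / real n) * Re (z ^ n)) + - (u ^ n / real n) * Re ((z\<^sup>2) ^ n) \<le> 0" for n
  proof -
    have "(Re (z ^ n))\<^sup>2 + (Im (z ^ n))\<^sup>2 = 1" using z by (simp add: cmod_power2[symmetric] norm_power)
    moreover have "Re ((z\<^sup>2) ^ n) = (Re (z ^ n))\<^sup>2 - (Im (z ^ n))\<^sup>2"
    proof -
      have "(z\<^sup>2) ^ n = (z ^ n) * (z ^ n)" by (simp add: power2_eq_square power_mult_distrib)
      then show ?thesis by (simp add: power2_eq_square)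
    qed
    ultimately have "3 + 4 * Re (z ^ n) + Re ((z\<^sup>2) ^ n) = 2 * (1 + Re (z ^ n))\<^sup>2"
      by (simp add: power2_eq_square algebra_simps)
    then have "0 \<le> (u ^ n / real n) * (3 + 4 * Re (z ^ n) + Re ((z\<^sup>2) ^ n))" using u by simp
    then show ?thesis by (simp add: algebra_simps)
  qed
  ultimately have "3 * ln a + 4 * ln b + ln c \<le> 0"
    by (metis (no_types, lifting) sums_le sums_zero)
  then have "ln (a ^ 3 * b ^ 4 * c) \<le> 0" using pos by (simp add: ln_mult ln_realpow)
  then show ?thesis using pos unfolding a_def b_def c_def by (simp add: ln_le_zero_iff)
qed

lemma npow_add: "npow (s + w) n = npow s n * npow w n"
  using rpow_add[of "real n" "- s" "- w"] by (simp add: npow_def)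

text \<open>Sieving by all primes up to N multiplies the right combination by local factors at most
  1, and the sieved combination tends to 1.\<close>

lemma zeta_sum_three_four_one:
  assumes x: "x > 1"
  shows "(norm (zeta_sum (of_real x))) ^ 3 * (norm (zeta_sum (of_real x + \<i> * of_real t))) ^ 4 *
     norm (zeta_sum (of_real x + 2 * \<i> * of_real t)) \<ge> 1"
proof -
  define s0 s1 s2 where "s0 = complex_of_real x" and "s1 = of_real x + \<i> * of_real t" and "s2 = of_real x + 2 * \<i> * of_real t"
  have Re: "Re s0 > 1" "Re s1 > 1" "Re s2 > 1" using x by (auto simp: s0_def s1_def s2_def)
  define A where "A = primes_upto"
  have finA: "finite (A N)" for N by (simp add: A_def)
  define Z where "Z s N = infsum (npow s) (coprime_to (A N))" for s N
  have Z: "Z s N = zeta_sum s * (\<Prod>p\<in>A N. 1 - npow s p)" if "Re s > 1" for s N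
    unfolding Z_def using that finA by (intro infsum_npow_coprime_to) (auto simp: A_def primes_upto_def)
  have lim: "(\<lambda>N. Z s N) \<longlonglongrightarrow> 1" if "Re s > 1" for s
  proof -
    have "npow s 1 = 1" by (simp add: npow_def)
    then show ?thesis
      using infsum_coprime_to_primes_tendsto[OF abs_summable_npow[OF that]] unfolding Z_def A_def by simp
  qed
  have L: "(\<lambda>N. (norm (Z s0 N)) ^ 3 * (norm (Z s1 N)) ^ 4 * norm (Z s2 N)) \<longlonglongrightarrow> (norm (1::complex)) ^ 3 * (norm (1::complex)) ^ 4 * norm (1::complex)"
    by (intro tendsto_intros lim Re)
  have le: "(norm (Z s0 N)) ^ 3 * (norm (Z s1 N)) ^ 4 * norm (Z s2 N) \<le>
      (norm (zeta_sum s0)) ^ 3 * (norm (zeta_sum s1)) ^ 4 * norm (zeta_sum s2)" for N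
  proof -
    have factor: "(norm (1 - npow s0 p)) ^ 3 * (norm (1 - npow s1 p)) ^ 4 * norm (1 - npow s2 p) \<le> 1" if p: "prime p" for p
    proof -
      define u where "u = real p powr (- x)"
      define z where "z = npow (\<i> * of_real t) p"
      have p1: "real p > 1" using prime_gt_1_nat[OF p] by simp
      have "npow s0 p = of_real u" using p1 by (simp add: npow_def s0_def u_def rpow_of_real flip: of_real_minus)
      moreover have "npow s1 p = npow s0 p * z" unfolding s1_def s0_def z_def by (rule npow_add)
      moreover have "npow s2 p = npow s0 p * z\<^sup>2"
      proof -
        have "s2 = (s0 + \<i> * of_real t) + \<i> * of_real t" by (simp add: s2_def s0_def)
        then have "npow s2 p = npow s0 p * z * z" unfolding z_def by (simp only: npow_add)
        then show ?thesis by (simp add: power2_eq_square mult.assoc)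
      qed
      moreover have "norm z = 1" using p1 by (simp add: z_def norm_npow)
      moreover have "0 \<le> u" "u < 1" using p1 x by (auto simp: u_def powr_less_one)
      ultimately show ?thesis using three_four_one[of u z] by simp
    qed
    have "(norm (Z s0 N)) ^ 3 * (norm (Z s1 N)) ^ 4 * norm (Z s2 N) =
      ((norm (zeta_sum s0)) ^ 3 * (norm (zeta_sum s1)) ^ 4 * norm (zeta_sum s2)) *
      (\<Prod>p\<in>A N. (norm (1 - npow s0 p)) ^ 3 * (norm (1 - npow s1 p)) ^ 4 * norm (1 - npow s2 p))"
      unfolding Z[OF Re(1)] Z[OF Re(2)] Z[OF Re(3)]
      by (simp add: norm_mult prod_norm[symmetric] power_mult_distrib prod.distrib prod_power_distrib mult_ac)
    also have "\<dots> \<le> ((norm (zeta_sum s0)) ^ 3 * (norm (zeta_sum s1)) ^ 4 * norm (zeta_sum s2)) * 1"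
      using factor by (intro mult_left_mono prod_le_1) (auto simp: A_def primes_upto_def)
    finally show ?thesis by simp
  qed
  have "(norm (1::complex)) ^ 3 * (norm (1::complex)) ^ 4 * norm (1::complex) \<le>
     (norm (zeta_sum s0)) ^ 3 * (norm (zeta_sum s1)) ^ 4 * norm (zeta_sum s2)"
    by (rule LIMSEQ_le_const2[OF L]) (use le in blast)
  then show ?thesis unfolding s0_def s1_def s2_def by simp
qed

lemma Hzeta_nonzero:
  assumes "Re s \<ge> 1"
  shows "Hzeta s \<noteq> 0"
proof (cases "Re s > 1")
  case True
  have "zeta_sum s \<noteq> 0" using zeta_times_moebius[OF True] by auto
  then show ?thesis using True by (auto simp: Hzeta_eq)
next
  case False
  define t where "t = Im s"
  have s: "s = 1 + \<i> * of_real t" using False assms by (simp add: complex_eq_iff t_def)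
  show ?thesis
  proof (cases "t = 0")
    case True
    then show ?thesis using s by simp
  next
    case t: False
    show ?thesis
    proof
      assume zero: "Hzeta s = 0"
      define s1 where "s1 x = of_real x + \<i> * of_real t" for x :: real
      define s2 where "s2 x = of_real x + 2 * \<i> * of_real t" for x :: real
      have op: "open {s. 0 < Re s}" by (rule open_halfspace_Re_gt)
      have diff: "(Hzeta has_field_derivative deriv Hzeta s) (at s)"
        using Hzeta_holomorphic op s by (intro holomorphic_derivI) auto
      have lim1: "((\<lambda>x. Hzeta (s1 x) / of_real (x - 1)) \<longlongrightarrow> deriv Hzeta s) (at_right 1)"
      proof -
        have "((\<lambda>w. (Hzeta w - Hzeta s) / (w - s)) \<longlongrightarrow> deriv Hzeta s) (at s)"
          using diff by (simp add: has_field_derivative_iff)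
        moreover have "filterlim s1 (at s) (at_right 1)"
        proof (rule filterlim_atI)
          have "(s1 \<longlongrightarrow> s1 1) (at_right 1)" unfolding s1_def by (intro tendsto_intros)
          then show "(s1 \<longlongrightarrow> s) (at_right 1)" by (simp add: s1_def s)
          show "\<forall>\<^sub>F x in at_right 1. s1 x \<noteq> s"
            unfolding eventually_at_filter by (rule always_eventually) (auto simp: s1_def s)
        qed
        ultimately have "((\<lambda>x. (Hzeta (s1 x) - Hzeta s) / (s1 x - s)) \<longlongrightarrow> deriv Hzeta s) (at_right 1)"
          by (rule filterlim_compose)
        moreover have "s1 x - s = of_real (x - 1)" for x by (simp add: s1_def s)
        ultimately show ?thesis by (simp add: zero)
      qed
      have lim0: "((\<lambda>x. Hzeta (of_real x)) \<longlongrightarrow> Hzeta 1) (at_right 1)"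
        by (rule isCont_tendsto_compose[OF isCont_Hzeta]) (auto intro!: tendsto_eq_intros)
      have lim2: "((\<lambda>x. Hzeta (s2 x)) \<longlongrightarrow> Hzeta (s2 1)) (at_right 1)"
        unfolding s2_def by (rule isCont_tendsto_compose[OF isCont_Hzeta]) (auto intro!: tendsto_eq_intros)
      have cs: "(s1 \<longlongrightarrow> s1 1) (at_right 1)" "(s2 \<longlongrightarrow> s2 1) (at_right 1)"
        unfolding s1_def s2_def by (intro tendsto_intros)+
      \<comment> \<open>The same 3-4-1 combination rewritten so that each factor has a limit. A zero
        of \<open>Hzeta\<close> at s contributes (x - 1)^4 against (x - 1)^3 from the pole, and the
        surviving factor x - 1 tends to 0.\<close>
      define R where "R x = (norm (Hzeta (of_real x))) ^ 3 * (norm (Hzeta (s1 x) / of_real (x - 1))) ^ 4 * norm (Hzeta (s2 x)) *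
          (x - 1) / (norm (s1 x - 1) ^ 4 * norm (s2 x - 1))" for x
      have "(R \<longlongrightarrow> (norm (Hzeta 1)) ^ 3 * (norm (deriv Hzeta s)) ^ 4 * norm (Hzeta (s2 1)) * (1 - 1) /
           (norm (s1 1 - 1) ^ 4 * norm (s2 1 - 1))) (at_right 1)"
        unfolding R_def
        by (intro tendsto_intros lim0 lim1 lim2 cs) (use t in \<open>auto simp: s1_def s2_def\<close>)
      then have "(R \<longlongrightarrow> 0) (at_right 1)" by simp
      then have "\<forall>\<^sub>F x in at_right 1. R x < 1" by (rule order_tendstoD) simp
      moreover have "\<forall>\<^sub>F x in at_right 1. x > (1::real)" by (rule eventually_at_right_less)
      ultimately have "\<forall>\<^sub>F x in at_right (1::real). False"
      proof eventually_elim
        case (elim x)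
        have x: "x > 1" by fact
        have z: "norm (zeta_sum w) = norm (Hzeta w) / norm (w - 1)" if "Re w > 1" for w
        proof -
          have "w \<noteq> 1" using that by auto
          then show ?thesis by (simp add: Hzeta_eq[OF that] norm_mult)
        qed
        have "1 \<le> (norm (zeta_sum (of_real x))) ^ 3 * (norm (zeta_sum (s1 x))) ^ 4 * norm (zeta_sum (s2 x))"
          unfolding s1_def s2_def by (rule zeta_sum_three_four_one[OF x])
        also have "\<dots> = R x"
        proof -
          have n0: "norm (complex_of_real x - 1) = x - 1" using x by (metis abs_of_pos diff_gt_0_iff_gt norm_of_real of_real_1 of_real_diff)
          have "norm (complex_of_real (x - 1)) = x - 1" unfolding norm_of_real using x by simp
          moreover have "(A / y) ^ 3 * (B / P) ^ 4 * (C / D) = A ^ 3 * (B / y) ^ 4 * C * y / (P ^ 4 * D)"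
            if "y > 0" for A B C D P y :: real
            using that by (simp add: power_divide power3_eq_cube power4_eq_xxxx)
          ultimately show ?thesis using x unfolding R_def norm_divide by (simp add: z s1_def s2_def n0)
        qed
        finally show False using elim by simp
      qed
      then show False by (simp add: eventually_False trivial_limit_at_right_real)
    qed
  qed
qed

section \<open>Newman's contour argument\<close>

text \<open>The right side telescopes in m, which bounds the tail of the sum of n^(-1-x) from N + 1
  on by N^(-x) / x.\<close>

lemma powr_minus_tail_le:
  fixes x m :: real
  assumes x: "x > 0" and m: "m \<ge> 1"
  shows "(m + 1) powr (- 1 - x) \<le> (m powr (- x) - (m + 1) powr (- x)) / x"
proof -
  have "\<exists>z. m < z \<and> z < m + 1 \<and> (m + 1) powr (- x) - m powr (- x) = (m + 1 - m) * (- x * z powr (- x - 1))"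
    using m by (intro MVT2) (auto intro!: derivative_eq_intros)
  then obtain z where z: "m < z" "z < m + 1" "(m + 1) powr (- x) - m powr (- x) = - x * z powr (- x - 1)" by auto
  have "(m + 1) powr (- 1 - x) \<le> z powr (- 1 - x)" using z m x by (intro powr_mono2') auto
  moreover have "(m powr (- x) - (m + 1) powr (- x)) / x = z powr (- 1 - x)"
  proof -
    have e: "- x - 1 = - 1 - x" by simp
    have "m powr (- x) - (m + 1) powr (- x) = z powr (- 1 - x) * x" using arg_cong[OF z(3)[unfolded e], of uminus]
      by (simp only: minus_diff_eq minus_mult_left[symmetric] minus_minus mult.commute)
    then show ?thesis using x by simp
  qed
  ultimately show ?thesis by simp
qed

text \<open>Comparison with an integral. For x \<ge> 1 the terms increase and the last one is added
  separately; for x < 1 they decrease and the integral alone dominates.\<close>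

lemma sum_powr_le:
  fixes x :: real
  assumes x: "x > 0"
  shows "(\<Sum>n<Suc N. real (n + 1) powr (x - 1)) \<le> real (N + 1) powr x / x + real (N + 1) powr (x - 1)"
proof (cases "x \<ge> 1")
  case True
  show ?thesis
  proof (induction N)
    case 0
    then show ?case using x by simp
  next
    case (Suc N)
    define m where "m = real (N + 1)"
    have m: "m \<ge> 1" by (simp add: m_def)
    have "\<exists>z. m < z \<and> z < m + 1 \<and> (m + 1) powr x - m powr x = (m + 1 - m) * (x * z powr (x - 1))"
      using m by (intro MVT2) (auto intro!: derivative_eq_intros)
    then obtain z where z: "m < z" "z < m + 1" "(m + 1) powr x - m powr x = x * z powr (x - 1)" by auto
    have "m powr (x - 1) \<le> z powr (x - 1)" using z m True by (intro powr_mono2) auto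
    moreover have "(m + 1) powr x / x - m powr x / x = z powr (x - 1)"
      using z(3) x by (simp add: diff_divide_distrib[symmetric])
    ultimately have "m powr x / x + m powr (x - 1) \<le> (m + 1) powr x / x" by linarith
    then have "real (N + 1) powr x / x + real (N + 1) powr (x - 1) \<le> real (Suc N + 1) powr x / x"
      by (simp add: m_def add.commute)
    moreover have "(\<Sum>n<Suc (Suc N). real (n + 1) powr (x - 1)) = (\<Sum>n<Suc N. real (n + 1) powr (x - 1)) + real (Suc N + 1) powr (x - 1)"
      by (rule sum.lessThan_Suc)
    ultimately show ?case using Suc.IH by linarith
  qed
next
  case False
  have "(\<Sum>n<Suc N. real (n + 1) powr (x - 1)) \<le> real (N + 1) powr x / x"
  proof (induction N)
    case 0
    then show ?case using x False by simp
  next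
    case (Suc N)
    define m where "m = real (N + 1)"
    have m: "m \<ge> 1" by (simp add: m_def)
    have "\<exists>z. m < z \<and> z < m + 1 \<and> (m + 1) powr x - m powr x = (m + 1 - m) * (x * z powr (x - 1))"
      using m by (intro MVT2) (auto intro!: derivative_eq_intros)
    then obtain z where z: "m < z" "z < m + 1" "(m + 1) powr x - m powr x = x * z powr (x - 1)" by auto
    have "(m + 1) powr (x - 1) \<le> z powr (x - 1)" using z m False by (intro powr_mono2') auto
    moreover have "(m + 1) powr x / x - m powr x / x = z powr (x - 1)"
      using z(3) x by (simp add: diff_divide_distrib[symmetric])
    ultimately have "m powr x / x + (m + 1) powr (x - 1) \<le> (m + 1) powr x / x" by linarith
    then have "real (N + 1) powr x / x + real (Suc N + 1) powr (x - 1) \<le> real (Suc N + 1) powr x / x"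
      by (simp add: m_def add.commute)
    moreover have "(\<Sum>n<Suc (Suc N). real (n + 1) powr (x - 1)) = (\<Sum>n<Suc N. real (n + 1) powr (x - 1)) + real (Suc N + 1) powr (x - 1)"
      by (rule sum.lessThan_Suc)
    ultimately show ?case using Suc.IH by linarith
  qed
  then show ?thesis by (smt (verit) powr_ge_zero)
qed

definition moebius_partial :: "nat \<Rightarrow> complex \<Rightarrow> complex" where
  "moebius_partial N s = (\<Sum>n<N. of_int (moebius_mu (n + 1)) * npow s (n + 1))"

lemma norm_moebius_term_le: "norm (of_int (moebius_mu (n + 1)) * npow s (n + 1)) \<le> real (n + 1) powr (- Re s)"
proof -
  have "norm (of_int (moebius_mu (n + 1)) :: complex) \<le> 1" using abs_moebius_mu_le[of "n + 1"] by simp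
  moreover have "norm (npow s (n + 1)) = real (n + 1) powr (- Re s)" by (rule norm_npow) simp
  ultimately show ?thesis unfolding norm_mult
    using mult_right_mono[of "norm (of_int (moebius_mu (n + 1)) :: complex)" 1 "norm (npow s (n + 1))"] by simp
qed

text \<open>Here z / \<open>Hzeta (1 + z)\<close> is 1 / \<zeta>(1 + z), so the difference is the
  tail of the Moebius series. The factor 1 / Re z is the one that \<open>Newman_kernel\<close>
  compensates.\<close>

lemma moebius_remainder_le:
  assumes x: "Re z > 0" and N: "N \<ge> 1"
  shows "norm (z / Hzeta (1 + z) - moebius_partial N (1 + z)) \<le> real N powr (- Re z) / Re z"
proof -
  define s where "s = 1 + z"
  define g where "g n = of_int (moebius_mu n) * npow s n" for n
  have s: "Re s > 1" using x by (simp add: s_def)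
  have le: "norm (g (n + 1)) \<le> real (n + 1) powr (- Re s)" for n unfolding g_def by (rule norm_moebius_term_le)
  have summ: "summable (\<lambda>n. norm (g (n + 1)))"
    by (rule summable_comparison_test'[OF summable_Suc_powr[of "- Re s"]]) (use s le in auto)
  define v where "v n = (real (n + N) powr (- Re z) - real (Suc n + N) powr (- Re z)) / Re z" for n
  have "(\<lambda>n. real (n + N) powr (- Re z)) \<longlonglongrightarrow> 0" using x by real_asymp
  from sums_divide[OF telescope_sums'[OF this]] have v_sums: "v sums (real N powr (- Re z) / Re z)"
    unfolding v_def by simp
  have "zeta_sum s * infsum g {1..} = 1" unfolding g_def by (rule zeta_times_moebius[OF s])
  moreover have H: "Hzeta s = z * zeta_sum s" using Hzeta_eq[OF s] by (simp add: s_def)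
  moreover have "z \<noteq> 0" using x by auto
  ultimately have "z / Hzeta s = 1 / zeta_sum s" "zeta_sum s \<noteq> 0" "infsum g {1..} = 1 / zeta_sum s"
    by (auto simp: nonzero_eq_divide_eq) (metis eq_divide_imp mult.commute mult_zero_left zero_neq_one)
  then have "z / Hzeta s = infsum g {1..}" by simp
  also have "\<dots> = (\<Sum>n. g (n + 1))" by (rule abs_summable_on_Suc(2)[OF summ])
  also have "\<dots> = (\<Sum>n. g (n + N + 1)) + (\<Sum>n<N. g (n + 1))"
    using suminf_split_initial_segment[OF summable_norm_cancel[OF summ], of N] by simp
  finally have "z / Hzeta s - moebius_partial N s = (\<Sum>n. g (n + N + 1))"
    by (simp add: moebius_partial_def g_def)
  also have "norm \<dots> \<le> (\<Sum>n. v n)"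
  proof (rule norm_suminf_le[OF _ sums_summable[OF v_sums]])
    fix n
    have "norm (g (n + N + 1)) \<le> real (n + N + 1) powr (- 1 - Re z)" using le[of "n + N"] by (simp add: s_def)
    also have "\<dots> \<le> v n"
      using powr_minus_tail_le[of "Re z" "real (n + N)"] x N by (simp add: v_def add_ac)
    finally show "norm (g (n + N + 1)) \<le> v n" .
  qed
  also have "\<dots> = real N powr (- Re z) / Re z" using v_sums by (simp add: sums_iff)
  finally show ?thesis by (simp add: s_def)
qed

lemma norm_moebius_partial_le:
  assumes x: "Re z < 0" and N: "N \<ge> 1"
  shows "norm (moebius_partial N (1 + z)) \<le> real N powr (- Re z) * (1 / - Re z + 1 / real N)"
proof -
  obtain K where K: "N = Suc K" using N by (cases N) auto
  define y where "y = - Re z"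
  have y: "y > 0" using x by (simp add: y_def)
  have "norm (moebius_partial N (1 + z)) \<le> (\<Sum>n<N. real (n + 1) powr (y - 1))"
    unfolding moebius_partial_def
  proof (rule sum_norm_le)
    fix n
    show "norm (of_int (moebius_mu (n + 1)) * npow (1 + z) (n + 1)) \<le> real (n + 1) powr (y - 1)"
    proof -
      have "y - 1 = - Re (1 + z)" by (simp add: y_def)
      then show ?thesis using norm_moebius_term_le[of n "1 + z"] by (simp only:)
    qed
  qed
  also have "\<dots> \<le> real N powr y / y + real N powr (y - 1)"
    unfolding K using sum_powr_le[OF y, of K] by simp
  also have "real N powr (y - 1) = real N powr y * (1 / real N)" using N by (simp add: powr_diff)
  finally show ?thesis by (simp add: y_def algebra_simps)
qed

text \<open>On the circle the kernel is real and proportional to Re z; this cancels the blow-up of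
  the estimates on both sides as z approaches the imaginary axis.\<close>

lemma Newman_kernel:
  assumes "norm z = R" "R > 0"
  shows "1 / z + z / (of_real R)\<^sup>2 = of_real (2 * Re z / R\<^sup>2)"
proof -
  have z0: "z \<noteq> 0" using assms by auto
  have "z * cnj z = (of_real R)\<^sup>2" using complex_norm_square[of z] assms by simp
  then have "1 / z = cnj z / (of_real R)\<^sup>2" using z0 assms by (simp add: field_simps)
  then have "1 / z + z / (of_real R)\<^sup>2 = (z + cnj z) / (of_real R)\<^sup>2" by (simp add: add_divide_distrib)
  also have "z + cnj z = of_real (2 * Re z)" by (rule complex_add_cnj)
  finally show ?thesis by simp
qed

text \<open>The points 1 + i y with y between - R and R form a compact subset of the open set where
  \<open>Hzeta\<close> is nonzero, so a uniform neighbourhood stays inside; to the right of the line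
  \<open>Hzeta_nonzero\<close> applies directly.\<close>

lemma Hzeta_nonzero_strip:
  obtains d where "d > 0" "\<And>z. - d < Re z \<Longrightarrow> \<bar>Im z\<bar> \<le> R \<Longrightarrow> Re (1 + z) > 0 \<and> Hzeta (1 + z) \<noteq> 0"
proof -
  define W where "W = {s. Re s > 0} \<inter> Hzeta -` (- {0})"
  have "open W" unfolding W_def
    by (rule continuous_open_preimage[OF holomorphic_on_imp_continuous_on[OF Hzeta_holomorphic] open_halfspace_Re_gt]) auto
  moreover have "compact ((\<lambda>y. 1 + \<i> * of_real y :: complex) ` {-R..R})"
    by (intro compact_continuous_image continuous_intros) auto
  moreover have "(\<lambda>y. 1 + \<i> * of_real y :: complex) ` {-R..R} \<subseteq> W"
    unfolding W_def using Hzeta_nonzero by auto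
  ultimately obtain d where d: "d > 0" "(\<Union>x\<in>(\<lambda>y. 1 + \<i> * of_real y :: complex) ` {-R..R}. ball x d) \<subseteq> W"
    using compact_subset_open_imp_ball_epsilon_subset by metis
  show ?thesis
  proof (rule that[OF d(1)])
    fix z assume z: "- d < Re z" "\<bar>Im z\<bar> \<le> R"
    show "Re (1 + z) > 0 \<and> Hzeta (1 + z) \<noteq> 0"
    proof (cases "Re z \<ge> 0")
      case True
      then show ?thesis using Hzeta_nonzero[of "1 + z"] by simp
    next
      case False
      have "dist (1 + \<i> * of_real (Im z)) (1 + z) = norm (of_real (Re z) :: complex)"
      proof -
        have "(1 + \<i> * of_real (Im z)) - (1 + z) = - of_real (Re z)" by (simp add: complex_eq_iff)
        then show ?thesis by (simp add: dist_norm)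
      qed
      then have "1 + z \<in> ball (1 + \<i> * of_real (Im z)) d" using z False by simp
      moreover have "Im z \<in> {-R..R}" using z by auto
      ultimately have "1 + z \<in> W" using d(2) by blast
      then show ?thesis by (auto simp: W_def)
    qed
  qed
qed

lemma moebius_partial_holomorphic: "(\<lambda>z. moebius_partial N (1 + z)) holomorphic_on S"
  unfolding moebius_partial_def npow_def by (intro holomorphic_intros)

text \<open>Newman's contour: since \<open>1 / \<zeta>\<close> vanishes at \<open>1\<close>, the integrand built from it has no pole at the origin.\<close>

lemma Newman_moebius:
  assumes R: "R > 0"
  shows "\<exists>d>0. \<exists>B. \<forall>N\<ge>1. 2 * pi * norm (moebius_partial N 1) \<le>
     (4 * pi + 2) / R + 2 * pi / real N + B * real N powr (- d)"
proof -
  obtain e where e: "e > 0" "\<And>z. - e < Re z \<Longrightarrow> \<bar>Im z\<bar> \<le> R + 1 \<Longrightarrow> Re (1 + z) > 0 \<and> Hzeta (1 + z) \<noteq> 0"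
    using Hzeta_nonzero_strip by blast
  define U where "U = {z. Re z > - e} \<inter> ({z. Im z < R + 1} \<inter> {z. Im z > - (R + 1)})"
  have openU: "open U" unfolding U_def
    by (intro open_Int open_halfspace_Re_gt open_halfspace_Im_lt open_halfspace_Im_gt)
  have convU: "convex U" unfolding U_def
    by (intro convex_Int convex_halfspace_Re_gt convex_halfspace_Im_lt convex_halfspace_Im_gt)
  have U_ok: "Re (1 + z) > 0" "Hzeta (1 + z) \<noteq> 0" if "z \<in> U" for z
  proof -
    have "- e < Re z" "\<bar>Im z\<bar> \<le> R + 1" using that by (auto simp: U_def)
    then show "Re (1 + z) > 0" "Hzeta (1 + z) \<noteq> 0" using e(2)[of z] by auto
  qed
  \<comment> \<open>1 / \<zeta>(1 + z) times the kernel 1 / z + z / R^2, with the factor z of 1 /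
    \<zeta> = z / \<open>Hzeta\<close> already cancelled.\<close>
  define q where "q z = (1 / Hzeta (1 + z)) * (1 + z\<^sup>2 / (of_real R)\<^sup>2)" for z
  have Hhol: "(\<lambda>z. Hzeta (1 + z)) holomorphic_on U"
  proof -
    have "(\<lambda>z::complex. 1 + z) holomorphic_on U" by (intro holomorphic_intros)
    then have "(Hzeta \<circ> (\<lambda>z. 1 + z)) holomorphic_on U"
      by (rule holomorphic_on_compose_gen[OF _ Hzeta_holomorphic]) (use U_ok in auto)
    then show ?thesis by (simp add: o_def)
  qed
  have qhol: "q holomorphic_on U"
    unfolding q_def using Hhol U_ok R by (intro holomorphic_intros) auto
  define K where "K = cbox (Complex (- e / 2) (- R)) (Complex 0 R)"
  have KU: "K \<subseteq> U" using e by (auto simp: K_def U_def in_cbox_complex_iff)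
  have "compact (q ` K)" unfolding K_def
    by (rule compact_continuous_image[OF continuous_on_subset[OF holomorphic_on_imp_continuous_on[OF qhol]]])
       (use KU in \<open>auto simp: K_def\<close>)
  then obtain B where B: "\<And>z. z \<in> K \<Longrightarrow> norm (q z) \<le> B" and B0: "B > 0"
    by (metis bounded_pos compact_imp_bounded imageI)
  \<comment> \<open>The left side of the contour stays in \<open>K\<close>, and d \<le> 1 / (B R)
    makes each horizontal side contribute at most 1 / R.\<close>
  define d where "d = min (e / 2) (1 / (B * R))"
  have d: "d > 0" "d \<le> e / 2" "B * d \<le> 1 / R"
    using e B0 R by (auto simp: d_def min_def field_simps)
  define C1 where "C1 = part_circlepath 0 R (- (pi / 2)) (pi / 2)"
  define C2 where "C2 = part_circlepath 0 R (pi / 2) (3 * pi / 2)"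
  define L1 where "L1 = linepath (\<i> * of_real R) (- of_real d + \<i> * of_real R)"
  define L2 where "L2 = linepath (- of_real d + \<i> * of_real R) (- of_real d - \<i> * of_real R)"
  define L3 where "L3 = linepath (- of_real d - \<i> * of_real R) (- \<i> * of_real R)"
  have i_exp: "exp (\<i> * of_real (pi / 2)) = \<i>" "exp (\<i> * of_real (- (pi / 2))) = - \<i>"
    by (simp_all only: cis_conv_exp[symmetric]) (simp_all add: complex_eq_iff)
  have ends: "pathstart C1 = - \<i> * of_real R" "pathfinish C1 = \<i> * of_real R"
    unfolding C1_def pathstart_part_circlepath pathfinish_part_circlepath i_exp by simp_all
  have C1_img: "norm z = R \<and> Re z \<ge> 0" if "z \<in> path_image C1" for z
  proof -
    have "z \<in> {0 + of_real R * exp (\<i> * of_real x) | x. - (pi / 2) \<le> x \<and> x \<le> pi / 2}"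
      using that unfolding C1_def by (subst (asm) path_image_part_circlepath) auto
    then obtain x where x: "z = of_real R * exp (\<i> * of_real x)" "- (pi / 2) \<le> x" "x \<le> pi / 2" by auto
    have "z = of_real R * cis x" using x by (simp add: cis_conv_exp)
    then show ?thesis using R x cos_ge_zero[of x] by (simp add: norm_mult)
  qed
  have C2_img: "norm z = R \<and> Re z \<le> 0" if "z \<in> path_image C2" for z
  proof -
    have "z \<in> {0 + of_real R * exp (\<i> * of_real x) | x. pi / 2 \<le> x \<and> x \<le> 3 * pi / 2}"
      using that unfolding C2_def by (subst (asm) path_image_part_circlepath) auto
    then obtain x where x: "z = of_real R * exp (\<i> * of_real x)" "pi / 2 \<le> x" "x \<le> 3 * pi / 2" by auto
    have "z = of_real R * cis x" using x by (simp add: cis_conv_exp)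
    moreover have "cos x \<le> 0" using cos_ge_zero[of "x - pi"] x by simp
    ultimately show ?thesis using R by (simp add: norm_mult mult_nonneg_nonpos)
  qed
  have segs: "closed_segment (\<i> * of_real R) (- of_real d + \<i> * of_real R) \<subseteq> K"
    "closed_segment (- of_real d + \<i> * of_real R) (- of_real d - \<i> * of_real R) \<subseteq> K"
    "closed_segment (- of_real d - \<i> * of_real R) (- \<i> * of_real R) \<subseteq> K"
    unfolding K_def using d e R
    by (intro closed_segment_subset convex_box; simp add: in_cbox_complex_iff)+
  have C1U: "path_image C1 \<subseteq> U"
  proof
    fix z assume "z \<in> path_image C1"
    then have "norm z = R" "Re z \<ge> 0" using C1_img by auto
    then show "z \<in> U" using abs_Im_le_cmod[of z] e by (auto simp: U_def)
  qed
  have main: "2 * pi * norm (moebius_partial N 1) \<le> (4 * pi + 2) / R + 2 * pi / real N + (B * (2 * R)) * real N powr (- d)"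
    if N: "N \<ge> 1" for N
  proof -
    have N0: "real N > 0" using N by simp
    define k where "k z = rpow (real N) z * (1 / z + z / (of_real R)\<^sup>2)" for z
    define f where "f z = rpow (real N) z * q z" for z
    define S where "S z = moebius_partial N (1 + z)" for z
    have norm_k: "norm (k z) = real N powr Re z * (2 * \<bar>Re z\<bar> / R\<^sup>2)" if "norm z = R" for z
      unfolding k_def norm_mult Newman_kernel[OF that R] norm_of_real norm_rpow[OF N0] by (simp add: abs_mult)
    have fhol: "f holomorphic_on U" unfolding f_def using qhol by (intro holomorphic_intros)
    \<comment> \<open>The partial sum is entire, so its integral may run over the full circle; only
      the integrand \<open>f\<close> with 1 / \<zeta> needs the contour inside the zero-free
      region.\<close>
    define G where "G z = S z * rpow (real N) z * (1 + z\<^sup>2 / (of_real R)\<^sup>2)" for z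
    have Ghol: "G holomorphic_on UNIV" unfolding G_def S_def
      using R by (intro holomorphic_intros moebius_partial_holomorphic) auto
    have GS: "G z / z = S z * k z" if "z \<noteq> 0" for z
      unfolding G_def k_def using that by (simp add: field_simps power2_eq_square)
    have int_f: "f contour_integrable_on C1" "f contour_integrable_on L1" "f contour_integrable_on L2" "f contour_integrable_on L3"
      unfolding C1_def L1_def L2_def L3_def
      using C1U segs KU by (auto intro!: contour_integrable_holomorphic_simple[OF fhol openU] simp: C1_def)
    have zero: "contour_integral C1 f + (contour_integral L1 f + (contour_integral L2 f + contour_integral L3 f)) = 0"
    proof -
      have "(f has_contour_integral 0) (C1 +++ (L1 +++ (L2 +++ L3)))"
      proof (rule Cauchy_theorem_convex_simple[OF fhol convU])
        show "valid_path (C1 +++ (L1 +++ (L2 +++ L3)))"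
          using ends by (intro valid_path_join) (auto simp: C1_def L1_def L2_def L3_def)
        show "path_image (C1 +++ (L1 +++ (L2 +++ L3))) \<subseteq> U"
          using ends C1U segs KU by (subst path_image_join path_image_join, simp add: L1_def)+
            (auto simp: L1_def L2_def L3_def path_image_join)
        show "pathfinish (C1 +++ (L1 +++ (L2 +++ L3))) = pathstart (C1 +++ (L1 +++ (L2 +++ L3)))"
          using ends by (simp add: L1_def L2_def L3_def)
      qed
      moreover have "(f has_contour_integral (contour_integral C1 f + (contour_integral L1 f + (contour_integral L2 f + contour_integral L3 f))))
          (C1 +++ (L1 +++ (L2 +++ L3)))"
        using int_f ends
        by (intro has_contour_integral_join has_contour_integral_integral valid_path_join)
           (auto simp: C1_def L1_def L2_def L3_def)
      ultimately show ?thesis by (rule has_contour_integral_unique[symmetric])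
    qed
    have nz: "0 \<notin> path_image C1" "0 \<notin> path_image C2" using C1_img[of 0] C2_img[of 0] R by auto
    have hol_Gz: "(\<lambda>z. G z / z) holomorphic_on - {0}" using holomorphic_on_subset[OF Ghol] by (intro holomorphic_intros) auto
    have int_G: "(\<lambda>z. G z / z) contour_integrable_on C1" "(\<lambda>z. G z / z) contour_integrable_on C2"
      unfolding C1_def C2_def
      using nz by (auto intro!: contour_integrable_holomorphic_simple[OF hol_Gz] simp: C1_def C2_def)
    have circ: "contour_integral C1 (\<lambda>z. G z / z) + contour_integral C2 (\<lambda>z. G z / z) = 2 * pi * \<i> * S 0"
    proof -
      \<comment> \<open>The full circle, started at - i R so that cutting it at pi / 2 gives
        \<open>C1\<close> and \<open>C2\<close>.\<close>
      define C where "C = part_circlepath 0 R (- (pi / 2)) (3 * pi / 2)"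
      have lt: "- (pi / 2) < pi / 2" "pi / 2 < 3 * pi / 2" "- (pi / 2) < 3 * pi / 2" using pi_gt_zero by linarith+
      have int1: "((\<lambda>z. G z / z) has_contour_integral (contour_integral C1 (\<lambda>z. G z / z) + contour_integral C2 (\<lambda>z. G z / z))) C"
        using has_contour_integral_integral[OF int_G(1)] has_contour_integral_integral[OF int_G(2)] lt
        unfolding C_def C1_def C2_def has_contour_integral_part_circlepath_iff[OF lt(1)]
          has_contour_integral_part_circlepath_iff[OF lt(2)] has_contour_integral_part_circlepath_iff[OF lt(3)]
        by (intro has_integral_combine[of _ "pi / 2"]) auto
      have valid: "valid_path C" unfolding C_def by simp
      have C_img: "path_image C \<subseteq> sphere 0 R" unfolding C_def using lt R by (intro path_image_part_circlepath_subset) auto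
      have "((\<lambda>w. 1 / (w - 0)) has_contour_integral (2 * pi * \<i>)) C"
        unfolding C_def has_contour_integral_part_circlepath_iff[OF lt(3)]
      proof -
        have "((\<lambda>t::real. \<i>) has_integral ((3 * pi / 2) - (- (pi / 2))) *\<^sub>R \<i>) {- (pi / 2)..3 * pi / 2}"
          using has_integral_const_real[of \<i> "- (pi / 2)" "3 * pi / 2"] lt by simp
        moreover have "((3 * pi / 2) - (- (pi / 2))) *\<^sub>R \<i> = 2 * pi * \<i>" by (simp add: scaleR_conv_of_real)
        moreover have trm: "1 / (0 + of_real R * cis t - 0) * of_real R * \<i> * cis t = \<i>" for t
          using R by (simp add: field_simps)
        ultimately show "((\<lambda>t. 1 / (0 + of_real R * cis t - 0) * of_real R * \<i> * cis t) has_integral 2 * pi * \<i>) {- (pi / 2)..3 * pi / 2}"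
          unfolding trm by (simp only:)
      qed
      then have "contour_integral C (\<lambda>w. 1 / (w - 0)) = 2 * pi * \<i>" by (rule contour_integral_unique)
      moreover have "0 \<notin> path_image C" using C_img R by auto
      ultimately have wind: "winding_number C 0 = 1" using winding_number_valid_path[OF valid, of 0] by simp
      have "((\<lambda>w. G w / (w - 0)) has_contour_integral (2 * pi * \<i> * winding_number C 0 * G 0)) C"
      proof (rule Cauchy_integral_formula_convex_simple[OF _ Ghol])
        show "path_image C \<subseteq> UNIV - {0}" using C_img R by auto
        have "exp (\<i> * of_real (3 * pi / 2)) = - \<i>"
        proof -
          have "cos (3 * pi / 2) = 0" "sin (3 * pi / 2) = - 1"
            using cos_periodic_pi[of "pi / 2"] sin_periodic_pi[of "pi / 2"] by (simp_all add: algebra_simps)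
          then show ?thesis by (simp only: cis_conv_exp[symmetric]) (simp add: complex_eq_iff)
        qed
        then show "pathfinish C = pathstart C"
          unfolding C_def pathstart_part_circlepath pathfinish_part_circlepath i_exp by simp
      qed (use valid in auto)
      then have "((\<lambda>z. G z / z) has_contour_integral (2 * pi * \<i> * G 0)) C" by (simp add: wind)
      moreover have "G 0 = S 0" by (simp add: G_def)
      ultimately show ?thesis using has_contour_integral_unique[OF int1] by simp
    qed
    define D1 where "D1 = contour_integral C1 (\<lambda>z. f z - G z / z)"
    have D1: "D1 = contour_integral C1 f - contour_integral C1 (\<lambda>z. G z / z)"
      unfolding D1_def using int_f(1) int_G(1) by (rule contour_integral_diff)
    have D1_le: "norm D1 \<le> 2 / R\<^sup>2 * R * \<bar>pi / 2 - - (pi / 2)\<bar>"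
      unfolding D1_def C1_def
    proof (rule contour_integral_bound_part_circlepath)
      show "(\<lambda>z. f z - G z / z) contour_integrable_on part_circlepath 0 R (- (pi / 2)) (pi / 2)"
        using contour_integrable_diff[OF int_f(1) int_G(1)] by (simp add: C1_def)
      fix z assume "z \<in> path_image (part_circlepath 0 R (- (pi / 2)) (pi / 2))"
      then have z: "norm z = R" "Re z \<ge> 0" using C1_img[of z] by (auto simp: C1_def)
      have z0: "z \<noteq> 0" using z R by auto
      have "f z - G z / z = (z / Hzeta (1 + z) - S z) * k z"
      proof -
        have "rpow (real N) z * (1 + z\<^sup>2 / (of_real R)\<^sup>2) = z * k z"
          unfolding k_def using z0 by (simp add: distrib_left power2_eq_square mult_ac)
        then have "f z = (1 / Hzeta (1 + z)) * (z * k z)" unfolding f_def q_def by (simp add: mult_ac)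
        then show ?thesis unfolding GS[OF z0] by (simp add: left_diff_distrib)
      qed
      then have eq: "norm (f z - G z / z) = norm (z / Hzeta (1 + z) - S z) * (real N powr Re z * (2 * \<bar>Re z\<bar> / R\<^sup>2))"
        by (simp add: norm_mult norm_k[OF z(1)])
      show "norm (f z - G z / z) \<le> 2 / R\<^sup>2"
      proof (cases "Re z = 0")
        case True
        then show ?thesis unfolding eq by simp
      next
        case False
        then have x: "Re z > 0" using z by simp
        have "norm (f z - G z / z) \<le> (real N powr (- Re z) / Re z) * (real N powr Re z * (2 * \<bar>Re z\<bar> / R\<^sup>2))"
          unfolding eq S_def by (intro mult_right_mono moebius_remainder_le x N) auto
        also have "\<dots> = 2 / R\<^sup>2" using x N0 by (simp add: powr_minus field_simps)
        finally show ?thesis .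
      qed
    qed (use R in auto)
    define D2 where "D2 = contour_integral C2 (\<lambda>z. G z / z)"
    have D2_le: "norm D2 \<le> (2 / R\<^sup>2 + 2 / (R * real N)) * R * \<bar>3 * pi / 2 - pi / 2\<bar>"
      unfolding D2_def C2_def
    proof (rule contour_integral_bound_part_circlepath)
      show "(\<lambda>z. G z / z) contour_integrable_on part_circlepath 0 R (pi / 2) (3 * pi / 2)"
        using int_G(2) by (simp add: C2_def)
      fix z assume "z \<in> path_image (part_circlepath 0 R (pi / 2) (3 * pi / 2))"
      then have z: "norm z = R" "Re z \<le> 0" using C2_img[of z] by (auto simp: C2_def)
      have z0: "z \<noteq> 0" using z R by auto
      have eq: "norm (G z / z) = norm (S z) * (real N powr Re z * (2 * \<bar>Re z\<bar> / R\<^sup>2))"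
        unfolding GS[OF z0] by (simp add: norm_mult norm_k[OF z(1)])
      show "norm (G z / z) \<le> 2 / R\<^sup>2 + 2 / (R * real N)"
      proof (cases "Re z = 0")
        case True
        then show ?thesis unfolding eq using R by simp
      next
        case False
        then have x: "Re z < 0" using z by simp
        define y where "y = - Re z"
        have y: "y > 0" "y \<le> R" using x abs_Re_le_cmod[of z] z by (auto simp: y_def)
        have "norm (G z / z) \<le> (real N powr (- Re z) * (1 / - Re z + 1 / real N)) * (real N powr Re z * (2 * \<bar>Re z\<bar> / R\<^sup>2))"
          unfolding eq S_def by (intro mult_right_mono norm_moebius_partial_le x N) auto
        also have "\<dots> = (real N powr y * real N powr (- y)) * ((1 / y + 1 / real N) * (2 * y / R\<^sup>2))"
          using x by (simp add: y_def)
        also have "real N powr y * real N powr (- y) = 1" using N0 by (simp add: powr_minus)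
        also have "1 * ((1 / y + 1 / real N) * (2 * y / R\<^sup>2)) = 2 / R\<^sup>2 + 2 * y / (R\<^sup>2 * real N)"
          using y N0 R by (simp add: field_simps)
        also have "2 * y / (R\<^sup>2 * real N) \<le> 2 * R / (R\<^sup>2 * real N)" using y N0 R by (intro divide_right_mono) auto
        also have "2 * R / (R\<^sup>2 * real N) = 2 / (R * real N)" using R by (simp add: power2_eq_square)
        finally show ?thesis by simp
      qed
    qed (use R N0 in auto)
    have f_le: "norm (f z) \<le> real N powr Re z * B" if "z \<in> K" for z
      unfolding f_def norm_mult norm_rpow[OF N0] using B[OF that] by (intro mult_left_mono) auto
    have f_le': "norm (f z) \<le> B" if "z \<in> K" for z
    proof -
      have "Re z \<le> 0" using that by (simp add: K_def in_cbox_complex_iff)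
      then have "real N powr Re z \<le> real N powr 0" using N by (intro powr_mono) auto
      then have "real N powr Re z * B \<le> 1 * B" using B0 N0 by (intro mult_right_mono) auto
      then show ?thesis using f_le[OF that] by simp
    qed
    have L1_le: "norm (contour_integral L1 f) \<le> 1 / R"
    proof -
      have "norm (contour_integral L1 f) \<le> B * norm ((- of_real d + \<i> * of_real R) - \<i> * of_real R)"
        using has_contour_integral_integral[OF int_f(2)] segs(1) f_le' B0 unfolding L1_def
        by (intro has_contour_integral_bound_linepath) auto
      then show ?thesis using d by simp
    qed
    have L3_le: "norm (contour_integral L3 f) \<le> 1 / R"
    proof -
      have "norm (contour_integral L3 f) \<le> B * norm ((- \<i> * of_real R) - (- of_real d - \<i> * of_real R))"
        using has_contour_integral_integral[OF int_f(4)] segs(3) f_le' B0 unfolding L3_def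
        by (intro has_contour_integral_bound_linepath) auto
      then show ?thesis using d by simp
    qed
    have L2_le: "norm (contour_integral L2 f) \<le> (B * (2 * R)) * real N powr (- d)"
    proof -
      have "norm (contour_integral L2 f) \<le> (real N powr (- d) * B) * norm ((- of_real d - \<i> * of_real R) - (- of_real d + \<i> * of_real R))"
      proof (rule has_contour_integral_bound_linepath)
        show "(f has_contour_integral contour_integral L2 f) (linepath (- of_real d + \<i> * of_real R) (- of_real d - \<i> * of_real R))"
          using has_contour_integral_integral[OF int_f(3)] unfolding L2_def .
        fix z assume z: "z \<in> closed_segment (- of_real d + \<i> * of_real R) (- of_real d - \<i> * of_real R)"
        then obtain v where "z = (1 - v) *\<^sub>R (- of_real d + \<i> * of_real R) + v *\<^sub>R (- of_real d - \<i> * of_real R)"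
          by (auto simp: closed_segment_def)
        then have "Re z = Re ((1 - v) *\<^sub>R (- of_real d + \<i> * of_real R) + v *\<^sub>R (- of_real d - \<i> * of_real R))"
          by (rule arg_cong)
        also have "\<dots> = (1 - v) * (- d) + v * (- d)" by simp
        also have "\<dots> = - d" by (simp add: algebra_simps)
        finally have "Re z = - d" .
        then show "norm (f z) \<le> real N powr (- d) * B" using f_le[of z] z segs(2) by auto
      qed (use B0 in auto)
      also have "(- of_real d - \<i> * of_real R) - (- of_real d + \<i> * of_real R) = - (2 * \<i> * of_real R)" by simp
      also have "norm (- (2 * \<i> * of_real R) :: complex) = 2 * R" using R by (simp add: norm_mult)
      finally show ?thesis by (simp add: mult_ac)
    qed
    \<comment> \<open>Cauchy's theorem for \<open>f\<close> trades its integral over the right arc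
      for the three sides on the left; subtracting the circle integral of \<open>G z / z\<close>
      leaves the remainder on the right arc and the partial sum on the left arc.\<close>
    have S0: "2 * pi * \<i> * S 0 = - (contour_integral L1 f + (contour_integral L2 f + contour_integral L3 f)) - D1 + D2"
    proof -
      have "- (contour_integral L1 f + (contour_integral L2 f + contour_integral L3 f)) = contour_integral C1 f"
        using minus_unique[of "contour_integral L1 f + (contour_integral L2 f + contour_integral L3 f)" "contour_integral C1 f"] zero
        by (simp only: add.commute)
      then show ?thesis unfolding circ[symmetric] D1 D2_def by simp
    qed
    have "norm (2 * pi * \<i> * S 0) \<le> norm (contour_integral L1 f) + (norm (contour_integral L2 f) + norm (contour_integral L3 f)) + norm D1 + norm D2"
    proof -
      have "norm (- (a + (b + c)) - x + y) \<le> norm a + (norm b + norm c) + norm x + norm y" for a b c x y :: complex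
        using norm_triangle_ineq[of "- (a + (b + c)) - x" y] norm_triangle_ineq4[of "- (a + (b + c))" x]
          norm_minus_cancel[of "a + (b + c)"] norm_triangle_ineq[of a "b + c"] norm_triangle_ineq[of b c] by linarith
      then show ?thesis unfolding S0 .
    qed
    also have "\<dots> \<le> 1 / R + ((B * (2 * R)) * real N powr (- d) + 1 / R) + 2 / R\<^sup>2 * R * \<bar>pi / 2 - - (pi / 2)\<bar>
        + (2 / R\<^sup>2 + 2 / (R * real N)) * R * \<bar>3 * pi / 2 - pi / 2\<bar>"
      by (intro add_mono L1_le L2_le L3_le D1_le D2_le)
    also have "\<dots> = (4 * pi + 2) / R + 2 * pi / real N + (B * (2 * R)) * real N powr (- d)"
      using R N0 by (simp add: field_simps power2_eq_square)
    finally show ?thesis by (simp add: S_def norm_mult)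
  qed
  show ?thesis using d(1) main by blast
qed

section \<open>Mean value of the Moebius function and conclusion\<close>

lemma moebius_partial_tendsto: "(\<lambda>N. moebius_partial N 1) \<longlonglongrightarrow> 0"
proof (rule tendsto_norm_zero_cancel, rule order_tendstoI)
  fix e :: real assume e: "e > 0"
  \<comment> \<open>The term that does not decay in N becomes e, while 2 pi e is allowed.\<close>
  define R where "R = (4 * pi + 2) / e"
  have "4 * pi + 2 > 0" using pi_gt_zero by linarith
  then have R: "R > 0" "(4 * pi + 2) / R = e" using e by (auto simp: R_def)
  obtain d B where d: "d > 0" and bound: "\<And>N. N \<ge> 1 \<Longrightarrow> 2 * pi * norm (moebius_partial N 1) \<le>
     (4 * pi + 2) / R + 2 * pi / real N + B * real N powr (- d)"
    using Newman_moebius[OF R(1)] by blast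
  have "(\<lambda>N. e + 2 * pi / real N + B * real N powr (- d)) \<longlonglongrightarrow> e + 0 + B * 0"
    using d by (intro tendsto_intros) real_asymp+
  moreover have "e + 0 + B * 0 < 2 * pi * e" using e pi_gt3 mult_strict_right_mono[of 1 "2 * pi" e] by simp
  ultimately have "\<forall>\<^sub>F N in sequentially. e + 2 * pi / real N + B * real N powr (- d) < 2 * pi * e"
    by (rule order_tendstoD(2))
  then show "\<forall>\<^sub>F N in sequentially. norm (moebius_partial N 1) < e"
    using eventually_ge_at_top[of 1]
  proof eventually_elim
    case (elim N)
    have "2 * pi * norm (moebius_partial N 1) < 2 * pi * e" using bound[OF elim(2)] elim(1) R(2) by linarith
    then show ?case using pi_gt_zero by simp
  qed
next
  fix e :: real assume "e < 0"
  then show "\<forall>\<^sub>F N in sequentially. e < norm (moebius_partial N 1)"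
    by (intro always_eventually allI) (rule less_le_trans[OF _ norm_ge_zero])
qed

text \<open>Abel summation: the sum of \<mu> is N times the logarithmically weighted sum
  \<open>a N\<close> minus the sum of the earlier \<open>a n\<close>. Both parts are o(N), the
  second as a Cesaro mean of a null sequence.\<close>

theorem moebius_mean_value:
  fixes delta :: real
  assumes delta: "delta > 0"
  shows "\<forall>\<^sub>F N in sequentially. \<bar>\<Sum>n<N. real_of_int (moebius_mu n)\<bar> \<le> delta * real N"
proof -
  define mu where "mu n = real_of_int (moebius_mu n)" for n
  define a where "a N = (\<Sum>n<N. mu (n + 1) / real (n + 1))" for N
  have a_eq: "moebius_partial N 1 = of_real (a N)" for N
  proof -
    have "npow 1 (n + 1) = of_real (1 / real (n + 1))" for n
    proof -
      have "npow 1 (n + 1) = of_real (real (n + 1) powr (- 1))"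
        unfolding npow_def using rpow_of_real[of "real (n + 1)" "- 1"] by simp
      also have "real (n + 1) powr (- 1) = 1 / real (n + 1)" by (subst powr_minus) (simp add: divide_inverse)
      finally show ?thesis .
    qed
    then show ?thesis unfolding moebius_partial_def a_def mu_def by simp
  qed
  have "(\<lambda>N. complex_of_real (a N)) \<longlonglongrightarrow> of_real 0"
    using moebius_partial_tendsto unfolding a_eq by simp
  then have "a \<longlonglongrightarrow> 0" by (simp only: tendsto_of_real_iff)
  then have "\<forall>\<^sub>F N in sequentially. dist (a N) 0 < delta / 4" by (rule tendstoD) (use delta in simp)
  then obtain n0 where n0: "\<And>n. n \<ge> n0 \<Longrightarrow> \<bar>a n\<bar> \<le> delta / 4"
    unfolding eventually_sequentially by (auto intro: less_imp_le)
  have abel: "(\<Sum>n<N. mu (n + 1)) = real N * a N - (\<Sum>n<N. a n)" for N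
  proof (induction N)
    case (Suc N)
    have "a (Suc N) = a N + mu (N + 1) / real (N + 1)" by (simp add: a_def)
    then have "real (Suc N) * a (Suc N) = real (Suc N) * a N + mu (N + 1)" by (simp add: distrib_left)
    then show ?case using Suc.IH by (simp add: algebra_simps)
  qed simp
  define A where "A = (\<Sum>n<n0. \<bar>a n\<bar>)"
  have sum_a: "(\<Sum>n<N. \<bar>a n\<bar>) \<le> A + delta / 4 * real N" for N
  proof -
    have "(\<Sum>n<N. \<bar>a n\<bar>) \<le> (\<Sum>n<N. (if n < n0 then \<bar>a n\<bar> else 0) + delta / 4)"
      using n0 delta by (intro sum_mono) (auto simp: not_less)
    also have "\<dots> = (\<Sum>n<N. (if n < n0 then \<bar>a n\<bar> else 0)) + delta / 4 * real N" by (simp add: sum.distrib)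
    also have "(\<Sum>n<N. (if n < n0 then \<bar>a n\<bar> else 0)) = (\<Sum>n\<in>{..<N} \<inter> {..<n0}. \<bar>a n\<bar>)"
      by (subst sum.inter_restrict) auto
    also have "\<dots> \<le> A" unfolding A_def by (intro sum_mono2) auto
    finally show ?thesis by simp
  qed
  have "\<forall>\<^sub>F N in sequentially. real N \<ge> (A + 1) * (2 / delta)"
    using filterlim_real_sequentially unfolding filterlim_at_top by blast
  then show ?thesis using eventually_ge_at_top[of n0]
  proof eventually_elim
    case (elim N)
    have "(\<Sum>n<N. mu n) = (\<Sum>n<N. mu (n + 1)) + mu 0 - mu N"
    proof -
      have "(\<Sum>n<N. mu (Suc n) - mu n) = mu N - mu 0" by (rule sum_lessThan_telescope)
      then show ?thesis by (simp add: sum_subtractf)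
    qed
    moreover have "mu 0 = 0" by (simp add: mu_def moebius_mu_def)
    moreover have "\<bar>mu N\<bar> \<le> 1" unfolding mu_def by (rule abs_moebius_mu_le)
    ultimately have "\<bar>\<Sum>n<N. mu n\<bar> \<le> \<bar>\<Sum>n<N. mu (n + 1)\<bar> + 1" by linarith
    also have "\<dots> \<le> real N * \<bar>a N\<bar> + (\<Sum>n<N. \<bar>a n\<bar>) + 1"
    proof -
      have "\<bar>real N * a N\<bar> = real N * \<bar>a N\<bar>" by (simp add: abs_mult)
      then show ?thesis
        unfolding abel using sum_abs[of a "{..<N}"] abs_triangle_ineq4[of "real N * a N" "\<Sum>n<N. a n"] by linarith
    qed
    also have "\<dots> \<le> real N * (delta / 4) + (A + delta / 4 * real N) + 1"
      using n0[OF elim(2)] sum_a by (intro add_mono mult_left_mono) auto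
    also have "\<dots> \<le> real N * (delta / 4) + delta / 4 * real N + delta / 2 * real N"
    proof -
      have "A + 1 \<le> delta / 2 * real N" using elim(1) delta by (simp add: field_simps)
      then show ?thesis by linarith
    qed
    also have "\<dots> = delta * real N" by simp
    finally show ?case unfolding mu_def .
  qed
qed

section \<open>Divergence of the reciprocals of the odd primes\<close>

lemma one_minus_ge_exp:
  fixes x :: real
  assumes "0 \<le> x" "x \<le> 1 / 2"
  shows "exp (- 2 * x) \<le> 1 - x"
proof -
  have "2 * x\<^sup>2 \<le> x" using assms mult_right_mono[of x "1/2" x] by (simp add: power2_eq_square)
  then have "- 2 * x \<le> ln (1 - x)" using ln_one_minus_pos_lower_bound[OF assms] by linarith
  then have "exp (- 2 * x) \<le> exp (ln (1 - x))" by (simp only: exp_le_cancel_iff)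
  then show ?thesis using assms by simp
qed

text \<open>If the sums were bounded, the finite Euler products would bound \<zeta>(x) uniformly for
  x > 1, whereas (x - 1) \<zeta>(x) tends to 1 as x decreases to 1.\<close>

lemma odd_prime_reciprocals_unbounded:
  fixes C :: real
  shows "\<exists>P\<subseteq>{p::nat. prime p \<and> odd p}. finite P \<and> C \<le> (\<Sum>p\<in>P. 1 / real p)"
proof (rule ccontr)
  assume "\<not> ?thesis"
  then have C: "(\<Sum>p\<in>P. 1 / real p) < C" if "P \<subseteq> {p. prime p \<and> odd p}" "finite P" for P
    using that by (meson not_le)
  define A where "A = primes_upto"
  have finA: "finite (A N)" for N by (simp add: A_def)
  have sumA: "(\<Sum>p\<in>A N. 1 / real p) \<le> C + 1" for N
  proof -
    have "(\<Sum>p\<in>A N. 1 / real p) \<le> (\<Sum>p\<in>insert 2 (A N - {2}). 1 / real p)" using finA by (intro sum_mono2) auto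
    also have "\<dots> = 1 / 2 + (\<Sum>p\<in>A N - {2}. 1 / real p)" using finA by (subst sum.insert) auto
    also have "(\<Sum>p\<in>A N - {2}. 1 / real p) < C"
    proof (rule C)
      show "A N - {2} \<subseteq> {p. prime p \<and> odd p}"
      proof
        fix p assume "p \<in> A N - {2}"
        then have p: "prime p" "p \<noteq> 2" by (auto simp: A_def primes_upto_def)
        then have "p > 2" using prime_ge_2_nat[of p] by simp
        then show "p \<in> {p. prime p \<and> odd p}" using p prime_odd_nat[of p] by simp
      qed
    qed (use finA in simp)
    finally show ?thesis by simp
  qed
  have bound: "norm (zeta_sum (of_real x)) \<le> exp (2 * (C + 1))" if x: "x > 1" for x :: real
  proof -
    have Re: "Re (complex_of_real x) > 1" using x by simp
    define Z where "Z N = infsum (npow (of_real x)) (coprime_to (A N))" for N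
    have "Z \<longlonglongrightarrow> npow (of_real x) 1"
      unfolding Z_def A_def by (rule infsum_coprime_to_primes_tendsto[OF abs_summable_npow[OF Re]])
    then have lim: "(\<lambda>N. norm (Z N)) \<longlonglongrightarrow> 1" using tendsto_norm[of Z "npow (of_real x) 1"] by (simp add: npow_def)
    have "norm (zeta_sum (of_real x)) * exp (- 2 * (C + 1)) \<le> norm (Z N)" for N
    proof -
      have factor: "exp (- 2 * (1 / real p)) \<le> norm (1 - npow (of_real x) p)" if p: "p \<in> A N" for p
      proof -
        have p2: "real p \<ge> 2" using p prime_ge_2_nat by (auto simp: A_def primes_upto_def)
        have "real p powr (- x) \<le> real p powr (- 1)" using p2 x by (intro powr_mono) auto
        also have "real p powr (- 1) = 1 / real p" using p2 by (subst powr_minus) (simp add: divide_inverse)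
        finally have le: "real p powr (- x) \<le> 1 / real p" .
        have "exp (- 2 * (1 / real p)) \<le> 1 - 1 / real p" using p2 by (intro one_minus_ge_exp) (auto simp: field_simps)
        also have "\<dots> \<le> 1 - real p powr (- x)" using le by simp
        also have "\<dots> = norm (1::complex) - norm (npow (of_real x) p)" using p2 by (subst norm_npow) auto
        also have "\<dots> \<le> norm (1 - npow (of_real x) p)" by (rule norm_triangle_ineq2)
        finally show ?thesis .
      qed
      have "exp (- 2 * (C + 1)) \<le> exp (- 2 * (\<Sum>p\<in>A N. 1 / real p))" using sumA[of N] by simp
      also have "\<dots> = (\<Prod>p\<in>A N. exp (- 2 * (1 / real p)))" using finA by (simp add: sum_distrib_left exp_sum)
      also have "\<dots> \<le> (\<Prod>p\<in>A N. norm (1 - npow (of_real x) p))" using factor by (intro prod_mono) auto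
      also have "\<dots> = norm (\<Prod>p\<in>A N. 1 - npow (of_real x) p)" by (rule prod_norm)
      finally have "norm (zeta_sum (of_real x)) * exp (- 2 * (C + 1)) \<le> norm (zeta_sum (of_real x)) * norm (\<Prod>p\<in>A N. 1 - npow (of_real x) p)"
        by (intro mult_left_mono) auto
      also have "\<dots> = norm (Z N)"
        unfolding Z_def norm_mult[symmetric] by (subst infsum_npow_coprime_to[OF Re finA]) (auto simp: A_def primes_upto_def)
      finally show ?thesis .
    qed
    then have "norm (zeta_sum (of_real x)) * exp (- 2 * (C + 1)) \<le> 1" by (intro LIMSEQ_le_const[OF lim]) blast
    then have "norm (zeta_sum (of_real x)) * exp (- 2 * (C + 1)) * exp (2 * (C + 1)) \<le> 1 * exp (2 * (C + 1))"
      by (intro mult_right_mono) auto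
    then show ?thesis by (simp add: mult.assoc flip: exp_add)
  qed
  have "((\<lambda>x. Hzeta (of_real x)) \<longlongrightarrow> Hzeta 1) (at_right 1)"
    by (rule isCont_tendsto_compose[OF isCont_Hzeta]) (auto intro!: tendsto_eq_intros)
  then have 1: "((\<lambda>x. norm (Hzeta (of_real x))) \<longlongrightarrow> 1) (at_right 1)" using tendsto_norm by fastforce
  have 2: "((\<lambda>x. (x - 1) * exp (2 * (C + 1))) \<longlongrightarrow> (1 - 1) * exp (2 * (C + 1))) (at_right 1)" by (intro tendsto_intros)
  have "\<forall>\<^sub>F x in at_right (1::real). x > 1" by (rule eventually_at_right_less)
  then have "\<forall>\<^sub>F x in at_right (1::real). norm (Hzeta (of_real x)) \<le> (x - 1) * exp (2 * (C + 1))"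
  proof eventually_elim
    case (elim x)
    have "norm (Hzeta (of_real x)) = norm (complex_of_real (x - 1)) * norm (zeta_sum (of_real x))"
      using Hzeta_eq[of "of_real x"] elim by (simp add: norm_mult)
    also have "norm (complex_of_real (x - 1)) = x - 1" unfolding norm_of_real using elim by simp
    finally show ?case using bound[OF elim] elim by (simp add: mult_left_mono)
  qed
  then have "1 \<le> (1 - 1) * exp (2 * (C + 1))"
    by (intro tendsto_le[OF _ 2 1]) (simp_all add: trivial_limit_at_right_real)
  then show False by simp
qed

section \<open>Assembling the two contributions\<close>

lemma thue_morse_eq: "real (thue_morse n) = (1 - tm_sign n) / 2"
  unfolding thue_morse_def tm_sign_def by (cases "even (binary_digit_sum n)") (auto simp: even_iff_mod_2_eq_zero odd_iff_mod_2_eq_one)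

theorem theorem1:
  shows "(\<lambda>N::nat. \<Sum>n<N. real_of_int (moebius_mu n) * real (thue_morse (n ^ 2))) \<in> o(\<lambda>N. real N)"
proof (rule landau_o.smallI)
  fix c :: real assume c: "c > 0"
  define F where "F n = tm_sign (n\<^sup>2)" for n
  have "\<forall>\<^sub>F N in sequentially. \<bar>\<Sum>n<N. real_of_int (moebius_mu n) * F n\<bar> \<le> c * real N"
  \<comment> \<open>The prime 2 is left out because the dilates p^2 and q^2 arising from F (p m) F
    (q m) have to be odd.\<close>
  proof (rule Katai_criterion[where A = "{p. prime p \<and> odd p}"])
    fix p q :: nat and e :: real
    assume p: "p \<in> {p. prime p \<and> odd p}" and q: "q \<in> {p. prime p \<and> odd p}" and "p \<noteq> q" and e: "e > 0"
    have "\<forall>\<^sub>F N in sequentially. \<bar>\<Sum>n<N. tm_sign (p\<^sup>2 * n\<^sup>2) * tm_sign (q\<^sup>2 * n\<^sup>2)\<bar> \<le> e * real N"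
      using p q \<open>p \<noteq> q\<close> e by (intro tm_squares_dilates_orthogonal) auto
    then show "\<forall>\<^sub>F N in sequentially. \<bar>\<Sum>m<N. F (p * m) * F (q * m)\<bar> \<le> e * real N"
      by (simp add: F_def power_mult_distrib)
  qed (use c odd_prime_reciprocals_unbounded in \<open>auto simp: F_def\<close>)
  then show "\<forall>\<^sub>F N in sequentially. norm (\<Sum>n<N. real_of_int (moebius_mu n) * real (thue_morse (n ^ 2))) \<le> c * norm (real N)"
    using moebius_mean_value[OF c]
  proof eventually_elim
    case (elim N)
    have "(\<Sum>n<N. real_of_int (moebius_mu n) * real (thue_morse (n ^ 2))) =
       ((\<Sum>n<N. real_of_int (moebius_mu n)) - (\<Sum>n<N. real_of_int (moebius_mu n) * F n)) / 2"
      unfolding thue_morse_eq F_def by (simp add: sum_subtractf[symmetric] sum_divide_distrib algebra_simps diff_divide_distrib)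
    then show ?case using elim by simp
  qed
qed

end
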